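(* Let $\tau\ge1$ be an integer and let $H$ be the hypergraph representation of the network defined by $\{\mathcal{I}_j\}$. If some protocol for $\{\mathcal{I}_j\}$ generates $\tau$ secret keys, then $\mathsf{S}^{(\tau)}_{\mathrm{L}}(\{\mathcal{I}_j\})=\varrho_\tau(H)-\tau$.
   Context: Network model: $n$ clients $c_1,\dots,c_n$, finite sets $\mathcal{I}_1,\dots,\mathcal{I}_n$ of message indices (the family $\{\mathcal{I}_j\}$); messages $X_i$ ($i\in\bigcup_j\mathcal{I}_j$) i.i.d. uniform on a finite field $\mathbb{F}$ with $|\mathbb{F}|>n$; client $c_j$ holds $\{X_i:i\in\mathcal{I}_j\}$; $\underline{X}$ is the vector of all messages. A protocol: in each of $t$ rounds one client broadcasts to all an element of $\mathbb{F}$ that is a function of its own messages, the round index, and all previous broadcasts; $\mathbf{T}(\underline{X})\in\mathbb{F}^t$ collects the broadcasts. Linear protocol: each broadcast is an $\mathbb{F}$-linear combination of the transmitter's messages. A protocol generates $\tau$ secret keys if there are functions $\mathsf{k}_j$ with $K=\mathsf{k}_1(\{X_i:i\in\mathcal{I}_1\},\mathbf{T}(\underline{X}))$ such that (i) $\mathsf{k}_j(\{X_i:i\in\mathcal{I}_j\},\mathbf{T}(\underline{X}))=K$ a.s. for all $j$; (ii) $K$ is uniform on $\mathbb{F}^\tau$; (iii) $I(K;\mathbf{T}(\underline{X}))=0$. $\mathsf{S}^{(\tau)}_{\mathrm{L}}(\{\mathcal{I}_j\})$ is the minimum number of transmissions of a linear protocol generating $\tau$ secret keys. The hypergraph representation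 of $\{\mathcal{I}_j\}$ has vertex set $\{c_1,\dots,c_n\}$ and one hyperedge for each index $e\in\bigcup_j\mathcal{I}_j$ (repeated hyperedges allowed), with $c_j\in e$ iff $e\in\mathcal{I}_j$. A multigraph is induced by a hypergraph $H=(\mathcal{V},\mathcal{E})$ if its edge multiset decomposes as a disjoint union of edge sets of simple graphs $G_e=(e,E_e)$, $e\in\mathcal{E}$, each a connected simple graph on vertex set $e$. $H$ is inherently $\tau$-connected if every multigraph induced by $H$ contains at least $\tau$ edge-disjoint spanning trees. $\varrho_\tau(H)=\min\{|\mathcal{E}'|:\mathcal{E}'\subseteq\mathcal{E},\ (\mathcal{V},\mathcal{E}')\text{ inherently }\tau\text{-connected}\}$. *)

theory Defs
  imports Complex_Main "HOL-Library.FuncSet"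
begin

text \<open>Clients are c_0, ..., c_(n-1) (the paper's c_1, ..., c_n); client j holds the
messages indexed by I j.  Message indices have an arbitrary type 'm.\<close>

definition msg_indices :: "nat \<Rightarrow> (nat \<Rightarrow> 'm set) \<Rightarrow> 'm set" where
  "msg_indices n I = (\<Union>j<n. I j)"

text \<open>Sample space of the message vector: all assignments of field elements to the
message indices; the messages are i.i.d. uniform, i.e. the uniform distribution on it.\<close>
definition msg_space :: "'f::{finite,field} itself \<Rightarrow> nat \<Rightarrow> (nat \<Rightarrow> 'm set) \<Rightarrow> ('m \<Rightarrow> 'f) set" where
  "msg_space _ n I = PiE (msg_indices n I) (\<lambda>_. UNIV)"

definition prob_u :: "'a set \<Rightarrow> ('a \<Rightarrow> bool) \<Rightarrow> real" where
  "prob_u \<Omega> P = real (card {x\<in>\<Omega>. P x}) / real (card \<Omega>)"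

definition mutual_info_u :: "'a set \<Rightarrow> ('a \<Rightarrow> 'b) \<Rightarrow> ('a \<Rightarrow> 'c) \<Rightarrow> real" where
  "mutual_info_u \<Omega> X Y =
     (\<Sum>a\<in>X ` \<Omega>. \<Sum>b\<in>Y ` \<Omega>.
        (let pab = prob_u \<Omega> (\<lambda>x. X x = a \<and> Y x = b) in
         if pab = 0 then 0
         else pab * log 2 (pab / (prob_u \<Omega> (\<lambda>x. X x = a) * prob_u \<Omega> (\<lambda>x. Y x = b)))))"

text \<open>A protocol: in round r client s r broadcasts g r (its own messages) (previous broadcasts).
The round index is the first argument of g.  trans gives the first r broadcasts.\<close>
fun trans :: "(nat \<Rightarrow> 'm set) \<Rightarrow> (nat \<Rightarrow> nat) \<Rightarrow> (nat \<Rightarrow> ('m \<Rightarrow> 'f) \<Rightarrow> 'f list \<Rightarrow> 'f)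
              \<Rightarrow> ('m \<Rightarrow> 'f) \<Rightarrow> nat \<Rightarrow> 'f list" where
  "trans I s g x 0 = []"
| "trans I s g x (Suc r) =
     trans I s g x r @ [g r (restrict x (I (s r))) (trans I s g x r)]"

definition generates_keys ::
  "'f::{finite,field} itself \<Rightarrow> nat \<Rightarrow> (nat \<Rightarrow> 'm set) \<Rightarrow> nat \<Rightarrow> nat \<Rightarrow> (nat \<Rightarrow> nat)
   \<Rightarrow> (nat \<Rightarrow> ('m \<Rightarrow> 'f) \<Rightarrow> 'f list \<Rightarrow> 'f) \<Rightarrow> (nat \<Rightarrow> ('m \<Rightarrow> 'f) \<Rightarrow> 'f list \<Rightarrow> 'f list) \<Rightarrow> bool" where
  "generates_keys F n I tau t s g kf =
     (let \<Omega> = msg_space F n I;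
          T = (\<lambda>x. trans I s g x t);
          K = (\<lambda>x. kf 0 (restrict x (I 0)) (T x))
      in (\<forall>x\<in>\<Omega>. \<forall>j<n. kf j (restrict x (I j)) (T x) = K x)
       \<and> (\<forall>x\<in>\<Omega>. length (K x) = tau)
       \<and> (\<forall>k. length k = tau \<longrightarrow> prob_u \<Omega> (\<lambda>x. K x = k) = 1 / real (card (UNIV :: 'f set) ^ tau))
       \<and> mutual_info_u \<Omega> K T = 0)"

definition protocol_generates ::
  "'f::{finite,field} itself \<Rightarrow> nat \<Rightarrow> (nat \<Rightarrow> 'm set) \<Rightarrow> nat \<Rightarrow> nat \<Rightarrow> bool" where
  "protocol_generates F n I tau t =
     (\<exists>s g kf. (\<forall>r<t. s r < n) \<and> generates_keys F n I tau t s g kf)"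

definition linear_protocol_generates ::
  "'f::{finite,field} itself \<Rightarrow> nat \<Rightarrow> (nat \<Rightarrow> 'm set) \<Rightarrow> nat \<Rightarrow> nat \<Rightarrow> bool" where
  "linear_protocol_generates F n I tau t =
     (\<exists>s (c :: nat \<Rightarrow> 'm \<Rightarrow> 'f) kf. (\<forall>r<t. s r < n) \<and>
        generates_keys F n I tau t s (\<lambda>r y p. \<Sum>i\<in>I (s r). c r i * y i) kf)"

definition S_L :: "'f::{finite,field} itself \<Rightarrow> nat \<Rightarrow> (nat \<Rightarrow> 'm set) \<Rightarrow> nat \<Rightarrow> nat" where
  "S_L F n I tau = (LEAST t. linear_protocol_generates F n I tau t)"

text \<open>An edge of a multigraph is a pair (label, {u,v}); distinct labels give parallel edges.\<close>

definition mg_conn :: "('e \<times> 'v set) set \<Rightarrow> 'v \<Rightarrow> 'v \<Rightarrow> bool" where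
  "mg_conn F = (\<lambda>a b. \<exists>f\<in>F. snd f = {a, b})\<^sup>*\<^sup>*"

definition mg_connected :: "'v set \<Rightarrow> ('e \<times> 'v set) set \<Rightarrow> bool" where
  "mg_connected V F = (\<forall>u\<in>V. \<forall>v\<in>V. mg_conn F u v)"

definition mg_cycle :: "('e \<times> 'v set) set \<Rightarrow> ('e \<times> 'v set) list \<Rightarrow> 'v list \<Rightarrow> bool" where
  "mg_cycle F es vs = (length es \<ge> 2 \<and> length vs = length es \<and> distinct es \<and> distinct vs
      \<and> set es \<subseteq> F
      \<and> (\<forall>i<length es. snd (es ! i) = {vs ! i, vs ! ((i + 1) mod length es)}))"

definition mg_acyclic :: "('e \<times> 'v set) set \<Rightarrow> bool" where
  "mg_acyclic F = (\<not> (\<exists>es vs. mg_cycle F es vs))"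

definition spanning_tree :: "'v set \<Rightarrow> ('e \<times> 'v set) set \<Rightarrow> bool" where
  "spanning_tree V F = ((\<forall>f\<in>F. snd f \<subseteq> V) \<and> mg_connected V F \<and> mg_acyclic F)"

definition has_edge_disjoint_spanning_trees :: "nat \<Rightarrow> 'v set \<Rightarrow> ('e \<times> 'v set) set \<Rightarrow> bool" where
  "has_edge_disjoint_spanning_trees tau V E =
     (\<exists>Ts :: nat \<Rightarrow> ('e \<times> 'v set) set.
        (\<forall>i<tau. Ts i \<subseteq> E \<and> spanning_tree V (Ts i))
      \<and> (\<forall>i<tau. \<forall>j<tau. i \<noteq> j \<longrightarrow> Ts i \<inter> Ts j = {}))"

text \<open>A hypergraph with vertex set V, hyperedge labels Es and hyperedge e having
vertex set inc e (labels allow repeated hyperedges).\<close>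

definition simple_connected_on :: "'v set \<Rightarrow> 'v set set \<Rightarrow> bool" where
  "simple_connected_on W G =
     (G \<subseteq> {{u, v} | u v. u \<in> W \<and> v \<in> W \<and> u \<noteq> v}
      \<and> (\<forall>u\<in>W. \<forall>v\<in>W. (\<lambda>a b. {a, b} \<in> G)\<^sup>*\<^sup>* u v))"

definition induced_mg :: "'e set \<Rightarrow> ('e \<Rightarrow> 'v set set) \<Rightarrow> ('e \<times> 'v set) set" where
  "induced_mg Es G = {(e, p). e \<in> Es \<and> p \<in> G e}"

definition inherently_connected :: "nat \<Rightarrow> 'v set \<Rightarrow> 'e set \<Rightarrow> ('e \<Rightarrow> 'v set) \<Rightarrow> bool" where
  "inherently_connected tau V Es inc =
     (\<forall>G. (\<forall>e\<in>Es. simple_connected_on (inc e) (G e)) \<longrightarrow>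
          has_edge_disjoint_spanning_trees tau V (induced_mg Es G))"

definition rho :: "nat \<Rightarrow> 'v set \<Rightarrow> 'e set \<Rightarrow> ('e \<Rightarrow> 'v set) \<Rightarrow> nat" where
  "rho tau V Es inc = (LEAST k. \<exists>Es'. Es' \<subseteq> Es \<and> card Es' = k \<and> inherently_connected tau V Es' inc)"

text \<open>Hypergraph representation of the network: vertices {0..<n}, one hyperedge per
message index e, with vertex set the clients holding X_e.\<close>
definition hyp_inc :: "nat \<Rightarrow> (nat \<Rightarrow> 'm set) \<Rightarrow> 'm \<Rightarrow> nat set" where
  "hyp_inc n I e = {j. j < n \<and> e \<in> I j}"

end

theory Submission
  imports Defs "HOL-Library.Function_Algebras"
begin

text \<open>By the tree-packing theorem, a hypergraph is inherently \<open>\<tau>\<close>-connected iff every partition of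
  the vertices into \<open>k\<close> blocks satisfies \<open>\<tau> (k - 1) \<le> \<Sum>\<^sub>e (|e| - 1)\<close>, where \<open>|e|\<close> counts the blocks met by \<open>e\<close>.

  Lower bound.  An entropy argument over the blocks of a partition shows that any protocol generating
  \<open>\<tau>\<close> keys forces this inequality.  Given a linear protocol with \<open>t\<close> transmissions, the messages can be
  thinned out to at most \<open>t + \<tau>\<close> ones, such that on these every client decodes everything and the kernel of
  the transmissions still has dimension at least \<open>\<tau>\<close>; the entropy argument then applies to them.

  Upper bound.  The partition inequality for a set of \<open>\<rho>\<close> hyperedges provides integer rates summing to
  \<open>\<rho> - \<tau>\<close>.  Hall's theorem turns the rates into one decodable \<open>0/1\<close> matrix per client, and over a field with more
  than \<open>n\<close> elements these can be merged into one matrix that suits all clients.  The key is a function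
  that is balanced on every fibre of the transcript.\<close>

subsection \<open>Hall's theorem and integer rates\<close>

text \<open>Both the tree packing and the protocol come from one object. The function
  \<open>touching\<close> minus \<open>tau\<close> is submodular on intersecting sets, and the
  partition inequality yields an integer vector \<open>r\<close> below it whose total is its value
  at the whole vertex set. Read as out-degrees, \<open>r\<close> orients an induced multigraph; read
  as numbers of broadcasts, it schedules the protocol. In both uses Hall's condition is the
  complementary lower bound on \<open>r\<close>. The obstacle in the lower bound is that a key may
  mix messages arbitrarily, whereas hyperedges can only be kept or deleted whole. Hence the
  complement in the thinning step must be spanned by coordinates. The entropy argument asks only
  that the key have enough conditional entropy given the transcript, so that afterwards the whole
  vector of surviving messages can play the key. The assumed protocol need not be linear; it
  guarantees that the minimum in \<open>rho\<close> is taken over a nonempty set. One client alone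
  is a separate case, because the partition inequality is void there.\<close>

lemma hall_marriage:
  fixes N :: "'a \<Rightarrow> 'b set"
  assumes "finite A" "\<forall>a\<in>A. finite (N a)"
    and "\<forall>C\<subseteq>A. card C \<le> card (\<Union>(N ` C))"
  shows "\<exists>f. inj_on f A \<and> (\<forall>a\<in>A. f a \<in> N a)"
  using assms
proof (induction "card A" arbitrary: A N rule: less_induct)
  case less
  show ?case
  proof (cases "A = {}")
    case True
    then show ?thesis by simp
  next
    case False
    \<comment> \<open>Either a proper nonempty subset is tight, and the matching splits into that
      subset and the rest with its neighbours removed, or every proper nonempty subset has a spare
      neighbour, and any single pair may be fixed first (Halmos and Vaughan).\<close>
    show ?thesis
    proof (cases "\<exists>C. C \<subset> A \<and> C \<noteq> {} \<and> card C = card (\<Union>(N ` C))")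
      case True
      then obtain C where C: "C \<subset> A" "C \<noteq> {}" "card C = card (\<Union>(N ` C))" by blast
      have finC: "finite C" using C(1) less.prems(1) finite_subset by blast
      have "card C < card A" using C(1) less.prems(1) psubset_card_mono by blast
      then have "\<exists>f. inj_on f C \<and> (\<forall>a\<in>C. f a \<in> N a)"
        using less.prems finC C(1) by (intro less.hyps) auto
      then obtain f where f: "inj_on f C" "\<forall>a\<in>C. f a \<in> N a" by blast
      define N' where "N' = (\<lambda>a. N a - \<Union>(N ` C))"
      have finNC: "finite (\<Union>(N ` C))" using finC less.prems(2) C(1) by auto
      have "\<exists>g. inj_on g (A - C) \<and> (\<forall>a\<in>A - C. g a \<in> N' a)"
      proof (rule less.hyps)
        show "card (A - C) < card A"
          using C less.prems(1) by (intro psubset_card_mono) auto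
        show "finite (A - C)" using less.prems(1) by simp
        show "\<forall>a\<in>A - C. finite (N' a)" using less.prems(2) N'_def by simp
        show "\<forall>D\<subseteq>A - C. card D \<le> card (\<Union>(N' ` D))"
        proof (intro allI impI)
          fix D assume D: "D \<subseteq> A - C"
          then have finD: "finite D" using less.prems(1) finite_subset by blast
          have finND: "finite (\<Union>(N' ` D))" using finD D less.prems(2) N'_def by auto
          \<comment> \<open>Joining the tight set \<open>C\<close> to \<open>D\<close> charges
            \<open>D\<close> only for neighbours that \<open>C\<close> does not use.\<close>
          have "card (D \<union> C) \<le> card (\<Union>(N ` (D \<union> C)))"
            using less.prems(3) D C(1) by blast
          moreover have "card (D \<union> C) = card D + card C"
            using D finD finC by (intro card_Un_disjoint) auto
          moreover have "\<Union>(N ` (D \<union> C)) = \<Union>(N' ` D) \<union> \<Union>(N ` C)"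
            unfolding N'_def by auto
          moreover have "card (\<Union>(N' ` D) \<union> \<Union>(N ` C)) = card (\<Union>(N' ` D)) + card (\<Union>(N ` C))"
            using finND finNC by (intro card_Un_disjoint) (auto simp: N'_def)
          ultimately show "card D \<le> card (\<Union>(N' ` D))" using C(3) by simp
        qed
      qed
      then obtain g where g: "inj_on g (A - C)" "\<forall>a\<in>A - C. g a \<in> N' a" by blast
      define h where "h = (\<lambda>a. if a \<in> C then f a else g a)"
      have "inj_on h A"
      proof (rule inj_onI)
        fix a b assume ab: "a \<in> A" "b \<in> A" "h a = h b"
        have sep: "g b \<noteq> f a" if "b \<in> A - C" "a \<in> C" for a b
        proof -
          have "g b \<notin> \<Union>(N ` C)" "f a \<in> \<Union>(N ` C)"
            using g(2) f(2) that unfolding N'_def by blast+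
          then show ?thesis by metis
        qed
        show "a = b"
        proof (cases "a \<in> C"; cases "b \<in> C")
          assume "a \<in> C" "b \<in> C" then show ?thesis using ab f(1) unfolding h_def by (simp add: inj_onD)
        next
          assume "a \<in> C" "b \<notin> C" then show ?thesis using ab sep[of b a] unfolding h_def by simp
        next
          assume "a \<notin> C" "b \<in> C" then show ?thesis using ab sep[of a b] unfolding h_def by simp
        next
          assume "a \<notin> C" "b \<notin> C" then show ?thesis using ab g(1) unfolding h_def by (simp add: inj_onD)
        qed
      qed
      moreover have "\<forall>a\<in>A. h a \<in> N a" using f g unfolding h_def N'_def by auto
      ultimately show ?thesis by blast
    next
      case no_tight: False
      obtain a where a: "a \<in> A" using False by blast
      have "card {a} \<le> card (\<Union>(N ` {a}))" using less.prems(3) a by blast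
      then have "N a \<noteq> {}" by auto
      then obtain b where b: "b \<in> N a" by blast
      define N' where "N' = (\<lambda>x. N x - {b})"
      have "\<exists>g. inj_on g (A - {a}) \<and> (\<forall>x\<in>A - {a}. g x \<in> N' x)"
      proof (rule less.hyps)
        show "card (A - {a}) < card A" using a less.prems(1) by (rule card_Diff1_less[rotated])
        show "finite (A - {a})" using less.prems(1) by simp
        show "\<forall>x\<in>A - {a}. finite (N' x)" using less.prems(2) N'_def by simp
        show "\<forall>D\<subseteq>A - {a}. card D \<le> card (\<Union>(N' ` D))"
        proof (intro allI impI)
          fix D assume D: "D \<subseteq> A - {a}"
          show "card D \<le> card (\<Union>(N' ` D))"
          proof (cases "D = {}")
            case False
            have "D \<subset> A" using D a by blast
            then have "card D \<noteq> card (\<Union>(N ` D))" "card D \<le> card (\<Union>(N ` D))"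
              using no_tight False less.prems(3) by blast+
            then have "card D < card (\<Union>(N ` D))" by simp
            moreover have "\<Union>(N' ` D) = \<Union>(N ` D) - {b}" unfolding N'_def by auto
            moreover have "card (\<Union>(N ` D)) - 1 \<le> card (\<Union>(N ` D) - {b})"
              by (simp add: card_Diff_singleton_if)
            ultimately show ?thesis by (metis Suc_leI diff_Suc_1 diff_le_mono le_trans)
          qed simp
        qed
      qed
      then obtain g where g: "inj_on g (A - {a})" "\<forall>x\<in>A - {a}. g x \<in> N' x" by blast
      have "inj_on (g(a := b)) A"
      proof (rule inj_onI)
        fix x y assume xy: "x \<in> A" "y \<in> A" "(g(a := b)) x = (g(a := b)) y"
        have "g z \<noteq> b" if "z \<in> A - {a}" for z using g(2) that unfolding N'_def by blast
        then show "x = y" using xy g(1) by (cases "x = a"; cases "y = a") (auto dest: inj_onD)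
      qed
      moreover have "\<forall>x\<in>A. (g(a := b)) x \<in> N x" using g(2) b unfolding N'_def by auto
      ultimately show ?thesis by blast
    qed
  qed
qed

section \<open>Intersecting submodularity and integer bases\<close>

text \<open>A partition is given by a colouring whose fibres are the blocks. Colours are vertex sets
  so that a block can be its own colour, as the tight sets are in
  \<open>partition_connected_base\<close>.\<close>

definition partition_connected :: "nat \<Rightarrow> 'v set \<Rightarrow> 'e set \<Rightarrow> ('e \<Rightarrow> 'v set) \<Rightarrow> bool" where
  "partition_connected tau V E inc \<longleftrightarrow>
     (\<forall>c :: 'v \<Rightarrow> 'v set. tau * (card (c ` V) - 1) \<le> (\<Sum>e\<in>E. card (c ` inc e) - 1))"

definition touching :: "'e set \<Rightarrow> ('e \<Rightarrow> 'v set) \<Rightarrow> 'v set \<Rightarrow> nat" where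
  "touching E inc S = card {e \<in> E. inc e \<inter> S \<noteq> {}}"

text \<open>Meeting the union means meeting \<open>S\<close> or \<open>T\<close>, so the union is
  counted exactly. The slack consists of hyperedges that meet \<open>S\<close> and \<open>T\<close>
  but not \<open>S \<inter> T\<close>.\<close>

lemma touching_submodular:
  assumes "finite E"
  shows "touching E inc (S \<union> T) + touching E inc (S \<inter> T) \<le> touching E inc S + touching E inc T"
proof -
  let ?A = "\<lambda>S. {e \<in> E. inc e \<inter> S \<noteq> {}}"
  have fin: "finite (?A X)" for X using assms by simp
  have "card (?A S) + card (?A T) = card (?A S \<union> ?A T) + card (?A S \<inter> ?A T)"
    using card_Un_Int fin by blast
  moreover have "?A S \<union> ?A T = ?A (S \<union> T)" by auto
  moreover have "card (?A (S \<inter> T)) \<le> card (?A S \<inter> ?A T)"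
    using fin by (intro card_mono) auto
  ultimately show ?thesis unfolding touching_def by presburger
qed

lemma sum_card_colours:
  assumes "finite E" "finite B" "\<And>e. e \<in> E \<Longrightarrow> col e \<subseteq> B"
  shows "(\<Sum>b\<in>B. card {e \<in> E. b \<in> col e}) = (\<Sum>e\<in>E. card (col e))"
proof -
  have "(\<Sum>b\<in>B. card {e \<in> E. b \<in> col e}) = (\<Sum>b\<in>B. \<Sum>e\<in>E. if b \<in> col e then 1 else 0)"
    using assms(1) by (intro sum.cong) (auto simp: sum.If_cases Int_def)
  also have "\<dots> = (\<Sum>e\<in>E. \<Sum>b\<in>B. if b \<in> col e then 1 else 0)"
    by (rule sum.swap)
  also have "\<dots> = (\<Sum>e\<in>E. card (col e))"
  proof (intro sum.cong refl)
    fix e assume "e \<in> E"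
    then have "{b \<in> B. b \<in> col e} = col e" using assms(3) by auto
    then show "(\<Sum>b\<in>B. if b \<in> col e then 1 else 0) = card (col e)"
      using assms(2) by (simp add: sum.If_cases Int_def)
  qed
  finally show ?thesis .
qed

lemma sum_card_colours_minus_1:
  assumes "finite E" "finite B" "\<And>e. e \<in> E \<Longrightarrow> col e \<subseteq> B" "\<And>e. e \<in> E \<Longrightarrow> col e \<noteq> {}"
  shows "(\<Sum>b\<in>B. card {e \<in> E. b \<in> col e}) = (\<Sum>e\<in>E. card (col e) - 1) + card E"
proof -
  have "(\<Sum>e\<in>E. card (col e)) = (\<Sum>e\<in>E. (card (col e) - 1) + 1)"
  proof (intro sum.cong refl)
    fix e assume "e \<in> E"
    then have "card (col e) > 0"
      using assms(2-4) by (metis card_gt_0_iff finite_subset)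
    then show "card (col e) = card (col e) - 1 + 1" by simp
  qed
  then show ?thesis using sum_card_colours[OF assms(1-3)] by (simp add: sum.distrib del: One_nat_def)
qed

text \<open>A vector of largest total below an intersecting submodular function attains the least
  sum of block values over all partitions; the maximal tight sets are the minimising partition. The
  partition inequality says that no partition undercuts the one with a single block, whose value is
  \<open>card E - tau\<close>.\<close>

lemma partition_connected_base:
  fixes inc :: "'e \<Rightarrow> 'v set"
  assumes V: "finite V" "V \<noteq> {}" and E: "finite E"
    and inc: "\<And>e. e \<in> E \<Longrightarrow> inc e \<subseteq> V" "\<And>e. e \<in> E \<Longrightarrow> inc e \<noteq> {}"
    and pc: "partition_connected tau V E inc"
  shows "\<exists>r :: 'v \<Rightarrow> int. (\<forall>S\<subseteq>V. S \<noteq> {} \<longrightarrow> sum r S \<le> int (touching E inc S) - int tau)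
            \<and> sum r V = int (card E) - int tau"
proof -
  define g where "g S = int (touching E inc S) - int tau" for S
  define feas where "feas r \<longleftrightarrow> (\<forall>S\<subseteq>V. S \<noteq> {} \<longrightarrow> sum r S \<le> g S)" for r :: "'v \<Rightarrow> int"
  have gV: "g V = int (card E) - int tau"
  proof -
    have "inc e \<inter> V \<noteq> {}" if "e \<in> E" for e using inc[OF that] by blast
    then have "{e \<in> E. inc e \<inter> V \<noteq> {}} = E" by blast
    then show ?thesis unfolding g_def touching_def by simp
  qed
  have feas0: "feas (\<lambda>_. - int tau)"
    unfolding feas_def
  proof (intro allI impI)
    fix S assume S: "S \<subseteq> V" "S \<noteq> {}"
    then have "card S \<ge> 1" using V by (simp add: Suc_leI card_gt_0_iff finite_subset)
    then have "int (card S) * int tau \<ge> int tau"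
      using mult_right_mono[of 1 "int (card S)" "int tau"] by simp
    then show "(\<Sum>_\<in>S. - int tau) \<le> g S" unfolding g_def by simp
  qed
  \<comment> \<open>\<open>lo\<close> is the total of the feasible constant vector. Among totals of
    at least \<open>lo\<close> the measure \<open>m\<close> loses nothing to \<open>nat\<close>, so
    a maximum over naturals can be taken.\<close>
  define lo where "lo = - int tau * int (card V)"
  define m where "m r = nat (sum r V - lo)" for r :: "'v \<Rightarrow> int"
  define P where "P r \<longleftrightarrow> feas r \<and> lo \<le> sum r V" for r
  have "P (\<lambda>_. - int tau)" using feas0 unfolding P_def lo_def by simp
  moreover have "\<forall>r. P r \<longrightarrow> m r < nat (g V - lo) + 1"
    using V unfolding P_def feas_def m_def by auto
  ultimately obtain r where r: "P r" and rmax: "\<And>r'. P r' \<Longrightarrow> m r' \<le> m r"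
    using ex_has_greatest_nat[of P _ m] by blast
  define tight where "tight S \<longleftrightarrow> S \<subseteq> V \<and> S \<noteq> {} \<and> sum r S = g S" for S
  have ex_tight: "\<exists>S. tight S \<and> v \<in> S" if v: "v \<in> V" for v
  proof (rule ccontr)
    assume no: "\<not> ?thesis"
    \<comment> \<open>All constraints are integral, so a vertex outside every tight set leaves room
      for a full unit, against maximality.\<close>
    define r' where "r' = r(v := r v + 1)"
    have sum': "sum r' S = sum r S + (if v \<in> S then 1 else 0)" if "S \<subseteq> V" for S
    proof -
      have fS: "finite S" using that V finite_subset by blast
      have "sum r' S = (\<Sum>x\<in>S. r x + (if x = v then 1 else 0))"
        unfolding r'_def by (intro sum.cong) auto
      then show ?thesis using fS by (simp add: sum.distrib)
    qed
    have "feas r'"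
      unfolding feas_def
    proof (intro allI impI)
      fix S assume S: "S \<subseteq> V" "S \<noteq> {}"
      have "sum r S \<le> g S" using r S unfolding P_def feas_def by blast
      moreover have "v \<in> S \<Longrightarrow> sum r S \<noteq> g S" using no S unfolding tight_def by blast
      ultimately show "sum r' S \<le> g S" using sum'[OF S(1)] by auto
    qed
    moreover have "sum r' V = sum r V + 1" using sum'[of V] v by simp
    ultimately have "P r'" "m r' > m r" using r unfolding P_def m_def by auto
    then show False using rmax by fastforce
  qed
  \<comment> \<open>Uncrossing. The sets have to intersect, because feasibility gives no bound at
    the empty set, where \<open>g\<close> is \<open>- int tau\<close>.\<close>
  have tight_Un: "tight (S \<union> T)" if "tight S" "tight T" "S \<inter> T \<noteq> {}" for S T
  proof -
    have sub: "S \<subseteq> V" "T \<subseteq> V" "S \<noteq> {}" using that unfolding tight_def by auto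
    have fin: "finite S" "finite T" using sub V finite_subset by blast+
    have "sum r (S \<union> T) + sum r (S \<inter> T) = sum r S + sum r T"
      using fin by (rule sum.union_inter)
    moreover have "sum r S = g S" "sum r T = g T" using that unfolding tight_def by auto
    moreover have "sum r (S \<union> T) \<le> g (S \<union> T)" "sum r (S \<inter> T) \<le> g (S \<inter> T)"
    proof -
      have *: "X \<subseteq> V \<Longrightarrow> X \<noteq> {} \<Longrightarrow> sum r X \<le> g X" for X
        using r unfolding P_def feas_def by simp
      show "sum r (S \<union> T) \<le> g (S \<union> T)" using sub by (intro *) auto
      show "sum r (S \<inter> T) \<le> g (S \<inter> T)" using sub that(3) by (intro *) auto
    qed
    moreover have "g (S \<union> T) + g (S \<inter> T) \<le> g S + g T"
      using touching_submodular[OF E, of inc S T] unfolding g_def by linarith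
    ultimately show ?thesis using sub unfolding tight_def by auto
  qed
  \<comment> \<open>The largest tight set around \<open>v\<close>. Two of these that meet coincide,
    so \<open>M\<close> is a colouring whose blocks are tight.\<close>
  define M where "M v = \<Union>{S. tight S \<and> v \<in> S}" for v
  have tight_M: "tight (M v)" if v: "v \<in> V" for v
  proof -
    have fin: "finite {S. tight S \<and> v \<in> S}"
      using V by (auto simp: tight_def intro: rev_finite_subset[of "Pow V"])
    have *: "finite \<A> \<Longrightarrow> \<A> \<noteq> {} \<Longrightarrow> \<A> \<subseteq> {S. tight S \<and> v \<in> S} \<Longrightarrow> tight (\<Union>\<A>) \<and> v \<in> \<Union>\<A>" for \<A>
    proof (induction \<A> rule: finite_ne_induct)
      case (insert S \<A>)
      then have "tight S" "v \<in> S" "tight (\<Union>\<A>)" "v \<in> \<Union>\<A>" by auto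
      then show ?case using tight_Un[of S "\<Union>\<A>"] by auto
    qed auto
    show ?thesis unfolding M_def using *[OF fin] ex_tight[OF v] by blast
  qed
  have M_self: "v \<in> M v" if "v \<in> V" for v using ex_tight[OF that] unfolding M_def by blast
  have M_sub: "M v \<subseteq> V" if "v \<in> V" for v using tight_M[OF that] unfolding tight_def by blast
  have M_eq: "M u = M v" if "u \<in> V" "v \<in> V" "M u \<inter> M v \<noteq> {}" for u v
  proof -
    have t: "tight (M u \<union> M v)" using tight_Un tight_M that by blast
    have "M u \<union> M v \<subseteq> M u" "M u \<union> M v \<subseteq> M v"
      using t M_self that unfolding M_def by blast+
    then show ?thesis by blast
  qed
  have M_iff: "w \<in> b \<longleftrightarrow> M w = b" if b: "b \<in> M ` V" and w: "w \<in> V" for w b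
  proof
    assume "w \<in> b"
    obtain v where "b = M v" "v \<in> V" using b by blast
    then show "M w = b" using M_eq[of w v] M_self[of w] w \<open>w \<in> b\<close> by blast
  next
    assume "M w = b"
    then show "w \<in> b" using M_self w by blast
  qed
  have "sum r V = (\<Sum>b\<in>M ` V. sum r {v \<in> V. M v = b})"
    using V by (intro sum.image_gen)
  also have "\<dots> = (\<Sum>b\<in>M ` V. g b)"
  proof (intro sum.cong refl)
    fix b assume b: "b \<in> M ` V"
    have "{v \<in> V. M v = b} = b" using M_iff[OF b] M_sub b by blast
    moreover have "tight b" using tight_M b by blast
    ultimately show "sum r {v \<in> V. M v = b} = g b" unfolding tight_def by simp
  qed
  also have "\<dots> = int (\<Sum>b\<in>M ` V. touching E inc b) - int tau * int (card (M ` V))"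
    unfolding g_def by (simp add: sum_subtractf)
  also have "(\<Sum>b\<in>M ` V. touching E inc b) = (\<Sum>b\<in>M ` V. card {e \<in> E. b \<in> M ` inc e})"
  proof (intro sum.cong refl)
    fix b assume b: "b \<in> M ` V"
    have "{e \<in> E. inc e \<inter> b \<noteq> {}} = {e \<in> E. b \<in> M ` inc e}"
    proof (intro Collect_cong conj_cong refl)
      fix e assume "e \<in> E"
      then have "inc e \<subseteq> V" using inc by blast
      then show "(inc e \<inter> b \<noteq> {}) = (b \<in> M ` inc e)" using M_iff[OF b] by blast
    qed
    then show "touching E inc b = card {e \<in> E. b \<in> M ` inc e}" unfolding touching_def by simp
  qed
  also have "\<dots> = (\<Sum>e\<in>E. card (M ` inc e) - 1) + card E"
    using E V inc by (intro sum_card_colours_minus_1) (auto intro!: image_mono)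
  finally have "sum r V = int ((\<Sum>e\<in>E. card (M ` inc e) - 1) + card E) - int tau * int (card (M ` V))" .
  moreover have "tau * (card (M ` V) - 1) \<le> (\<Sum>e\<in>E. card (M ` inc e) - 1)"
    using pc unfolding partition_connected_def by blast
  moreover have "tau * card (M ` V) = tau * (card (M ` V) - 1) + tau"
  proof -
    have "card (M ` V) > 0" using V by (simp add: card_gt_0_iff)
    then obtain k where "card (M ` V) = Suc k" using gr0_implies_Suc by blast
    then show ?thesis by simp
  qed
  ultimately have "sum r V \<ge> int (card E) - int tau"
    by (smt (verit) of_nat_add of_nat_mult of_nat_mono)
  moreover have "sum r V \<le> g V" using r V unfolding P_def feas_def by blast
  ultimately have "sum r V = int (card E) - int tau" using gV by linarith
  moreover have "\<forall>S\<subseteq>V. S \<noteq> {} \<longrightarrow> sum r S \<le> int (touching E inc S) - int tau"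
    using r unfolding P_def feas_def g_def by blast
  ultimately show ?thesis by blast
qed

text \<open>Subtracting the upper bound at \<open>V - S\<close> from the total turns upper bounds
  into lower bounds, the form that Hall's condition takes. \<open>S\<close> is proper because
  nothing is known about \<open>r\<close> on an empty complement.\<close>

lemma base_complement:
  fixes r :: "'v \<Rightarrow> int"
  assumes V: "finite V" and E: "finite E"
    and r: "\<And>S. S \<subseteq> V \<Longrightarrow> S \<noteq> {} \<Longrightarrow> sum r S \<le> int (touching E inc S) - t"
    and rV: "sum r V = int (card E) - t"
    and S: "S \<subset> V"
  shows "int (card {e \<in> E. inc e \<inter> (V - S) = {}}) \<le> sum r S"
proof -
  have "sum r V = sum r S + sum r (V - S)"
    using V S by (metis psubset_imp_subset sum.subset_diff add.commute)
  moreover have "sum r (V - S) \<le> int (touching E inc (V - S)) - t" using r S by blast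
  moreover have "card E = touching E inc (V - S) + card {e \<in> E. inc e \<inter> (V - S) = {}}"
  proof -
    have "E = {e \<in> E. inc e \<inter> (V - S) \<noteq> {}} \<union> {e \<in> E. inc e \<inter> (V - S) = {}}" by blast
    then have "card E = card ({e \<in> E. inc e \<inter> (V - S) \<noteq> {}} \<union> {e \<in> E. inc e \<inter> (V - S) = {}})" by simp
    also have "\<dots> = touching E inc (V - S) + card {e \<in> E. inc e \<inter> (V - S) = {}}"
      unfolding touching_def using E by (intro card_Un_disjoint) auto
    finally show ?thesis .
  qed
  ultimately show ?thesis using rV by linarith
qed

subsection \<open>Tree packing\<close>

lemma rtranclp_leaves:
  assumes "R\<^sup>*\<^sup>* u v" "P u" "\<not> P v"
  shows "\<exists>a b. P a \<and> \<not> P b \<and> R a b"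
  using assms by (induction rule: rtranclp_induct) blast+

text \<open>Contracting the colour classes leaves a connected graph, which has at least as many
  edges as classes minus one. The induction enlarges a set \<open>X\<close> of reached colours; the
  edges used so far stay inside \<open>X\<close>, so an edge that leaves \<open>X\<close> is
  new.\<close>

lemma connected_colour_bound:
  fixes en :: "'e \<Rightarrow> 'v set"
  assumes F: "finite F" and W: "finite W" "W \<noteq> {}" and en: "\<And>f. f \<in> F \<Longrightarrow> en f \<subseteq> W"
    and conn: "\<And>u v. u \<in> W \<Longrightarrow> v \<in> W \<Longrightarrow> (\<lambda>a b. \<exists>f\<in>F. en f = {a, b})\<^sup>*\<^sup>* u v"
  shows "card (c ` W) - 1 \<le> (\<Sum>f\<in>F. card (c ` en f) - 1)"
proof -
  have "\<exists>X D. X \<subseteq> c ` W \<and> card X = Suc j \<and> D \<subseteq> F \<and> (\<forall>f\<in>D. c ` en f \<subseteq> X)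
      \<and> j \<le> (\<Sum>f\<in>D. card (c ` en f) - 1)" if "Suc j \<le> card (c ` W)" for j
    using that
  proof (induction j)
    case 0
    obtain w where "w \<in> W" using W by blast
    then show ?case by (intro exI[of _ "{c w}"] exI[of _ "{}"]) auto
  next
    case (Suc j)
    then obtain X D where X: "X \<subseteq> c ` W" "card X = Suc j" and D: "D \<subseteq> F" "\<forall>f\<in>D. c ` en f \<subseteq> X"
      "j \<le> (\<Sum>f\<in>D. card (c ` en f) - 1)" by (metis Suc_leD)
    have finX: "finite X" using X(2) card.infinite by fastforce
    have "X \<noteq> {}" "X \<noteq> c ` W" using X Suc.prems by auto
    then obtain u v where uv: "u \<in> W" "c u \<in> X" "v \<in> W" "c v \<notin> X" using X(1) by blast
    obtain a b where ab: "c a \<in> X" "c b \<notin> X" "\<exists>f\<in>F. en f = {a, b}"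
      using rtranclp_leaves[OF conn[OF uv(1,3)], of "\<lambda>x. c x \<in> X"] uv by blast
    then obtain f where f: "f \<in> F" "en f = {a, b}" by blast
    have "f \<notin> D" using D(2) f(2) ab(2) by auto
    moreover have "card (c ` en f) = 2" using f(2) ab by (auto simp: card_insert_if)
    moreover have "finite D" using D(1) F finite_subset by blast
    ultimately have "Suc j \<le> (\<Sum>g\<in>insert f D. card (c ` en g) - 1)" using D(3) by simp
    moreover have "b \<in> W" using en[OF f(1)] f(2) by blast
    moreover have "card (insert (c b) X) = Suc (Suc j)" using finX ab(2) X(2) by simp
    moreover have "\<forall>g\<in>insert f D. c ` en g \<subseteq> insert (c b) X" using D(2) f(2) ab(1) by auto
    ultimately show ?case using X(1) D(1) f(1)
      by (intro exI[of _ "insert (c b) X"] exI[of _ "insert f D"]) simp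
  qed
  from this[of "card (c ` W) - 1"] obtain D
    where D: "D \<subseteq> F" "card (c ` W) - 1 \<le> (\<Sum>f\<in>D. card (c ` en f) - 1)"
    using W by (auto simp: card_gt_0_iff Suc_le_eq)
  moreover have "(\<Sum>f\<in>D. card (c ` en f) - 1) \<le> (\<Sum>f\<in>F. card (c ` en f) - 1)"
    using D(1) F by (intro sum_mono2) auto
  ultimately show ?thesis by linarith
qed

lemma simple_connected_on_finite:
  assumes "finite W" "simple_connected_on W G"
  shows "finite G" "p \<in> G \<Longrightarrow> p \<subseteq> W" "p \<in> G \<Longrightarrow> \<exists>u v. u \<noteq> v \<and> p = {u, v}"
proof -
  have "G \<subseteq> {{u, v} | u v. u \<in> W \<and> v \<in> W \<and> u \<noteq> v}"
    using assms(2) unfolding simple_connected_on_def by blast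
  then have *: "\<exists>u v. u \<in> W \<and> v \<in> W \<and> u \<noteq> v \<and> p = {u, v}" if "p \<in> G" for p
    using that by blast
  then have "G \<subseteq> Pow W" by blast
  then show "finite G" using assms(1) by (simp add: finite_subset)
  show "p \<in> G \<Longrightarrow> p \<subseteq> W" "p \<in> G \<Longrightarrow> \<exists>u v. u \<noteq> v \<and> p = {u, v}" using * by blast+
qed

lemma induced_mg_Sigma: "induced_mg E G = Sigma E G"
  unfolding induced_mg_def by auto

text \<open>Cliques inside the colour classes, joined by a star of class representatives: a connected graph
  with as few bichromatic edges as possible.\<close>
lemma ex_simple_connected_few_crossing:
  fixes c :: "'v \<Rightarrow> 'b"
  assumes W: "finite W" "W \<noteq> {}"
  shows "\<exists>G. simple_connected_on W G \<and> (\<Sum>p\<in>G. card (c ` p) - 1) \<le> card (c ` W) - 1"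
proof -
  have "\<forall>x\<in>c ` W. \<exists>v. v \<in> W \<and> c v = x" by blast
  then obtain rp where rp: "\<And>x. x \<in> c ` W \<Longrightarrow> rp x \<in> W \<and> c (rp x) = x" by metis
  obtain w where w: "w \<in> W" using W by blast
  define G1 where "G1 = {{u, v} | u v. u \<in> W \<and> v \<in> W \<and> u \<noteq> v \<and> c u = c v}"
  define G2 where "G2 = (\<lambda>x. {rp (c w), rp x}) ` (c ` W - {c w})"
  define G where "G = G1 \<union> G2"
  have G1: "G1 \<subseteq> Pow W" unfolding G1_def by auto
  have fin: "finite G1" "finite G2" using G1 W unfolding G2_def by (auto simp: finite_subset)
  have neq: "rp (c w) \<noteq> rp x" if "x \<in> c ` W - {c w}" for x
    using rp[of x] rp[of "c w"] w that by auto
  have "G2 \<subseteq> {{u, v} | u v. u \<in> W \<and> v \<in> W \<and> u \<noteq> v}"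
    unfolding G2_def using neq rp w by blast
  then have sub: "G \<subseteq> {{u, v} | u v. u \<in> W \<and> v \<in> W \<and> u \<noteq> v}" unfolding G_def G1_def by blast
  let ?R = "\<lambda>a b. {a, b} \<in> G"
  have same: "?R\<^sup>*\<^sup>* u v" if "u \<in> W" "v \<in> W" "c u = c v" for u v
    using that unfolding G_def G1_def by (cases "u = v") auto
  have hub: "?R\<^sup>*\<^sup>* u (rp (c w))" if u: "u \<in> W" for u
  proof -
    have 1: "?R\<^sup>*\<^sup>* u (rp (c u))" using same[of u "rp (c u)"] u rp[of "c u"] by auto
    have "?R\<^sup>*\<^sup>* (rp (c u)) (rp (c w))"
    proof (cases "c u = c w")
      case False
      then have "{rp (c w), rp (c u)} \<in> G" using u unfolding G_def G2_def by blast
      then have "?R (rp (c u)) (rp (c w))" by (simp add: insert_commute)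
      then show ?thesis by blast
    qed simp
    then show ?thesis using 1 by simp
  qed
  have sym: "symp ?R" by (simp add: symp_def insert_commute)
  have "?R\<^sup>*\<^sup>* u v" if "u \<in> W" "v \<in> W" for u v
    using hub[OF that(1)] hub[OF that(2)] symp_rtranclp[OF sym]
    by (metis (no_types, lifting) rtranclp_trans sympD)
  then have "simple_connected_on W G" using sub unfolding simple_connected_on_def by blast
  moreover have "(\<Sum>p\<in>G. card (c ` p) - 1) \<le> card (c ` W) - 1"
  proof -
    have "(\<Sum>p\<in>G. card (c ` p) - 1) \<le> (\<Sum>p\<in>G1. card (c ` p) - 1) + (\<Sum>p\<in>G2. card (c ` p) - 1)"
      unfolding G_def using sum.union_inter[OF fin, of "\<lambda>p. card (c ` p) - 1"] by linarith
    also have "(\<Sum>p\<in>G1. card (c ` p) - 1) = 0"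
      unfolding G1_def by (intro sum.neutral) auto
    also have "(\<Sum>p\<in>G2. card (c ` p) - 1) \<le> (\<Sum>p\<in>G2. 1)"
    proof (rule sum_mono)
      fix p assume "p \<in> G2"
      then obtain x y where "p = {x, y}" unfolding G2_def by blast
      then show "card (c ` p) - 1 \<le> 1" by (simp add: card_insert_if)
    qed
    also have "\<dots> \<le> card (c ` W - {c w})"
      unfolding G2_def using W by (simp add: card_image_le)
    also have "\<dots> = card (c ` W) - 1" using w W by simp
    finally show ?thesis by simp
  qed
  ultimately show ?thesis by blast
qed

text \<open>The adversary picks \<open>G\<close> after seeing the partition and spends on each
  hyperedge as few crossing edges as possible, while every one of the disjoint trees consumes at
  least as many as there are blocks, minus one.\<close>

lemma inherently_connected_imp_partition_connected:
  fixes inc :: "'e \<Rightarrow> 'v set"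
  assumes V: "finite V" "V \<noteq> {}" and E: "finite E"
    and inc: "\<And>e. e \<in> E \<Longrightarrow> inc e \<subseteq> V" "\<And>e. e \<in> E \<Longrightarrow> inc e \<noteq> {}"
    and ic: "inherently_connected tau V E inc"
  shows "partition_connected tau V E inc"
  unfolding partition_connected_def
proof
  fix c :: "'v \<Rightarrow> 'v set"
  have fin: "finite (inc e)" if "e \<in> E" for e using inc(1)[OF that] V finite_subset by blast
  have "\<forall>e\<in>E. \<exists>G. simple_connected_on (inc e) G \<and> (\<Sum>p\<in>G. card (c ` p) - 1) \<le> card (c ` inc e) - 1"
    by (intro ballI ex_simple_connected_few_crossing fin inc(2))
  then obtain G where G: "\<And>e. e \<in> E \<Longrightarrow> simple_connected_on (inc e) (G e)"
    "\<And>e. e \<in> E \<Longrightarrow> (\<Sum>p\<in>G e. card (c ` p) - 1) \<le> card (c ` inc e) - 1" by metis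
  let ?M = "induced_mg E G"
  have finM: "finite ?M"
    unfolding induced_mg_Sigma using E simple_connected_on_finite(1)[OF fin G(1)] by blast
  obtain Ts :: "nat \<Rightarrow> ('e \<times> 'v set) set" where
    Ts: "\<And>i. i < tau \<Longrightarrow> Ts i \<subseteq> ?M \<and> spanning_tree V (Ts i)"
    and disj: "\<And>i j. i < tau \<Longrightarrow> j < tau \<Longrightarrow> i \<noteq> j \<Longrightarrow> Ts i \<inter> Ts j = {}"
    using ic G(1) unfolding inherently_connected_def has_edge_disjoint_spanning_trees_def by metis
  have finT: "finite (Ts i)" if "i < tau" for i using Ts[OF that] finM finite_subset by blast
  have "tau * (card (c ` V) - 1) = (\<Sum>i<tau. card (c ` V) - 1)" by simp
  also have "\<dots> \<le> (\<Sum>i<tau. \<Sum>f\<in>Ts i. card (c ` snd f) - 1)"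
  proof (intro sum_mono connected_colour_bound)
    fix i assume "i \<in> {..<tau}"
    then have i: "i < tau" by simp
    show "finite (Ts i)" using finT[OF i] .
    show "finite V" "V \<noteq> {}" using V .
    show "snd f \<subseteq> V" if "f \<in> Ts i" for f using Ts[OF i] that unfolding spanning_tree_def by blast
    show "(\<lambda>a b. \<exists>f\<in>Ts i. snd f = {a, b})\<^sup>*\<^sup>* u v" if "u \<in> V" "v \<in> V" for u v
      using Ts[OF i] that unfolding spanning_tree_def mg_connected_def mg_conn_def by blast
  qed
  also have "\<dots> = (\<Sum>f\<in>(\<Union>i<tau. Ts i). card (c ` snd f) - 1)"
    using finT disj by (intro sum.UNION_disjoint[symmetric]) auto
  also have "\<dots> \<le> (\<Sum>f\<in>?M. card (c ` snd f) - 1)"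
    using Ts finM by (intro sum_mono2) auto
  also have "\<dots> = (\<Sum>e\<in>E. \<Sum>p\<in>G e. card (c ` p) - 1)"
    unfolding induced_mg_Sigma using E simple_connected_on_finite(1)[OF fin G(1)]
    by (subst sum.Sigma) (auto simp: case_prod_unfold)
  also have "\<dots> \<le> (\<Sum>e\<in>E. card (c ` inc e) - 1)" using G(2) by (intro sum_mono) auto
  finally show "tau * (card (c ` V) - 1) \<le> (\<Sum>e\<in>E. card (c ` inc e) - 1)" .
qed

section \<open>Arc-disjoint arborescences\<close>

definition entering :: "'e set \<Rightarrow> ('e \<Rightarrow> 'v) \<Rightarrow> ('e \<Rightarrow> 'v) \<Rightarrow> 'v set \<Rightarrow> 'e set" where
  "entering A tail head S = {a \<in> A. tail a \<notin> S \<and> head a \<in> S}"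

lemma card_entering_submodular:
  assumes "finite A"
  shows "card (entering A tail head (S \<inter> T)) + card (entering A tail head (S \<union> T))
    \<le> card (entering A tail head S) + card (entering A tail head T)"
proof -
  let ?e = "entering A tail head"
  have fin: "finite (?e X)" for X using assms unfolding entering_def by simp
  have "card (?e (S \<inter> T) \<union> ?e (S \<union> T)) \<le> card (?e S \<union> ?e T)"
    using fin by (intro card_mono) (auto simp: entering_def)
  moreover have "card (?e (S \<inter> T) \<inter> ?e (S \<union> T)) \<le> card (?e S \<inter> ?e T)"
    using fin by (intro card_mono) (auto simp: entering_def)
  ultimately show ?thesis using card_Un_Int[OF fin fin] by (metis add_mono)
qed

text \<open>Lovasz's proof of Edmonds' branching theorem: the arborescence grows one arc at a time, and a
  minimal dangerous set (one whose in-degree has dropped to \<^term>\<open>k\<close>) contains an arc that is safe to add.\<close>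
lemma ex_arborescence:
  fixes A :: "'e set" and V :: "'v set"
  assumes A: "finite A" and V: "finite V" "z \<in> V"
    and arcs: "\<And>a. a \<in> A \<Longrightarrow> tail a \<in> V \<and> head a \<in> V"
    and cut: "\<And>S. S \<subseteq> V - {z} \<Longrightarrow> S \<noteq> {} \<Longrightarrow> Suc k \<le> card (entering A tail head S)"
  shows "\<exists>F\<subseteq>A. (\<forall>v\<in>V. (\<lambda>a b. \<exists>f\<in>F. tail f = a \<and> head f = b)\<^sup>*\<^sup>* z v)
     \<and> (\<forall>S\<subseteq>V - {z}. S \<noteq> {} \<longrightarrow> k \<le> card (entering (A - F) tail head S))"
proof -
  let ?conn = "\<lambda>F. (\<lambda>a b. \<exists>f\<in>F. tail f = a \<and> head f = b)\<^sup>*\<^sup>*"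
  \<comment> \<open>Chosen arcs have their heads in \<open>R\<close>. A set that avoids
    \<open>R\<close> has therefore lost no entering arc and still has in-degree at least
    \<open>Suc k\<close>, as \<open>away\<close> records.\<close>
  define good where "good F R \<longleftrightarrow> F \<subseteq> A \<and> z \<in> R \<and> R \<subseteq> V \<and> (\<forall>f\<in>F. head f \<in> R)
     \<and> (\<forall>v\<in>R. ?conn F z v) \<and> (\<forall>S\<subseteq>V - {z}. S \<noteq> {} \<longrightarrow> k \<le> card (entering (A - F) tail head S))"
    for F R
  have "\<exists>F R. good F R \<and> card R = Suc m" if "Suc m \<le> card V" for m
    using that
  proof (induction m)
    case 0
    have "good {} {z}" unfolding good_def using V cut by (auto dest: Suc_leD)
    then show ?case by (intro exI[of _ "{}"] exI[of _ "{z}"]) simp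
  next
    case (Suc m)
    then obtain F R where g: "good F R" and cR: "card R = Suc m" by (metis Suc_leD)
    have F: "F \<subseteq> A" and R: "z \<in> R" "R \<subseteq> V" and headF: "\<And>f. f \<in> F \<Longrightarrow> head f \<in> R"
      and conn: "\<And>v. v \<in> R \<Longrightarrow> ?conn F z v"
      and cutF: "\<And>S. S \<subseteq> V - {z} \<Longrightarrow> S \<noteq> {} \<Longrightarrow> k \<le> card (entering (A - F) tail head S)"
      using g unfolding good_def by blast+
    have finR: "finite R" using R V finite_subset by blast
    have "R \<noteq> V" using cR Suc.prems by auto
    have finent: "finite (entering (A - F) tail head S)" for S using A unfolding entering_def by simp
    have away: "Suc k \<le> card (entering (A - F) tail head S)" if "S \<subseteq> V - R" "S \<noteq> {}" for S
    proof -
      have "entering (A - F) tail head S = entering A tail head S"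
        using headF that(1) unfolding entering_def by blast
      then show ?thesis using cut[of S] that R by auto
    qed
    \<comment> \<open>Sets inside \<open>R\<close> are left out: the next arc has its head outside
      \<open>R\<close> and cannot enter them.\<close>
    define dang where "dang S \<longleftrightarrow> S \<subseteq> V - {z} \<and> S - R \<noteq> {} \<and> card (entering (A - F) tail head S) = k" for S
    have "\<exists>a\<in>A - F. tail a \<in> R \<and> head a \<in> V - R \<and> (\<forall>S. dang S \<longrightarrow> head a \<in> S \<longrightarrow> tail a \<in> S)"
    proof (cases "\<exists>S. dang S")
      case False
      have "Suc k \<le> card (entering (A - F) tail head (V - R))"
        using away[of "V - R"] R \<open>R \<noteq> V\<close> by blast
      then have "entering (A - F) tail head (V - R) \<noteq> {}" by auto
      then obtain a where "a \<in> A - F" "tail a \<notin> V - R" "head a \<in> V - R" unfolding entering_def by blast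
      then show ?thesis using False arcs by blast
    next
      case True
      then obtain S where S: "dang S" and Smin: "\<And>S'. dang S' \<Longrightarrow> card S \<le> card S'"
        using ex_has_least_nat[of dang _ card] by metis
      have Sd: "S \<subseteq> V - {z}" "S - R \<noteq> {}" "card (entering (A - F) tail head S) = k"
        using S unfolding dang_def by auto
      \<comment> \<open>More arcs enter \<open>S - R\<close> than \<open>S\<close>, so one of them
        starts inside \<open>S\<close>, and its tail can only be in \<open>R\<close>.\<close>
      have "Suc k \<le> card (entering (A - F) tail head (S - R))" using away[of "S - R"] Sd by blast
      then have "\<not> entering (A - F) tail head (S - R) \<subseteq> entering (A - F) tail head S"
        using Sd(3) finent card_mono by (metis Suc_n_not_le_n le_trans)
      then obtain a where a: "a \<in> A - F" "tail a \<in> S" "tail a \<in> R" "head a \<in> S - R"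
        unfolding entering_def by blast
      \<comment> \<open>If \<open>a\<close> entered another dangerous set, submodularity would make
        the intersection with \<open>S\<close> dangerous too. It lacks \<open>tail a\<close>, so it
        would be smaller than the minimal \<open>S\<close>.\<close>
      have "tail a \<in> S'" if S': "dang S'" "head a \<in> S'" for S'
      proof (rule ccontr)
        assume nt: "tail a \<notin> S'"
        have S'd: "S' \<subseteq> V - {z}" "card (entering (A - F) tail head S') = k"
          using S' unfolding dang_def by auto
        have "k \<le> card (entering (A - F) tail head (S \<inter> S'))" "k \<le> card (entering (A - F) tail head (S \<union> S'))"
          using Sd S'd S'(2) a(4) by (intro cutF; blast)+
        then have "card (entering (A - F) tail head (S \<inter> S')) = k"
          using card_entering_submodular[of "A - F" tail head S S'] A Sd(3) S'd(2) by simp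
        then have "dang (S \<inter> S')" using Sd S'(2) a(4) unfolding dang_def by blast
        then have "card S \<le> card (S \<inter> S')" using Smin by blast
        moreover have "card (S \<inter> S') < card S"
          using nt a(2) Sd(1) V by (intro psubset_card_mono) (auto intro: finite_subset)
        ultimately show False by simp
      qed
      then show ?thesis using a Sd by blast
    qed
    then obtain a where a: "a \<in> A - F" "tail a \<in> R" "head a \<in> V - R"
      "\<And>S. dang S \<Longrightarrow> head a \<in> S \<Longrightarrow> tail a \<in> S" by blast
    have mono: "?conn F x y \<Longrightarrow> ?conn (insert a F) x y" for x y
      by (erule rtranclp_mono[THEN predicate2D, rotated]) blast
    have "?conn (insert a F) z (head a)"
      using mono[OF conn[OF a(2)]] by (rule rtranclp.rtrancl_into_rtrancl) blast
    then have conn': "\<forall>v\<in>insert (head a) R. ?conn (insert a F) z v" using mono conn by blast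
    have cut': "k \<le> card (entering (A - insert a F) tail head S)" if S: "S \<subseteq> V - {z}" "S \<noteq> {}" for S
    proof (cases "head a \<in> S \<and> tail a \<notin> S")
      case True
      then have "card (entering (A - F) tail head S) \<noteq> k" using a S unfolding dang_def by blast
      then have "Suc k \<le> card (entering (A - F) tail head S)" using cutF[OF S] by simp
      moreover have "card (entering (A - F) tail head S) - 1 \<le> card (entering (A - F) tail head S - {a})"
        by (simp only: card_Diff_singleton_if) simp
      moreover have eq: "entering (A - insert a F) tail head S = entering (A - F) tail head S - {a}"
        unfolding entering_def by blast
      ultimately show ?thesis unfolding eq by linarith
    next
      case False
      then have "entering (A - insert a F) tail head S = entering (A - F) tail head S"
        unfolding entering_def by blast
      then show ?thesis using cutF[OF S] by simp
    qed
    have "good (insert a F) (insert (head a) R)"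
      unfolding good_def using F R a headF conn' cut' by blast
    moreover have "card (insert (head a) R) = Suc (Suc m)" using a(3) finR cR by simp
    ultimately show ?case by blast
  qed
  moreover have "Suc (card V - 1) = card V" using V by (metis Suc_pred' card_gt_0_iff empty_iff)
  ultimately obtain F R where g: "good F R" and "card R = card V" by (metis order_refl)
  then have "R = V" using V unfolding good_def by (metis card_subset_eq)
  then show ?thesis using g unfolding good_def by blast
qed

text \<open>Edmonds' theorem by peeling: the guaranteed in-degree drops by one with each
  arborescence removed.\<close>

lemma disjoint_arborescences:
  fixes A :: "'e set" and V :: "'v set"
  assumes "finite A" and "finite V" "z \<in> V"
    and "\<And>a. a \<in> A \<Longrightarrow> tail a \<in> V \<and> head a \<in> V"
    and "\<And>S. S \<subseteq> V - {z} \<Longrightarrow> S \<noteq> {} \<Longrightarrow> k \<le> card (entering A tail head S)"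
  shows "\<exists>Ts :: nat \<Rightarrow> 'e set.
     (\<forall>i<k. Ts i \<subseteq> A \<and> (\<forall>v\<in>V. (\<lambda>a b. \<exists>f\<in>Ts i. tail f = a \<and> head f = b)\<^sup>*\<^sup>* z v))
     \<and> (\<forall>i<k. \<forall>j<k. i \<noteq> j \<longrightarrow> Ts i \<inter> Ts j = {})"
  using assms(1,4,5)
proof (induction k arbitrary: A)
  case (Suc k)
  obtain F where F: "F \<subseteq> A" "\<forall>v\<in>V. (\<lambda>a b. \<exists>f\<in>F. tail f = a \<and> head f = b)\<^sup>*\<^sup>* z v"
    "\<forall>S\<subseteq>V - {z}. S \<noteq> {} \<longrightarrow> k \<le> card (entering (A - F) tail head S)"
    using ex_arborescence[OF Suc.prems(1) assms(2,3) Suc.prems(2,3)] by blast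
  have "\<exists>Ts :: nat \<Rightarrow> 'e set.
     (\<forall>i<k. Ts i \<subseteq> A - F \<and> (\<forall>v\<in>V. (\<lambda>a b. \<exists>f\<in>Ts i. tail f = a \<and> head f = b)\<^sup>*\<^sup>* z v))
     \<and> (\<forall>i<k. \<forall>j<k. i \<noteq> j \<longrightarrow> Ts i \<inter> Ts j = {})"
    using Suc.prems F by (intro Suc.IH) auto
  then obtain Ts :: "nat \<Rightarrow> 'e set" where
    T: "(\<forall>i<k. Ts i \<subseteq> A - F \<and> (\<forall>v\<in>V. (\<lambda>a b. \<exists>f\<in>Ts i. tail f = a \<and> head f = b)\<^sup>*\<^sup>* z v))
     \<and> (\<forall>i<k. \<forall>j<k. i \<noteq> j \<longrightarrow> Ts i \<inter> Ts j = {})"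
    by (elim exE) (rule that)
  have Ts: "Ts i \<subseteq> A - F \<and> (\<forall>v\<in>V. (\<lambda>a b. \<exists>f\<in>Ts i. tail f = a \<and> head f = b)\<^sup>*\<^sup>* z v)"
    if "i < k" for i using T that by simp
  have disj: "Ts i \<inter> Ts j = {}" if "i < k" "j < k" "i \<noteq> j" for i j using T that by simp
  define Ts' where "Ts' = Ts(k := F)"
  have "Ts' i \<inter> Ts' j = {}" if "i < Suc k" "j < Suc k" "i \<noteq> j" for i j
    using that disj[of i j] Ts[of i] Ts[of j] unfolding Ts'_def
    by (cases "i = k"; cases "j = k") auto
  moreover have "Ts' i \<subseteq> A \<and> (\<forall>v\<in>V. (\<lambda>a b. \<exists>f\<in>Ts' i. tail f = a \<and> head f = b)\<^sup>*\<^sup>* z v)"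
    if "i < Suc k" for i
    using that Ts[of i] F unfolding Ts'_def by (cases "i = k") auto
  ultimately show ?case by blast
qed simp

section \<open>Spanning trees of connected multigraphs\<close>

lemma mg_conn_sym: "mg_conn F u v \<Longrightarrow> mg_conn F v u"
proof -
  have "symp (\<lambda>a b. \<exists>f\<in>F. snd f = {a, b})" by (auto simp: symp_def insert_commute)
  then show "mg_conn F u v \<Longrightarrow> mg_conn F v u"
    unfolding mg_conn_def using symp_rtranclp by (metis (no_types, lifting) sympD)
qed

lemma mg_conn_trans: "mg_conn F u v \<Longrightarrow> mg_conn F v w \<Longrightarrow> mg_conn F u w"
  unfolding mg_conn_def by (rule rtranclp_trans)

lemma mg_conn_edge: "f \<in> F \<Longrightarrow> snd f = {a, b} \<Longrightarrow> mg_conn F a b"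
  unfolding mg_conn_def by blast

text \<open>The rest of the cycle is a detour from \<open>vs ! 1\<close> to \<open>vs ! 0\<close>.
  For a cycle of length 2 the detour is the parallel edge \<open>es ! 1\<close>.\<close>

lemma mg_conn_delete_cycle_edge:
  assumes cyc: "mg_cycle F es vs" and conn: "mg_conn F u v"
  shows "mg_conn (F - {es ! 0}) u v"
proof -
  let ?L = "length es" and ?F = "F - {es ! 0}"
  have L: "?L \<ge> 2" and d: "distinct es" and sub: "set es \<subseteq> F"
    and ends: "\<And>i. i < ?L \<Longrightarrow> snd (es ! i) = {vs ! i, vs ! ((i + 1) mod ?L)}"
    using cyc unfolding mg_cycle_def by auto
  have mem: "es ! i \<in> ?F" if "0 < i" "i < ?L" for i
  proof -
    have "es ! i \<noteq> es ! 0" using nth_eq_iff_index_eq[OF d that(2), of 0] that by (cases "es = []") auto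
    then show ?thesis using sub that by auto
  qed
  have path: "mg_conn ?F (vs ! 1) (vs ! Suc i)" if "Suc i < ?L" for i
    using that
  proof (induction i)
    case 0
    then show ?case by (simp add: mg_conn_def)
  next
    case (Suc i)
    have "snd (es ! Suc i) = {vs ! Suc i, vs ! Suc (Suc i)}" using ends[of "Suc i"] Suc.prems by simp
    then have "mg_conn ?F (vs ! Suc i) (vs ! Suc (Suc i))" using mem Suc.prems by (intro mg_conn_edge) auto
    then show ?case using Suc mg_conn_trans by (metis Suc_lessD)
  qed
  have "mg_conn ?F (vs ! 1) (vs ! (?L - 1))" using path[of "?L - 2"] L
    by (metis Suc_1 Suc_diff_Suc Suc_le_lessD diff_less lessI less_trans zero_less_Suc numeral_2_eq_2 One_nat_def)
  moreover have "mg_conn ?F (vs ! (?L - 1)) (vs ! 0)"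
  proof -
    have "?L - 1 + 1 = ?L" using L by linarith
    then have "(?L - 1 + 1) mod ?L = 0" by (metis mod_self)
    then have "snd (es ! (?L - 1)) = {vs ! (?L - 1), vs ! 0}" using ends[of "?L - 1"] L by simp
    then show ?thesis using mem L by (intro mg_conn_edge) auto
  qed
  ultimately have bypass: "mg_conn ?F (vs ! 1) (vs ! 0)" by (rule mg_conn_trans)
  have e0: "snd (es ! 0) = {vs ! 0, vs ! 1}" using ends[of 0] L by (cases "es = []") auto
  have edge: "mg_conn ?F a b" if ab: "\<exists>f\<in>F. snd f = {a, b}" for a b
  proof -
    obtain f where f: "f \<in> F" "snd f = {a, b}" using ab by blast
    show ?thesis
    proof (cases "f = es ! 0")
      case True
      then have "(a = vs ! 0 \<and> b = vs ! 1) \<or> (a = vs ! 1 \<and> b = vs ! 0)"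
        using f e0 by (auto simp: doubleton_eq_iff)
      then show ?thesis using bypass mg_conn_sym by metis
    next
      case False
      then show ?thesis using f by (intro mg_conn_edge) auto
    qed
  qed
  show ?thesis
    using conn unfolding mg_conn_def[of F]
  proof (induction rule: rtranclp_induct)
    case base
    then show ?case by (simp add: mg_conn_def)
  next
    case (step y z)
    then show ?case using edge[of y z] mg_conn_trans[of ?F u y z] by blast
  qed
qed

text \<open>A connected edge set of least cardinality has no cycle, since a cycle edge could be
  dropped.\<close>

lemma ex_spanning_tree_subset:
  assumes F: "finite F" "\<And>f. f \<in> F \<Longrightarrow> snd f \<subseteq> V" "mg_connected V F"
  shows "\<exists>T\<subseteq>F. spanning_tree V T"
proof -
  define P where "P T \<longleftrightarrow> T \<subseteq> F \<and> mg_connected V T" for T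
  have "P F" using F unfolding P_def by simp
  then obtain T where T: "P T" and min: "\<And>T'. P T' \<Longrightarrow> card T \<le> card T'"
    using ex_has_least_nat[of P F card] by metis
  have finT: "finite T" using T F(1) finite_subset unfolding P_def by blast
  have "mg_acyclic T"
    unfolding mg_acyclic_def
  proof
    assume "\<exists>es vs. mg_cycle T es vs"
    then obtain es vs where cyc: "mg_cycle T es vs" by blast
    then have "0 < length es" "set es \<subseteq> T" unfolding mg_cycle_def by auto
    then have "es ! 0 \<in> T" using nth_mem by blast
    moreover have "P (T - {es ! 0})"
      using T mg_conn_delete_cycle_edge[OF cyc] unfolding P_def mg_connected_def by blast
    then have "card T \<le> card (T - {es ! 0})" using min by blast
    ultimately show False using card_Diff1_less[OF finT] by fastforce
  qed
  then show ?thesis using T F(2) unfolding P_def spanning_tree_def by blast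
qed

text \<open>Nash-Williams and Tutte.  The capacities \<^term>\<open>r\<close>, increased by \<^term>\<open>tau\<close> at a root, are
  realised as out-degrees of an orientation, in which every set avoiding the root has in-degree at
  least \<^term>\<open>tau\<close>.\<close>
lemma tree_packing:
  fixes M :: "('e \<times> 'v set) set"
  assumes V: "finite V" "V \<noteq> {}" and M: "finite M"
    and edges: "\<And>f. f \<in> M \<Longrightarrow> snd f \<subseteq> V \<and> (\<exists>u v. u \<noteq> v \<and> snd f = {u, v})"
    and pc: "partition_connected tau V M snd"
  shows "has_edge_disjoint_spanning_trees tau V M"
proof -
  obtain z where z: "z \<in> V" using V by blast
  have nonempty: "snd f \<noteq> {}" if "f \<in> M" for f using edges[OF that] by auto
  obtain r :: "'v \<Rightarrow> int" where
    r: "\<And>S. S \<subseteq> V \<Longrightarrow> S \<noteq> {} \<Longrightarrow> sum r S \<le> int (touching M snd S) - int tau"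
    and rV: "sum r V = int (card M) - int tau"
    using partition_connected_base[OF V M _ _ pc] edges nonempty by blast
  \<comment> \<open>The extra \<open>tau\<close> brings the total up to \<open>card M\<close>, so
    that the lower bound needed for Hall's condition holds at \<open>S = V\<close> as well, where
    \<open>base_complement\<close> gives nothing.\<close>
  define r' where "r' v = r v + (if v = z then int tau else 0)" for v
  have sum_r': "sum r' S = sum r S + (if z \<in> S then int tau else 0)" if "finite S" for S
    unfolding r'_def using that by (simp add: sum.distrib)
  have inside: "int (card {f \<in> M. snd f \<inter> (V - S) = {}}) \<le> sum r' S" if S: "S \<subseteq> V" for S
  proof (cases "S = V")
    case True
    then show ?thesis using rV z V sum_r'[of V] by simp
  next
    case False
    have "int (card {f \<in> M. snd f \<inter> (V - S) = {}}) \<le> sum r S"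
      using base_complement[OF V(1) M r rV, of S] False S by blast
    moreover have "finite S" using S V finite_subset by blast
    then have "sum r S \<le> sum r' S" using sum_r'[of S] by simp
    ultimately show ?thesis by linarith
  qed
  have r'_nonneg: "0 \<le> r' v" if "v \<in> V" for v
    using inside[of "{v}"] that by simp
  define cap where "cap v = nat (r' v)" for v
  have sum_cap: "int (sum cap S) = sum r' S" if "S \<subseteq> V" for S
    unfolding cap_def using r'_nonneg that by (simp add: subset_iff)
  \<comment> \<open>Vertex \<open>v\<close> offers \<open>cap v\<close> slots. Matching every edge
    to a slot at one of its ends selects its tail and keeps out-degrees within
    \<open>cap\<close>.\<close>
  define N where "N f = Sigma (snd f) (\<lambda>v. {..<cap v})" for f :: "'e \<times> 'v set"
  have fin_end: "finite (snd f)" if "f \<in> M" for f using edges[OF that] V finite_subset by blast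
  have "\<exists>m. inj_on m M \<and> (\<forall>f\<in>M. m f \<in> N f)"
  proof (rule hall_marriage)
    show "finite M" using M .
    show "\<forall>f\<in>M. finite (N f)" using fin_end unfolding N_def by blast
    show "\<forall>C\<subseteq>M. card C \<le> card (\<Union>(N ` C))"
    proof (intro allI impI)
      fix C assume C: "C \<subseteq> M"
      let ?S = "\<Union>(snd ` C)"
      have S: "?S \<subseteq> V" using C edges by blast
      have finS: "finite ?S" using S V finite_subset by blast
      have "\<Union>(N ` C) = Sigma ?S (\<lambda>v. {..<cap v})" unfolding N_def by blast
      then have "card (\<Union>(N ` C)) = sum cap ?S" using finS by simp
      moreover have "card C \<le> card {f \<in> M. snd f \<inter> (V - ?S) = {}}"
        using C M by (intro card_mono) auto
      ultimately show "card C \<le> card (\<Union>(N ` C))" using inside[OF S] sum_cap[OF S] by linarith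
    qed
  qed
  then obtain m where m: "inj_on m M" "\<And>f. f \<in> M \<Longrightarrow> m f \<in> N f" by blast
  define tail where "tail f = fst (m f)" for f
  have tail: "tail f \<in> snd f" if "f \<in> M" for f using m(2)[OF that] unfolding tail_def N_def by auto
  have "\<forall>f\<in>M. \<exists>w. snd f = {tail f, w}" using edges tail by fastforce
  then obtain head where head: "\<And>f. f \<in> M \<Longrightarrow> snd f = {tail f, head f}" by metis
  \<comment> \<open>At least \<open>sum r S + tau\<close> edges meet \<open>S\<close>. At most
    \<open>sum r S\<close> of them have their tail in \<open>S\<close>, because the root with its
    extra capacity lies outside; the others enter.\<close>
  have "tau \<le> card (entering M tail head S)" if S: "S \<subseteq> V - {z}" "S \<noteq> {}" for S
  proof -
    have finS: "finite S" using S V finite_subset by blast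
    let ?O = "{f \<in> M. tail f \<in> S}"
    have "card ?O \<le> card (Sigma S (\<lambda>v. {..<cap v}))"
    proof (rule card_inj_on_le)
      show "inj_on m ?O" using m(1) by (rule inj_on_subset) blast
      show "m ` ?O \<subseteq> Sigma S (\<lambda>v. {..<cap v})"
        using m(2) unfolding tail_def N_def by (force simp: mem_Times_iff)
      show "finite (Sigma S (\<lambda>v. {..<cap v}))" using finS by blast
    qed
    then have "card ?O \<le> sum cap S" using finS by simp
    moreover have "int (sum cap S) = sum r' S" using S by (intro sum_cap) blast
    ultimately have "int (card ?O) \<le> sum r' S" by linarith
    also have "\<dots> = sum r S" using sum_r'[OF finS] S by auto
    also have "\<dots> \<le> int (touching M snd S) - int tau" using r[of S] S by blast
    finally have "card ?O + tau \<le> touching M snd S" by linarith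
    moreover have "{f \<in> M. snd f \<inter> S \<noteq> {}} \<subseteq> ?O \<union> entering M tail head S"
    proof
      fix f assume "f \<in> {f \<in> M. snd f \<inter> S \<noteq> {}}"
      then have "f \<in> M" "{tail f, head f} \<inter> S \<noteq> {}" by (simp, simp add: head[symmetric])
      then show "f \<in> ?O \<union> entering M tail head S" unfolding entering_def by blast
    qed
    then have "touching M snd S \<le> card (?O \<union> entering M tail head S)"
      unfolding touching_def using M by (intro card_mono) (auto simp: entering_def)
    moreover have "card (?O \<union> entering M tail head S) \<le> card ?O + card (entering M tail head S)"
      by (rule card_Un_le)
    ultimately show ?thesis by linarith
  qed
  moreover have "tail f \<in> V \<and> head f \<in> V" if "f \<in> M" for f using head[OF that] edges[OF that] by auto
  ultimately have "\<exists>Ts :: nat \<Rightarrow> ('e \<times> 'v set) set.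
      (\<forall>i<tau. Ts i \<subseteq> M \<and> (\<forall>v\<in>V. (\<lambda>a b. \<exists>f\<in>Ts i. tail f = a \<and> head f = b)\<^sup>*\<^sup>* z v))
      \<and> (\<forall>i<tau. \<forall>j<tau. i \<noteq> j \<longrightarrow> Ts i \<inter> Ts j = {})"
    by (intro disjoint_arborescences M V z)
  then obtain Ts :: "nat \<Rightarrow> ('e \<times> 'v set) set" where
    T: "(\<forall>i<tau. Ts i \<subseteq> M \<and> (\<forall>v\<in>V. (\<lambda>a b. \<exists>f\<in>Ts i. tail f = a \<and> head f = b)\<^sup>*\<^sup>* z v))
      \<and> (\<forall>i<tau. \<forall>j<tau. i \<noteq> j \<longrightarrow> Ts i \<inter> Ts j = {})"
    by (elim exE) (rule that)
  have Ts: "Ts i \<subseteq> M \<and> (\<forall>v\<in>V. (\<lambda>a b. \<exists>f\<in>Ts i. tail f = a \<and> head f = b)\<^sup>*\<^sup>* z v)"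
    if "i < tau" for i using T that by simp
  have disj: "Ts i \<inter> Ts j = {}" if "i < tau" "j < tau" "i \<noteq> j" for i j using T that by simp
  have "\<exists>T\<subseteq>Ts i. spanning_tree V T" if i: "i < tau" for i
  proof (rule ex_spanning_tree_subset)
    show "finite (Ts i)" using Ts[OF i] M finite_subset by blast
    show "snd f \<subseteq> V" if "f \<in> Ts i" for f using Ts[OF i] edges that by blast
    have "mg_conn (Ts i) z v" if v: "v \<in> V" for v
    proof -
      have "(\<lambda>a b. \<exists>f\<in>Ts i. tail f = a \<and> head f = b)\<^sup>*\<^sup>* z v" using Ts[OF i] v by blast
      then show ?thesis unfolding mg_conn_def
        by (rule rtranclp_mono[THEN predicate2D, rotated]) (use head Ts[OF i] in blast)
    qed
    then show "mg_connected V (Ts i)"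
      unfolding mg_connected_def using mg_conn_sym mg_conn_trans by metis
  qed
  then obtain Ts' where Ts': "\<And>i. i < tau \<Longrightarrow> Ts' i \<subseteq> Ts i \<and> spanning_tree V (Ts' i)" by metis
  have "Ts' i \<inter> Ts' j = {}" if "i < tau" "j < tau" "i \<noteq> j" for i j
    using Ts'[OF that(1)] Ts'[OF that(2)] disj[OF that] by blast
  moreover have "Ts' i \<subseteq> M \<and> spanning_tree V (Ts' i)" if "i < tau" for i
    using Ts'[OF that] Ts[OF that] by blast
  ultimately show ?thesis unfolding has_edge_disjoint_spanning_trees_def by blast
qed

text \<open>Any connected realisation of a hyperedge crosses a partition at least as often as the
  hyperedge is charged for, so the inequality passes to every induced multigraph.\<close>

lemma partition_connected_imp_inherently_connected:
  fixes inc :: "'e \<Rightarrow> 'v set"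
  assumes V: "finite V" "V \<noteq> {}" and E: "finite E"
    and inc: "\<And>e. e \<in> E \<Longrightarrow> inc e \<subseteq> V" "\<And>e. e \<in> E \<Longrightarrow> inc e \<noteq> {}"
    and pc: "partition_connected tau V E inc"
  shows "inherently_connected tau V E inc"
  unfolding inherently_connected_def
proof (intro allI impI)
  fix G :: "'e \<Rightarrow> 'v set set"
  assume "\<forall>e\<in>E. simple_connected_on (inc e) (G e)"
  then have G: "\<And>e. e \<in> E \<Longrightarrow> simple_connected_on (inc e) (G e)" by blast
  have fin: "finite (inc e)" if "e \<in> E" for e using inc(1)[OF that] V finite_subset by blast
  note sc = simple_connected_on_finite[OF fin G]
  let ?M = "induced_mg E G"
  show "has_edge_disjoint_spanning_trees tau V ?M"
  proof (rule tree_packing[OF V])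
    show "finite ?M" unfolding induced_mg_Sigma using E sc(1) by blast
    show "snd f \<subseteq> V \<and> (\<exists>u v. u \<noteq> v \<and> snd f = {u, v})" if f: "f \<in> ?M" for f
    proof -
      obtain e where "e \<in> E" "snd f \<in> G e" using f unfolding induced_mg_Sigma by auto
      then show ?thesis using sc(2,3) inc(1) by (metis subset_trans)
    qed
    show "partition_connected tau V ?M snd"
      unfolding partition_connected_def
    proof
      fix c :: "'v \<Rightarrow> 'v set"
      have "tau * (card (c ` V) - 1) \<le> (\<Sum>e\<in>E. card (c ` inc e) - 1)"
        using pc unfolding partition_connected_def by blast
      also have "\<dots> \<le> (\<Sum>e\<in>E. \<Sum>p\<in>G e. card (c ` p) - 1)"
      proof (rule sum_mono)
        fix e assume e: "e \<in> E"
        show "card (c ` inc e) - 1 \<le> (\<Sum>p\<in>G e. card (c ` p) - 1)"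
        proof (rule connected_colour_bound[where en = "\<lambda>p. p"])
          show "finite (G e)" "finite (inc e)" "inc e \<noteq> {}" using sc(1) fin inc e by auto
          show "f \<subseteq> inc e" if "f \<in> G e" for f using sc(2) e that by blast
          show "(\<lambda>a b. \<exists>f\<in>G e. f = {a, b})\<^sup>*\<^sup>* u v" if "u \<in> inc e" "v \<in> inc e" for u v
            using G[OF e] that unfolding simple_connected_on_def by simp
        qed
      qed
      also have "\<dots> = (\<Sum>f\<in>?M. card (c ` snd f) - 1)"
        unfolding induced_mg_Sigma using E sc(1) by (subst sum.Sigma) (auto simp: case_prod_unfold)
      finally show "tau * (card (c ` V) - 1) \<le> (\<Sum>f\<in>?M. card (c ` snd f) - 1)" .
    qed
  qed
qed

subsection \<open>Entropy bound for the key rate\<close>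

text \<open>The Shannon entropy of \<^term>\<open>f\<close> under the uniform distribution on \<^term>\<open>\<Omega>\<close>, in nats and scaled by
  \<^term>\<open>card \<Omega>\<close>.\<close>
definition ent :: "'x set \<Rightarrow> ('x \<Rightarrow> 'a) \<Rightarrow> real" where
  "ent \<Omega> f = (\<Sum>x\<in>\<Omega>. ln (real (card \<Omega>) / real (card {y \<in> \<Omega>. f y = f x})))"

text \<open>Entropy sees only the partition of \<open>\<Omega>\<close> into fibres. All recoding of
  random variables, across different codomains, goes through this.\<close>

lemma ent_cong:
  assumes "\<And>x y. x \<in> \<Omega> \<Longrightarrow> y \<in> \<Omega> \<Longrightarrow> f x = f y \<longleftrightarrow> g x = g y"
  shows "ent \<Omega> f = ent \<Omega> g"
proof -
  have "{y \<in> \<Omega>. f y = f x} = {y \<in> \<Omega>. g y = g x}" if "x \<in> \<Omega>" for x using assms that by blast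
  then show ?thesis unfolding ent_def by simp
qed

lemma ent_uniform:
  assumes "\<And>x. x \<in> \<Omega> \<Longrightarrow> real (card \<Omega>) / real (card {y \<in> \<Omega>. f y = f x}) = p"
  shows "ent \<Omega> f = real (card \<Omega>) * ln p"
  using assms unfolding ent_def by simp

lemma card_fibre_pos:
  assumes "finite \<Omega>" "x \<in> \<Omega>"
  shows "card {y \<in> \<Omega>. f y = f x} > 0"
  using assms by (auto simp: card_gt_0_iff)

text \<open>Conditional mutual information is nonnegative. After \<open>ln u \<le> u - 1\<close> it
  remains to weigh triples in which \<open>y\<close> shares \<open>f\<close> and \<open>h\<close>
  with \<open>x\<close>, and \<open>z\<close> shares \<open>g\<close> and \<open>h\<close> with
  \<open>x\<close>; summing over \<open>x\<close> first makes the weights telescope.\<close>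

lemma ent_submodular:
  assumes fin: "finite \<Omega>"
  shows "ent \<Omega> (\<lambda>x. (f x, g x, h x)) + ent \<Omega> h \<le> ent \<Omega> (\<lambda>x. (f x, h x)) + ent \<Omega> (\<lambda>x. (g x, h x))"
proof -
  let ?N = "\<lambda>f x. card {y \<in> \<Omega>. f y = f x}"
  define Nfgh where "Nfgh x = ?N (\<lambda>x. (f x, g x, h x)) x" for x
  define Nfh where "Nfh x = ?N (\<lambda>x. (f x, h x)) x" for x
  define Ngh where "Ngh x = ?N (\<lambda>x. (g x, h x)) x" for x
  define Nh where "Nh x = ?N h x" for x
  have pos: "Nfgh x > 0" "Nfh x > 0" "Ngh x > 0" "Nh x > 0" "card \<Omega> > 0" if "x \<in> \<Omega>" for x
    unfolding Nfgh_def Nfh_def Ngh_def Nh_def using that fin by (auto simp: card_gt_0_iff)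
  define w where "w x = 1 / (real (Nfgh x) * real (Nh x))" for x
  define P where "P x y z \<longleftrightarrow> f y = f x \<and> h y = h x \<and> g z = g x \<and> h z = h x" for x y z
  have "(\<Sum>x\<in>\<Omega>. real (Nfh x) * real (Ngh x) * w x) = (\<Sum>x\<in>\<Omega>. \<Sum>y\<in>\<Omega>. \<Sum>z\<in>\<Omega>. if P x y z then w x else 0)"
  proof (intro sum.cong refl)
    fix x
    have "real (Nfh x) * real (Ngh x) * w x
      = (\<Sum>y\<in>\<Omega>. if f y = f x \<and> h y = h x then 1 else 0) * (\<Sum>z\<in>\<Omega>. if g z = g x \<and> h z = h x then w x else 0)"
      unfolding Nfh_def Ngh_def using fin by (simp add: sum.If_cases Int_def)
    also have "\<dots> = (\<Sum>y\<in>\<Omega>. \<Sum>z\<in>\<Omega>. if P x y z then w x else 0)"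
      unfolding sum_product P_def by (intro sum.cong refl) simp
    finally show "real (Nfh x) * real (Ngh x) * w x = (\<Sum>y\<in>\<Omega>. \<Sum>z\<in>\<Omega>. if P x y z then w x else 0)" .
  qed
  also have "\<dots> = (\<Sum>y\<in>\<Omega>. \<Sum>z\<in>\<Omega>. \<Sum>x\<in>\<Omega>. if P x y z then w x else 0)"
    by (subst sum.swap, rule sum.cong[OF refl], rule sum.swap)
  also have "\<dots> \<le> (\<Sum>y\<in>\<Omega>. \<Sum>z\<in>\<Omega>. if h z = h y then 1 / real (Nh y) else 0)"
  proof (intro sum_mono)
    \<comment> \<open>For fixed \<open>y\<close> and \<open>z\<close> the admissible
      \<open>x\<close> form one fibre of the triple \<open>(f, g, h)\<close> or none, so weights
      that divide by the size of that fibre add up to \<open>1 / Nh y\<close> or 0.\<close>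
    fix y z assume yz: "y \<in> \<Omega>" "z \<in> \<Omega>"
    let ?C = "{x \<in> \<Omega>. P x y z}"
    have "(\<Sum>x\<in>\<Omega>. if P x y z then w x else 0) = (\<Sum>x\<in>?C. w x)"
      using fin by (simp add: sum.If_cases Int_def)
    also have "\<dots> \<le> (if h z = h y then 1 / real (Nh y) else 0)"
    proof (cases "?C = {}")
      case True
      then show ?thesis by (simp only: True) simp
    next
      case False
      have "w x = 1 / (real (card ?C) * real (Nh y))" if x: "x \<in> ?C" for x
      proof -
        have "{y \<in> \<Omega>. (f y, g y, h y) = (f x, g x, h x)} = ?C" "{a \<in> \<Omega>. h a = h x} = {a \<in> \<Omega>. h a = h y}"
          using x unfolding P_def by auto
        then show ?thesis unfolding w_def Nfgh_def Nh_def by (simp only:)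
      qed
      then have "(\<Sum>x\<in>?C. w x) = (\<Sum>x\<in>?C. 1 / (real (card ?C) * real (Nh y)))" by (rule sum.cong[OF refl])
      also have "\<dots> = 1 / real (Nh y)" using False fin by simp
      finally show ?thesis using False unfolding P_def by auto
    qed
    finally show "(\<Sum>x\<in>\<Omega>. if P x y z then w x else 0) \<le> (if h z = h y then 1 / real (Nh y) else 0)" .
  qed
  also have "\<dots> = (\<Sum>y\<in>\<Omega>. 1)"
  proof (intro sum.cong refl)
    fix y assume "y \<in> \<Omega>"
    then show "(\<Sum>z\<in>\<Omega>. if h z = h y then 1 / real (Nh y) else 0) = 1"
      using fin pos(4)[of y] unfolding Nh_def by (auto simp: sum.If_cases Int_def)
  qed
  finally have bound: "(\<Sum>x\<in>\<Omega>. real (Nfh x) * real (Ngh x) * w x) \<le> real (card \<Omega>)" by simp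
  have "ent \<Omega> (\<lambda>x. (f x, g x, h x)) + ent \<Omega> h - ent \<Omega> (\<lambda>x. (f x, h x)) - ent \<Omega> (\<lambda>x. (g x, h x))
     = (\<Sum>x\<in>\<Omega>. ln (real (Nfh x) * real (Ngh x) * w x))"
    unfolding ent_def Nfgh_def[symmetric] Nfh_def[symmetric] Ngh_def[symmetric] Nh_def[symmetric]
      sum.distrib[symmetric] sum_subtractf[symmetric]
  proof (intro sum.cong refl)
    fix x assume "x \<in> \<Omega>"
    then show "ln (real (card \<Omega>) / real (Nfgh x)) + ln (real (card \<Omega>) / real (Nh x))
        - ln (real (card \<Omega>) / real (Nfh x)) - ln (real (card \<Omega>) / real (Ngh x))
       = ln (real (Nfh x) * real (Ngh x) * w x)"
      unfolding w_def using pos[of x] by (simp add: ln_div ln_mult)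
  qed
  also have "\<dots> \<le> (\<Sum>x\<in>\<Omega>. real (Nfh x) * real (Ngh x) * w x - 1)"
  proof (rule sum_mono)
    fix x assume "x \<in> \<Omega>"
    then have "real (Nfh x) * real (Ngh x) * w x > 0" unfolding w_def using pos[of x] by simp
    then show "ln (real (Nfh x) * real (Ngh x) * w x) \<le> real (Nfh x) * real (Ngh x) * w x - 1"
      by (rule ln_le_minus_one)
  qed
  also have "\<dots> \<le> 0" using bound by (simp add: sum_subtractf)
  finally show ?thesis by linarith
qed

text \<open>Submodularity in conditional form: knowing \<open>X\<close> can only lower the
  information gained in passing from \<open>T\<close> to the finer \<open>T'\<close>.\<close>

lemma ent_increment_cond:
  assumes fin: "finite \<Omega>"
    and ref: "\<And>x y. x \<in> \<Omega> \<Longrightarrow> y \<in> \<Omega> \<Longrightarrow> T' x = T' y \<Longrightarrow> T x = T y"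
  shows "ent \<Omega> (\<lambda>x. (T' x, X x)) - ent \<Omega> (\<lambda>x. (T x, X x)) \<le> ent \<Omega> T' - ent \<Omega> T"
proof -
  have "ent \<Omega> (\<lambda>x. (T' x, X x, T x)) + ent \<Omega> T \<le> ent \<Omega> (\<lambda>x. (T' x, T x)) + ent \<Omega> (\<lambda>x. (X x, T x))"
    by (rule ent_submodular[OF fin])
  moreover have "ent \<Omega> (\<lambda>x. (T' x, X x, T x)) = ent \<Omega> (\<lambda>x. (T' x, X x))"
    by (intro ent_cong) (simp, use ref in blast)
  moreover have "ent \<Omega> (\<lambda>x. (T' x, T x)) = ent \<Omega> T'" by (intro ent_cong) (simp, use ref in blast)
  moreover have "ent \<Omega> (\<lambda>x. (X x, T x)) = ent \<Omega> (\<lambda>x. (T x, X x))" by (intro ent_cong) auto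
  ultimately show ?thesis by linarith
qed

text \<open>The potential that proves the upper bound on the key rate: it never decreases when a transmission of
  some block is revealed, and it gains \<^term>\<open>card B - 1\<close> times the key entropy when the key,
  which all blocks can compute, is revealed.\<close>
definition block_potential :: "'x set \<Rightarrow> 'b set \<Rightarrow> ('b \<Rightarrow> 'x \<Rightarrow> 'c) \<Rightarrow> ('x \<Rightarrow> 'a) \<Rightarrow> real" where
  "block_potential \<Omega> B X Z = (real (card B) - 1) * ent \<Omega> Z - (\<Sum>b\<in>B. ent \<Omega> (\<lambda>x. (Z x, X b x)) - ent \<Omega> (X b))"

text \<open>The subtracted term of the block that computes the step stays put; each of the other
  \<open>card B - 1\<close> terms grows by at most the increase of \<open>ent\<close>, which the
  leading coefficient covers.\<close>

lemma block_potential_own: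
  assumes fin: "finite \<Omega>" and B: "finite B" "b \<in> B"
    and ref: "\<And>x y. x \<in> \<Omega> \<Longrightarrow> y \<in> \<Omega> \<Longrightarrow> T' x = T' y \<Longrightarrow> T x = T y"
    and own: "\<And>x y. x \<in> \<Omega> \<Longrightarrow> y \<in> \<Omega> \<Longrightarrow> T x = T y \<Longrightarrow> X b x = X b y \<Longrightarrow> T' x = T' y"
  shows "block_potential \<Omega> B X T \<le> block_potential \<Omega> B X T'"
proof -
  let ?d = "\<lambda>b. ent \<Omega> (\<lambda>x. (T' x, X b x)) - ent \<Omega> (\<lambda>x. (T x, X b x))"
  have "?d b = 0"
  proof -
    have "ent \<Omega> (\<lambda>x. (T' x, X b x)) = ent \<Omega> (\<lambda>x. (T x, X b x))"
      using ref own by (intro ent_cong) blast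
    then show ?thesis by simp
  qed
  then have "(\<Sum>b\<in>B. ?d b) = (\<Sum>b\<in>B - {b}. ?d b)" using B by (simp add: sum.remove)
  also have "\<dots> \<le> (\<Sum>b\<in>B - {b}. ent \<Omega> T' - ent \<Omega> T)"
    using fin ref by (intro sum_mono ent_increment_cond) blast+
  also have "\<dots> = (real (card B) - 1) * (ent \<Omega> T' - ent \<Omega> T)"
  proof -
    have "card B \<ge> 1" using B by (metis One_nat_def Suc_leI card_gt_0_iff empty_iff)
    then show ?thesis using B by (simp add: of_nat_diff)
  qed
  finally show ?thesis unfolding block_potential_def by (simp add: sum_subtractf algebra_simps)
qed

text \<open>Every block computes the step, so all subtracted terms stay put and the growth of the
  leading term is pure gain.\<close>

lemma block_potential_common:
  assumes ref: "\<And>x y. x \<in> \<Omega> \<Longrightarrow> y \<in> \<Omega> \<Longrightarrow> T' x = T' y \<Longrightarrow> T x = T y"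
    and own: "\<And>b x y. b \<in> B \<Longrightarrow> x \<in> \<Omega> \<Longrightarrow> y \<in> \<Omega> \<Longrightarrow> T x = T y \<Longrightarrow> X b x = X b y \<Longrightarrow> T' x = T' y"
  shows "block_potential \<Omega> B X T' = block_potential \<Omega> B X T + (real (card B) - 1) * (ent \<Omega> T' - ent \<Omega> T)"
proof -
  have "ent \<Omega> (\<lambda>x. (T' x, X b x)) = ent \<Omega> (\<lambda>x. (T x, X b x))" if "b \<in> B" for b
    using ref own[OF that] by (intro ent_cong) blast
  then show ?thesis unfolding block_potential_def by (simp add: algebra_simps)
qed

section \<open>Key rate on product spaces\<close>

text \<open>Only injectivity of the coordinates and the sizes of cylinders are recorded. Thus one
  entropy bound serves the message space, whose elements are \<open>undefined\<close> outside the
  index set, and also vectors that vanish outside a set.\<close>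

definition product_space :: "('m \<Rightarrow> 'f) set \<Rightarrow> 'm set \<Rightarrow> nat \<Rightarrow> bool" where
  "product_space \<Omega> E q \<longleftrightarrow> finite \<Omega> \<and> \<Omega> \<noteq> {} \<and> finite E \<and> q \<ge> 2
     \<and> (\<forall>x\<in>\<Omega>. \<forall>y\<in>\<Omega>. (\<forall>e\<in>E. x e = y e) \<longrightarrow> x = y)
     \<and> (\<forall>J\<subseteq>E. \<forall>x\<in>\<Omega>. card {y \<in> \<Omega>. \<forall>e\<in>J. y e = x e} = q ^ (card E - card J))"

lemma product_space_ent:
  assumes ps: "product_space \<Omega> E q" and J: "J \<subseteq> E"
  shows "ent \<Omega> (\<lambda>x. restrict x J) = real (card \<Omega>) * (real (card J) * ln (real q))"
proof -
  have fin: "finite E" "finite \<Omega>" "q \<ge> 2" using ps unfolding product_space_def by auto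
  have cJ: "card J \<le> card E" using J fin by (simp add: card_mono)
  have "ent \<Omega> (\<lambda>x. restrict x J) = real (card \<Omega>) * ln (real q ^ card J)"
  proof (rule ent_uniform)
    fix x assume x: "x \<in> \<Omega>"
    have cyl: "card {y \<in> \<Omega>. \<forall>e\<in>K. y e = x e} = q ^ (card E - card K)" if "K \<subseteq> E" for K
      using ps x that unfolding product_space_def by blast
    have "{y \<in> \<Omega>. restrict y J = restrict x J} = {y \<in> \<Omega>. \<forall>e\<in>J. y e = x e}"
      by (auto simp: restrict_def fun_eq_iff)
    then have "card {y \<in> \<Omega>. restrict y J = restrict x J} = q ^ (card E - card J)" using cyl[OF J] by simp
    moreover have "card \<Omega> = q ^ card E" using cyl[of "{}"] by simp
    ultimately show "real (card \<Omega>) / real (card {y \<in> \<Omega>. restrict y J = restrict x J}) = real q ^ card J"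
    proof -
      have "q ^ card E = q ^ (card E - card J) * q ^ card J" using cJ by (simp flip: power_add)
      then show ?thesis using \<open>card \<Omega> = q ^ card E\<close> \<open>card {y \<in> \<Omega>. restrict y J = restrict x J} = _\<close> fin
        by simp
    qed
  qed
  then show ?thesis using fin by (simp add: ln_realpow)
qed

text \<open>Each block acts as one client that pools its members' messages. The potential starts at
  0, and its final value, when all messages are out, is the right-hand side of the partition
  inequality times \<open>?u\<close>. Transcript and key enter only through what determines what, so
  neither has to be linear.\<close>

theorem key_rate_bound:
  fixes \<Omega> :: "('m \<Rightarrow> 'f) set" and inc :: "'m \<Rightarrow> 'v set" and T :: "nat \<Rightarrow> ('m \<Rightarrow> 'f) \<Rightarrow> 'a"
  assumes ps: "product_space \<Omega> E q"
    and V: "finite V" "V \<noteq> {}"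
    and inc: "\<And>e. e \<in> E \<Longrightarrow> inc e \<subseteq> V" "\<And>e. e \<in> E \<Longrightarrow> inc e \<noteq> {}"
    and T0: "\<And>x y. x \<in> \<Omega> \<Longrightarrow> y \<in> \<Omega> \<Longrightarrow> T 0 x = T 0 y"
    and Tref: "\<And>r x y. r < t \<Longrightarrow> x \<in> \<Omega> \<Longrightarrow> y \<in> \<Omega> \<Longrightarrow> T (Suc r) x = T (Suc r) y \<Longrightarrow> T r x = T r y"
    and s: "\<And>r. r < t \<Longrightarrow> s r \<in> V"
    and Town: "\<And>r x y. r < t \<Longrightarrow> x \<in> \<Omega> \<Longrightarrow> y \<in> \<Omega> \<Longrightarrow> T r x = T r y
        \<Longrightarrow> (\<forall>e\<in>E. s r \<in> inc e \<longrightarrow> x e = y e) \<Longrightarrow> T (Suc r) x = T (Suc r) y"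
    and K: "\<And>j x y. j \<in> V \<Longrightarrow> x \<in> \<Omega> \<Longrightarrow> y \<in> \<Omega> \<Longrightarrow> T t x = T t y
        \<Longrightarrow> (\<forall>e\<in>E. j \<in> inc e \<longrightarrow> x e = y e) \<Longrightarrow> K x = K y"
    and rate: "real (card \<Omega>) * (real tau * ln (real q)) \<le> ent \<Omega> (\<lambda>x. (T t x, K x)) - ent \<Omega> (T t)"
  shows "partition_connected tau V E inc"
  unfolding partition_connected_def
proof
  fix c :: "'v \<Rightarrow> 'v set"
  have fin: "finite E" "finite \<Omega>" "q \<ge> 2" "card \<Omega> > 0"
    using ps unfolding product_space_def by (auto simp: card_gt_0_iff)
  define B where "B = c ` V"
  define J where "J b = {e \<in> E. b \<in> c ` inc e}" for b
  define X where "X b x = restrict x (J b)" for b and x :: "'m \<Rightarrow> 'f"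
  have B: "finite B" "B \<noteq> {}" using V unfolding B_def by auto
  have Xj: "\<forall>e\<in>E. j \<in> inc e \<longrightarrow> x e = y e" if "X (c j) x = X (c j) y" for j x y
  proof (intro ballI impI)
    fix e assume "e \<in> E" "j \<in> inc e"
    then have "e \<in> J (c j)" unfolding J_def by blast
    then show "x e = y e" using that unfolding X_def by (metis restrict_apply')
  qed
  let ?P = "\<lambda>Z. block_potential \<Omega> B X Z"
  have chain: "r \<le> t \<Longrightarrow> 0 \<le> ?P (T r)" for r
  proof (induction r)
    case 0
    have "ent \<Omega> (T 0) = ent \<Omega> (\<lambda>_. ())" using T0 by (intro ent_cong) blast
    also have "\<dots> = 0" using fin unfolding ent_def by simp
    finally have 1: "ent \<Omega> (T 0) = 0" .
    have 2: "ent \<Omega> (\<lambda>x. (T 0 x, X b x)) = ent \<Omega> (X b)" for b using T0 by (intro ent_cong) blast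
    show ?case unfolding block_potential_def 1 2 by simp
  next
    case (Suc r)
    then have r: "r < t" by simp
    have "?P (T r) \<le> ?P (T (Suc r))"
    proof (rule block_potential_own[OF fin(2) B(1), of "c (s r)"])
      show "c (s r) \<in> B" using s[OF r] unfolding B_def by blast
      show "T r x = T r y" if "x \<in> \<Omega>" "y \<in> \<Omega>" "T (Suc r) x = T (Suc r) y" for x y
        using Tref[OF r that] .
      show "T (Suc r) x = T (Suc r) y"
        if "x \<in> \<Omega>" "y \<in> \<Omega>" "T r x = T r y" "X (c (s r)) x = X (c (s r)) y" for x y
        using Town[OF r that(1-3) Xj[OF that(4)]] .
    qed
    then show ?case using Suc by simp
  qed
  \<comment> \<open>After the key, the blocks disclose their messages one block at a time; each
    disclosure is a step computable by its own block.\<close>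
  define Z where "Z C x = (T t x, K x, restrict x (\<Union>b\<in>C. J b))" for C x
  have PZ: "?P (\<lambda>x. (T t x, K x)) \<le> ?P (Z C)" if "C \<subseteq> B" for C
    using finite_subset[OF that B(1)] that
  proof (induction C rule: finite_induct)
    case empty
    have "ent \<Omega> (Z {}) = ent \<Omega> (\<lambda>x. (T t x, K x))" unfolding Z_def by (intro ent_cong) auto
    moreover have "ent \<Omega> (\<lambda>x. (Z {} x, X b x)) = ent \<Omega> (\<lambda>x. ((T t x, K x), X b x))" for b
      unfolding Z_def by (intro ent_cong) auto
    ultimately show ?case unfolding block_potential_def by simp
  next
    case (insert b C)
    have eqr: "restrict x (\<Union>b\<in>insert b C. J b) = restrict y (\<Union>b\<in>insert b C. J b)
       \<longleftrightarrow> X b x = X b y \<and> restrict x (\<Union>b\<in>C. J b) = restrict y (\<Union>b\<in>C. J b)" for x y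
      unfolding X_def by (auto simp: restrict_def fun_eq_iff)
    have "?P (Z C) \<le> ?P (Z (insert b C))"
    proof (rule block_potential_own[OF fin(2) B(1), of b])
      show "b \<in> B" using insert by simp
      show "Z C x = Z C y" if "Z (insert b C) x = Z (insert b C) y" for x y
        using that eqr[of x y] unfolding Z_def by (simp del: UN_insert)
      show "Z (insert b C) x = Z (insert b C) y" if "Z C x = Z C y" "X b x = X b y" for x y
        using that eqr[of x y] unfolding Z_def by (simp del: UN_insert)
    qed
    then show ?case using insert by auto
  qed
  have "?P (\<lambda>x. (T t x, K x)) = ?P (T t) + (real (card B) - 1) * (ent \<Omega> (\<lambda>x. (T t x, K x)) - ent \<Omega> (T t))"
  proof (rule block_potential_common)
    show "(T t x, K x) = (T t y, K y)"
      if b: "b \<in> B" and xy: "x \<in> \<Omega>" "y \<in> \<Omega>" "T t x = T t y" "X b x = X b y" for b x y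
    proof -
      obtain j where "j \<in> V" "b = c j" using b unfolding B_def by blast
      then show ?thesis using K[OF _ xy(1-3)] Xj xy by simp
    qed
  qed simp
  moreover have k1: "real (card B) - 1 \<ge> 0" using B by (simp add: Suc_leI card_gt_0_iff)
  moreover have "(real (card B) - 1) * (real (card \<Omega>) * (real tau * ln (real q)))
     \<le> (real (card B) - 1) * (ent \<Omega> (\<lambda>x. (T t x, K x)) - ent \<Omega> (T t))"
    using rate k1 by (rule mult_left_mono)
  ultimately have low: "(real (card B) - 1) * (real (card \<Omega>) * (real tau * ln (real q))) \<le> ?P (Z B)"
    using PZ[of B] chain[of t] by simp
  have JB: "(\<Union>b\<in>B. J b) = E"
  proof
    show "E \<subseteq> (\<Union>b\<in>B. J b)"
    proof
      fix e assume e: "e \<in> E"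
      then obtain v where "v \<in> inc e" "v \<in> V" using inc[OF e] by blast
      then show "e \<in> (\<Union>b\<in>B. J b)" using e unfolding J_def B_def by blast
    qed
  qed (auto simp: J_def)
  \<comment> \<open>Now everything is known. The total entropy occurs \<open>card B - 1\<close>
    times with plus and \<open>card B\<close> times with minus, so the potential is the sum of the
    block entropies minus the total.\<close>
  have ZB: "ent \<Omega> (Z B) = ent \<Omega> (\<lambda>x. restrict x E)" "ent \<Omega> (\<lambda>x. (Z B x, X b x)) = ent \<Omega> (\<lambda>x. restrict x E)" for b
  proof -
    have "x = y" if "restrict x E = restrict y E" "x \<in> \<Omega>" "y \<in> \<Omega>" for x y
    proof -
      have "\<forall>e\<in>E. x e = y e" using that(1) by (metis restrict_apply')
      then show ?thesis using ps that unfolding product_space_def by blast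
    qed
    note inj = this
    show "ent \<Omega> (Z B) = ent \<Omega> (\<lambda>x. restrict x E)"
      unfolding Z_def JB by (intro ent_cong) (auto dest: inj)
    show "ent \<Omega> (\<lambda>x. (Z B x, X b x)) = ent \<Omega> (\<lambda>x. restrict x E)"
      unfolding Z_def JB by (intro ent_cong) (auto dest: inj)
  qed
  let ?u = "real (card \<Omega>) * ln (real q)"
  have "ent \<Omega> (X b) = real (card (J b)) * ?u" for b
    unfolding X_def using product_space_ent[OF ps, of "J b"] by (simp add: J_def)
  moreover have "ent \<Omega> (\<lambda>x. restrict x E) = real (card E) * ?u"
    using product_space_ent[OF ps, of E] by simp
  ultimately have "?P (Z B) = (\<Sum>b\<in>B. real (card (J b)) * ?u) - real (card E) * ?u"
    unfolding block_potential_def ZB by (simp add: sum_subtractf algebra_simps)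
  also have "\<dots> = (real (\<Sum>b\<in>B. card (J b)) - real (card E)) * ?u"
    by (simp only: left_diff_distrib of_nat_sum sum_distrib_right)
  also have "(\<Sum>b\<in>B. card (J b)) = (\<Sum>e\<in>E. card (c ` inc e) - 1) + card E"
    unfolding J_def B_def using fin V inc by (intro sum_card_colours_minus_1) (auto intro!: image_mono)
  finally have "?P (Z B) = real (\<Sum>e\<in>E. card (c ` inc e) - 1) * ?u" by simp
  then have "((real (card B) - 1) * real tau) * ?u \<le> real (\<Sum>e\<in>E. card (c ` inc e) - 1) * ?u"
    using low by (simp add: algebra_simps)
  moreover have "?u > 0" using fin by simp
  ultimately have "(real (card B) - 1) * real tau \<le> real (\<Sum>e\<in>E. card (c ` inc e) - 1)"
    by (simp only: mult_le_cancel_right_pos)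
  moreover have "real (card B - 1) = real (card B) - 1"
    using B by (simp add: Suc_leI card_gt_0_iff of_nat_diff)
  ultimately have "real (tau * (card B - 1)) \<le> real (\<Sum>e\<in>E. card (c ` inc e) - 1)"
    by (simp add: mult.commute)
  then show "tau * (card (c ` V) - 1) \<le> (\<Sum>e\<in>E. card (c ` inc e) - 1)"
    unfolding B_def by (simp only: of_nat_le_iff)
qed

section \<open>Entropy of keys and general protocols\<close>

text \<open>The factor converts bits to nats and averages to sums over points. Regrouped by points,
  a pair of probability 0 is an empty sum, which agrees with the convention in
  \<open>mutual_info_u\<close>.\<close>

lemma mutual_info_u_ent:
  assumes fin: "finite \<Omega>" "\<Omega> \<noteq> {}"
  shows "mutual_info_u \<Omega> X Y * (real (card \<Omega>) * ln 2) = ent \<Omega> X + ent \<Omega> Y - ent \<Omega> (\<lambda>x. (Y x, X x))"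
proof -
  have n: "card \<Omega> > 0" using fin by (simp add: card_gt_0_iff)
  define NX where "NX a = card {y \<in> \<Omega>. X y = a}" for a
  define NY where "NY b = card {y \<in> \<Omega>. Y y = b}" for b
  define NXY where "NXY a b = card {y \<in> \<Omega>. X y = a \<and> Y y = b}" for a b
  define \<phi> where "\<phi> a b = ln (real (card \<Omega>) / real (NX a)) + ln (real (card \<Omega>) / real (NY b))
      - ln (real (card \<Omega>) / real (NXY a b))" for a b
  have summand: "(let pab = prob_u \<Omega> (\<lambda>x. X x = a \<and> Y x = b) in
      if pab = 0 then 0 else pab * log 2 (pab / (prob_u \<Omega> (\<lambda>x. X x = a) * prob_u \<Omega> (\<lambda>x. Y x = b))))
      * (real (card \<Omega>) * ln 2) = (\<Sum>x\<in>{x \<in> {x \<in> \<Omega>. X x = a}. Y x = b}. \<phi> (X x) (Y x))"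
    for a b
  proof -
    have "{x \<in> {x \<in> \<Omega>. X x = a}. Y x = b} = {y \<in> \<Omega>. X y = a \<and> Y y = b}" by blast
    then have rhs: "(\<Sum>x\<in>{x \<in> {x \<in> \<Omega>. X x = a}. Y x = b}. \<phi> (X x) (Y x)) = real (NXY a b) * \<phi> a b"
      unfolding NXY_def by simp
    have p: "prob_u \<Omega> (\<lambda>x. X x = a \<and> Y x = b) = real (NXY a b) / real (card \<Omega>)"
      "prob_u \<Omega> (\<lambda>x. X x = a) = real (NX a) / real (card \<Omega>)"
      "prob_u \<Omega> (\<lambda>x. Y x = b) = real (NY b) / real (card \<Omega>)"
      unfolding prob_u_def NX_def NY_def NXY_def by auto
    show ?thesis
    proof (cases "NXY a b = 0")
      case True
      then show ?thesis unfolding rhs p by simp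
    next
      case False
      have "NXY a b \<le> NX a" "NXY a b \<le> NY b"
        unfolding NXY_def NX_def NY_def using fin by (auto intro!: card_mono)
      then have pos: "NXY a b > 0" "NX a > 0" "NY b > 0" using False by auto
      have "log 2 ((real (NXY a b) / real (card \<Omega>)) / ((real (NX a) / real (card \<Omega>)) * (real (NY b) / real (card \<Omega>)))) * ln 2
          = \<phi> a b"
        unfolding \<phi>_def log_def using pos n by (simp add: ln_div ln_mult)
      then show ?thesis unfolding rhs p Let_def using pos n by (simp add: field_simps)
    qed
  qed
  have "mutual_info_u \<Omega> X Y * (real (card \<Omega>) * ln 2)
      = (\<Sum>a\<in>X ` \<Omega>. \<Sum>b\<in>Y ` \<Omega>. \<Sum>x\<in>{x \<in> {x \<in> \<Omega>. X x = a}. Y x = b}. \<phi> (X x) (Y x))"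
    unfolding mutual_info_u_def sum_distrib_right summand ..
  also have "\<dots> = (\<Sum>a\<in>X ` \<Omega>. \<Sum>x\<in>{x \<in> \<Omega>. X x = a}. \<phi> (X x) (Y x))"
    using fin by (intro sum.cong refl sum.group) auto
  also have "\<dots> = (\<Sum>x\<in>\<Omega>. \<phi> (X x) (Y x))" using fin by (intro sum.group) auto
  also have "\<dots> = ent \<Omega> X + ent \<Omega> Y - ent \<Omega> (\<lambda>x. (Y x, X x))"
    unfolding ent_def \<phi>_def sum.distrib[symmetric] sum_subtractf[symmetric] NX_def NY_def NXY_def
    by (simp add: conj_commute)
  finally show ?thesis .
qed

lemma product_space_PiE:
  assumes "finite E"
  shows "product_space (PiE E (\<lambda>_. UNIV :: 'f::{finite,field} set)) E (card (UNIV :: 'f set))"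
  unfolding product_space_def
proof (intro conjI ballI allI impI)
  let ?\<Omega> = "PiE E (\<lambda>_. UNIV :: 'f set)"
  show "finite ?\<Omega>" using assms by (simp add: finite_PiE)
  show "?\<Omega> \<noteq> {}" by (simp add: PiE_eq_empty_iff)
  show "finite E" by fact
  have "card {0 :: 'f, 1} \<le> card (UNIV :: 'f set)" by (intro card_mono) auto
  then show "2 \<le> card (UNIV :: 'f set)" by simp
  show "x = y" if "x \<in> ?\<Omega>" "y \<in> ?\<Omega>" "\<forall>e\<in>E. x e = y e" for x y
    using that by (auto intro: PiE_ext)
  show "card {y \<in> ?\<Omega>. \<forall>e\<in>J. y e = x e} = card (UNIV :: 'f set) ^ (card E - card J)"
    if J: "J \<subseteq> E" and x: "x \<in> ?\<Omega>" for J x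
  proof -
    have "{y \<in> ?\<Omega>. \<forall>e\<in>J. y e = x e} = PiE E (\<lambda>e. if e \<in> J then {x e} else UNIV)"
      using J by (auto simp: PiE_iff extensional_def split: if_splits)
    then have "card {y \<in> ?\<Omega>. \<forall>e\<in>J. y e = x e} = (\<Prod>e\<in>E. if e \<in> J then 1 else card (UNIV :: 'f set))"
      using assms by (simp add: card_PiE if_distrib cong: if_cong)
    also have "\<dots> = card (UNIV :: 'f set) ^ card (E - J)"
      using assms by (simp add: prod.If_cases Diff_eq)
    also have "card (E - J) = card E - card J" using J assms by (simp add: card_Diff_subset finite_subset)
    finally show ?thesis .
  qed
qed

lemma hyp_inc_iff: "j \<in> hyp_inc n I e \<longleftrightarrow> j < n \<and> e \<in> I j"
  unfolding hyp_inc_def by simp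

lemma hyp_inc_incidence:
  "hyp_inc n I e \<subseteq> {0..<n}" "e \<in> msg_indices n I \<Longrightarrow> hyp_inc n I e \<noteq> {}"
  unfolding hyp_inc_def msg_indices_def by auto

lemma finite_msg_indices: "\<forall>j<n. finite (I j) \<Longrightarrow> finite (msg_indices n I)"
  unfolding msg_indices_def by simp

text \<open>Uniformity fixes the entropy of the key, and vanishing mutual information makes its
  conditional entropy given the transcript the same.\<close>

lemma generates_keys_rate:
  fixes kf :: "nat \<Rightarrow> ('m \<Rightarrow> 'f) \<Rightarrow> 'f list \<Rightarrow> 'f::{finite,field} list"
  assumes fin: "\<forall>j<n. finite (I j)" and gk: "generates_keys TYPE('f) n I tau t s g kf"
  defines "\<Omega> \<equiv> msg_space TYPE('f) n I"
  shows "ent \<Omega> (\<lambda>x. (trans I s g x t, kf 0 (restrict x (I 0)) (trans I s g x t))) - ent \<Omega> (\<lambda>x. trans I s g x t)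
     = real (card \<Omega>) * (real tau * ln (real (card (UNIV :: 'f set))))"
proof -
  let ?q = "card (UNIV :: 'f set)"
  let ?T = "\<lambda>x. trans I s g x t" and ?K = "\<lambda>x. kf 0 (restrict x (I 0)) (trans I s g x t)"
  have \<Omega>: "finite \<Omega>" "\<Omega> \<noteq> {}" "?q \<ge> 2"
    using product_space_PiE[OF finite_msg_indices[OF fin], where 'f='f]
    unfolding \<Omega>_def msg_space_def product_space_def by auto
  have len: "\<forall>x\<in>\<Omega>. length (?K x) = tau"
    and unif: "\<forall>k. length k = tau \<longrightarrow> prob_u \<Omega> (\<lambda>x. ?K x = k) = 1 / real (?q ^ tau)"
    and mi: "mutual_info_u \<Omega> ?K ?T = 0"
    using gk unfolding generates_keys_def Let_def \<Omega>_def by auto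
  have "ent \<Omega> ?K = real (card \<Omega>) * ln (real ?q ^ tau)"
  proof (rule ent_uniform)
    fix x assume x: "x \<in> \<Omega>"
    have "prob_u \<Omega> (\<lambda>y. ?K y = ?K x) = 1 / real (?q ^ tau)" using len unif x by blast
    then have "real (card {y \<in> \<Omega>. ?K y = ?K x}) / real (card \<Omega>) = 1 / real ?q ^ tau"
      unfolding prob_u_def by simp
    moreover have "card \<Omega> > 0" using \<Omega> by (simp add: card_gt_0_iff)
    ultimately show "real (card \<Omega>) / real (card {y \<in> \<Omega>. ?K y = ?K x}) = real ?q ^ tau"
      using card_fibre_pos[OF \<Omega>(1) x, of ?K]
      using \<Omega>(3) by (simp add: field_simps)
  qed
  then have "ent \<Omega> ?K = real (card \<Omega>) * (real tau * ln (real ?q))" using \<Omega>(3) by (simp add: ln_realpow)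
  moreover have "ent \<Omega> ?K + ent \<Omega> ?T - ent \<Omega> (\<lambda>x. (?T x, ?K x)) = 0"
    using mutual_info_u_ent[OF \<Omega>(1,2), of ?K ?T] mi by simp
  ultimately show ?thesis by simp
qed

text \<open>Arbitrary protocols are covered. Applied to the full index set, this provides the
  candidate without which the minimum in \<open>rho\<close> might not exist.\<close>

lemma protocol_imp_partition_connected:
  fixes I :: "nat \<Rightarrow> 'm set"
  assumes n: "1 \<le> n" and fin: "\<forall>j<n. finite (I j)"
    and pg: "protocol_generates TYPE('f::{finite,field}) n I tau t"
  shows "partition_connected tau {0..<n} (msg_indices n I) (hyp_inc n I)"
proof -
  obtain s g and kf :: "nat \<Rightarrow> ('m \<Rightarrow> 'f) \<Rightarrow> 'f list \<Rightarrow> 'f list"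
    where s: "\<forall>r<t. s r < n" and gk: "generates_keys TYPE('f) n I tau t s g kf"
    using pg unfolding protocol_generates_def by blast
  let ?\<Omega> = "msg_space TYPE('f) n I" and ?E = "msg_indices n I"
  let ?K = "\<lambda>x. kf 0 (restrict x (I 0)) (trans I s g x t)"
  have agree: "restrict x (I j) = restrict y (I j)"
    if "j < n" "\<forall>e\<in>?E. j \<in> hyp_inc n I e \<longrightarrow> x e = y e" for x y :: "'m \<Rightarrow> 'f" and j
    using that unfolding msg_indices_def hyp_inc_iff by (intro restrict_ext) auto
  show ?thesis
  proof (rule key_rate_bound[where \<Omega> = ?\<Omega> and T = "\<lambda>r x. trans I s g x r" and s = s and t = t and K = ?K])
    show "product_space ?\<Omega> ?E (card (UNIV :: 'f set))"
      unfolding msg_space_def by (intro product_space_PiE finite_msg_indices fin)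
    show "{0..<n} \<noteq> {}" using n by auto
    show "trans I s g x (Suc r) = trans I s g y (Suc r)"
      if "r < t" "trans I s g x r = trans I s g y r" "\<forall>e\<in>?E. s r \<in> hyp_inc n I e \<longrightarrow> x e = y e" for r x y
      using agree[of "s r" x y] s that by simp
    show "?K x = ?K y" if "j \<in> {0..<n}" "x \<in> ?\<Omega>" "y \<in> ?\<Omega>" "trans I s g x t = trans I s g y t"
       "\<forall>e\<in>?E. j \<in> hyp_inc n I e \<longrightarrow> x e = y e" for j x y
    proof -
      have j: "j < n" using that(1) by simp
      have "\<forall>z\<in>?\<Omega>. \<forall>j<n. kf j (restrict z (I j)) (trans I s g z t) = ?K z"
        using gk unfolding generates_keys_def Let_def by blast
      then have key: "kf j (restrict z (I j)) (trans I s g z t) = ?K z" if "z \<in> ?\<Omega>" for z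
        using j that by blast
      have "?K x = kf j (restrict x (I j)) (trans I s g x t)" by (rule key[OF that(2), symmetric])
      also have "\<dots> = kf j (restrict y (I j)) (trans I s g y t)" by (simp only: agree[OF j that(5)] that(4))
      also have "\<dots> = ?K y" by (rule key[OF that(3)])
      finally show ?thesis .
    qed
    show "real (card ?\<Omega>) * (real tau * ln (real (card (UNIV :: 'f set))))
      \<le> ent ?\<Omega> (\<lambda>x. (trans I s g x t, ?K x)) - ent ?\<Omega> (\<lambda>x. trans I s g x t)"
      using generates_keys_rate[OF fin gk] by simp
  qed (use s in \<open>auto simp: hyp_inc_def msg_indices_def\<close>)
qed

subsection \<open>Linear protocols: lower bound\<close>

text \<open>Vanishing outside \<open>E\<close>, instead of being \<open>undefined\<close> there,
  makes the message vectors a subspace of all functions.\<close>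

definition supported :: "'m set \<Rightarrow> ('m \<Rightarrow> 'f::zero) set" where
  "supported E = {x. \<forall>i. i \<notin> E \<longrightarrow> x i = 0}"

definition zero_ext :: "'m set \<Rightarrow> ('m \<Rightarrow> 'f::zero) \<Rightarrow> 'm \<Rightarrow> 'f" where
  "zero_ext E x = (\<lambda>e. if e \<in> E then x e else 0)"

lemma bij_betw_restrict: "bij_betw (\<lambda>x. restrict x E) (supported E) (PiE E (\<lambda>_. UNIV))"
  by (rule bij_betw_byWitness[where f' = "zero_ext E"])
     (auto simp: zero_ext_def supported_def restrict_def fun_eq_iff PiE_iff extensional_def)

lemma bij_betw_card_Collect:
  assumes "bij_betw h A B"
  shows "card {x \<in> A. P (h x)} = card {y \<in> B. P y}"
proof -
  have "h ` {x \<in> A. P (h x)} = {y \<in> B. P y}" using assms unfolding bij_betw_def by blast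
  moreover have "inj_on h {x \<in> A. P (h x)}"
    using assms unfolding bij_betw_def by (blast intro: inj_on_subset)
  ultimately show ?thesis by (metis card_image)
qed

lemma ent_bij:
  assumes "bij_betw h \<Omega> \<Omega>'"
  shows "ent \<Omega> (\<lambda>x. f (h x)) = ent \<Omega>' f"
proof -
  have "card \<Omega> = card \<Omega>'" using assms by (rule bij_betw_same_card)
  then show ?thesis
    unfolding ent_def bij_betw_card_Collect[OF assms, of "\<lambda>y. f y = f (h _)"]
    using assms by (simp add: sum.reindex_bij_betw[OF assms, symmetric])
qed

lemma product_space_supported:
  assumes "finite E"
  shows "product_space (supported E :: ('m \<Rightarrow> 'f::{finite,field}) set) E (card (UNIV :: 'f set))"
proof -
  let ?\<Omega> = "supported E :: ('m \<Rightarrow> 'f) set" and ?\<Omega>' = "PiE E (\<lambda>_. UNIV :: 'f set)"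
  have ps: "product_space ?\<Omega>' E (card (UNIV :: 'f set))" using assms by (rule product_space_PiE)
  have bij: "bij_betw (\<lambda>x. restrict x E) ?\<Omega> ?\<Omega>'" by (rule bij_betw_restrict)
  have f1: "finite ?\<Omega>" using bij ps unfolding product_space_def by (simp add: bij_betw_finite)
  have "(\<lambda>_. 0) \<in> ?\<Omega>" unfolding supported_def by simp
  then have f2: "?\<Omega> \<noteq> {}" by blast
  have q2: "card (UNIV :: 'f set) \<ge> 2" using ps unfolding product_space_def by blast
  have f3: "x = y" if "x \<in> ?\<Omega>" "y \<in> ?\<Omega>" "\<forall>e\<in>E. x e = y e" for x y
    using that unfolding supported_def by (auto simp: fun_eq_iff)
  have f4: "card {y \<in> ?\<Omega>. \<forall>e\<in>J. y e = x e} = card (UNIV :: 'f set) ^ (card E - card J)"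
    if "J \<subseteq> E" "x \<in> ?\<Omega>" for J x
  proof -
    have "card {y \<in> ?\<Omega>'. \<forall>e\<in>J. y e = restrict x E e} = card (UNIV :: 'f set) ^ (card E - card J)"
      using ps that bij_betwE[OF bij] unfolding product_space_def by blast
    moreover have "{y \<in> ?\<Omega>. \<forall>e\<in>J. y e = x e} = {y \<in> ?\<Omega>. \<forall>e\<in>J. restrict y E e = restrict x E e}"
      using that by (auto simp: subset_iff)
    ultimately show ?thesis
      using bij_betw_card_Collect[OF bij, of "\<lambda>y. \<forall>e\<in>J. y e = restrict x E e"] by simp
  qed
  show ?thesis
    unfolding product_space_def
  proof (intro conjI)
    show "\<forall>x\<in>?\<Omega>. \<forall>y\<in>?\<Omega>. (\<forall>e\<in>E. x e = y e) \<longrightarrow> x = y" using f3 by blast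
    show "\<forall>J\<subseteq>E. \<forall>x\<in>?\<Omega>. card {y \<in> ?\<Omega>. \<forall>e\<in>J. y e = x e} = card (UNIV :: 'f set) ^ (card E - card J)"
      using f4 by simp
  qed (fact f1 f2 assms q2)+
qed

lemma card_supported:
  assumes "finite E"
  shows "card (supported E :: ('m \<Rightarrow> 'f::{finite,field}) set) = card (UNIV :: 'f set) ^ card E"
    and "finite (supported E :: ('m \<Rightarrow> 'f::{finite,field}) set)"
proof -
  let ?\<Omega> = "supported E :: ('m \<Rightarrow> 'f) set"
  have ps: "product_space ?\<Omega> E (card (UNIV :: 'f set))" using assms by (rule product_space_supported)
  then obtain x where "x \<in> ?\<Omega>" unfolding product_space_def by blast
  then have "card {y \<in> ?\<Omega>. \<forall>e\<in>{}. y e = x e} = card (UNIV :: 'f set) ^ (card E - card ({} :: 'm set))"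
    using ps unfolding product_space_def by blast
  then show "card ?\<Omega> = card (UNIV :: 'f set) ^ card E" by simp
  show "finite ?\<Omega>" using ps unfolding product_space_def by blast
qed

section \<open>Linear algebra by counting\<close>

text \<open>The index type may be infinite. Over a finite field the finite subspaces can be compared
  by cardinality, which takes the place of dimension.\<close>

interpretation fun_space: vector_space "(\<lambda>a x i. a * x i) :: 'f::field \<Rightarrow> ('m \<Rightarrow> 'f) \<Rightarrow> ('m \<Rightarrow> 'f)"
  by standard (auto simp: fun_eq_iff algebra_simps)

lemma subspace_supported: "fun_space.subspace (supported E)"
  unfolding fun_space.subspace_def supported_def by simp

definition annihilator :: "(nat \<Rightarrow> ('m \<Rightarrow> 'f) \<Rightarrow> 'f::field) \<Rightarrow> nat \<Rightarrow> ('m \<Rightarrow> 'f) set" where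
  "annihilator L t = {x. \<forall>r<t. L r x = 0}"

definition linear_forms :: "(nat \<Rightarrow> ('m \<Rightarrow> 'f) \<Rightarrow> 'f::field) \<Rightarrow> bool" where
  "linear_forms L \<longleftrightarrow> (\<forall>r x y a. L r (\<lambda>i. x i + a * y i) = L r x + a * L r y)"

definition transcript :: "(nat \<Rightarrow> ('m \<Rightarrow> 'f) \<Rightarrow> 'f) \<Rightarrow> nat \<Rightarrow> ('m \<Rightarrow> 'f) \<Rightarrow> 'f list" where
  "transcript L t x = map (\<lambda>r. L r x) [0..<t]"

lemma transcript_eq_iff: "transcript L t x = transcript L t y \<longleftrightarrow> (\<forall>r<t. L r x = L r y)"
  unfolding transcript_def by auto

lemma linear_formsD:
  assumes "linear_forms L"
  shows "L r (x + y) = L r x + L r y" "L r (\<lambda>i. a * x i) = a * L r x" "L r 0 = 0" "L r (x - y) = L r x - L r y"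
proof -
  have lin: "L r (\<lambda>i. x i + a * y i) = L r x + a * L r y" for a x y
    using assms unfolding linear_forms_def by blast
  show "L r (x + y) = L r x + L r y" using lin[of x 1 y] by (simp add: plus_fun_def)
  show 0: "L r 0 = 0" using lin[of 0 "-1" 0] by (simp add: zero_fun_def)
  show "L r (\<lambda>i. a * x i) = a * L r x" using lin[of 0 a x] 0 by simp
  show "L r (x - y) = L r x - L r y" using lin[of x "-1" y] by (simp add: fun_diff_def)
qed

lemma subspace_annihilator: "linear_forms L \<Longrightarrow> fun_space.subspace (annihilator L t)"
  unfolding fun_space.subspace_def annihilator_def by (simp add: linear_formsD)

lemma card_transcript_fibre:
  fixes M :: "('m \<Rightarrow> 'f::field) set"
  assumes L: "linear_forms L" and M: "fun_space.subspace M" and x: "x \<in> M"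
  shows "card {y \<in> M. transcript L t y = transcript L t x} = card (M \<inter> annihilator L t)"
proof -
  have "bij_betw (\<lambda>y. y - x) {y \<in> M. transcript L t y = transcript L t x} (M \<inter> annihilator L t)"
  proof (rule bij_betw_byWitness[where f' = "\<lambda>y. y + x"])
    show "(\<lambda>y. y - x) ` {y \<in> M. transcript L t y = transcript L t x} \<subseteq> M \<inter> annihilator L t"
      using x M by (auto simp: transcript_eq_iff annihilator_def linear_formsD[OF L] fun_space.subspace_diff)
    show "(\<lambda>y. y + x) ` (M \<inter> annihilator L t) \<subseteq> {y \<in> M. transcript L t y = transcript L t x}"
      using x M by (auto simp: transcript_eq_iff annihilator_def linear_formsD[OF L] fun_space.subspace_add)
  qed auto
  then show ?thesis by (rule bij_betw_same_card)
qed

text \<open>Rank-nullity as a count: there are at most \<open>card UNIV ^ t\<close> transcripts, and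
  all nonempty fibres are cosets of the kernel.\<close>

lemma card_le_kernel:
  fixes M :: "('m \<Rightarrow> 'f::{finite,field}) set"
  assumes L: "linear_forms L" and M: "fun_space.subspace M" and fin: "finite M"
  shows "card M \<le> card (UNIV :: 'f set) ^ t * card (M \<inter> annihilator L t)"
proof -
  let ?T = "transcript L t"
  have "card M = (\<Sum>v\<in>?T ` M. card {x \<in> M. ?T x = v})"
    using sum.image_gen[OF fin, of "\<lambda>_. 1 :: nat" ?T] by simp
  also have "\<dots> \<le> (\<Sum>v\<in>?T ` M. card (M \<inter> annihilator L t))"
    using card_transcript_fibre[OF L M] by (intro sum_mono) auto
  also have "\<dots> = card (?T ` M) * card (M \<inter> annihilator L t)" by simp
  also have "card (?T ` M) \<le> card {v :: 'f list. set v \<subseteq> UNIV \<and> length v = t}"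
    by (intro card_mono finite_lists_length_eq) (auto simp: transcript_def)
  also have "\<dots> = card (UNIV :: 'f set) ^ t" by (rule card_lists_length_eq) simp
  finally show ?thesis by simp
qed

text \<open>Steinitz exchange. If \<open>E'\<close> is maximal with trivial intersection, every
  further coordinate \<open>e\<close> has a witness in \<open>W\<close> that is nonzero at
  \<open>e\<close> and otherwise lives on \<open>E'\<close>, so its unit vector reduces to
  \<open>E'\<close> modulo \<open>W\<close>. A complement of this kind corresponds to deleting
  messages.\<close>

lemma ex_coordinate_complement:
  fixes W :: "('m \<Rightarrow> 'f::field) set"
  assumes E: "finite E" and W: "fun_space.subspace W"
  shows "\<exists>E'\<subseteq>E. supported E' \<inter> W \<subseteq> {0} \<and> (\<forall>x\<in>supported E. \<exists>w\<in>W. x - w \<in> supported E')"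
proof -
  define P where "P E' \<longleftrightarrow> E' \<subseteq> E \<and> supported E' \<inter> W \<subseteq> {0}" for E'
  have "P {}" unfolding P_def supported_def by (auto simp: fun_eq_iff)
  moreover have "\<forall>E'. P E' \<longrightarrow> card E' < card E + 1"
    using E unfolding P_def by (auto simp: card_mono less_Suc_eq_le)
  ultimately obtain E' where E': "P E'" and max: "\<And>E''. P E'' \<Longrightarrow> card E'' \<le> card E'"
    using ex_has_greatest_nat[of P "{}" card "card E + 1"] by blast
  have finE': "finite E'" using E' E finite_subset unfolding P_def by blast
  note sub = subspace_supported[of E']
  have unit: "\<exists>w\<in>W. (\<lambda>i. if i = e then a else 0) - w \<in> supported E'" if e: "e \<in> E" for e a
  proof (cases "e \<in> E'")
    case True
    then show ?thesis using W fun_space.subspace_0 by (intro bexI[of _ 0]) (auto simp: supported_def)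
  next
    case False
    then have "\<not> P (insert e E')" using max[of "insert e E'"] finE' by auto
    then obtain w where w: "w \<in> supported (insert e E')" "w \<in> W" "w \<noteq> 0"
      using E' e unfolding P_def by blast
    have we: "w e \<noteq> 0"
    proof
      assume "w e = 0"
      then have "w \<in> supported E'" using w(1) unfolding supported_def by auto
      then show False using E' w unfolding P_def by blast
    qed
    have "(\<lambda>i. (a / w e) * w i) \<in> W" using W w(2) by (rule fun_space.subspace_scale)
    moreover have "(\<lambda>i. if i = e then a else 0) - (\<lambda>i. (a / w e) * w i) \<in> supported E'"
      using w(1) we unfolding supported_def by auto
    ultimately show ?thesis by blast
  qed
  have "\<forall>x\<in>supported F. \<exists>w\<in>W. x - w \<in> supported E'" if "F \<subseteq> E" for F
    using finite_subset[OF that E] that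
  proof (induction F rule: finite_induct)
    case empty
    have "0 \<in> W" using W fun_space.subspace_0 by blast
    moreover have "x = 0" if "x \<in> supported {}" for x :: "'m \<Rightarrow> 'f"
      using that unfolding supported_def by (auto simp: fun_eq_iff)
    ultimately show ?case using fun_space.subspace_0[OF sub] by (intro ballI bexI[of _ 0]) auto
  next
    case (insert e F)
    show ?case
    proof
      fix x :: "'m \<Rightarrow> 'f" assume x: "x \<in> supported (insert e F)"
      let ?u = "\<lambda>i. if i = e then x e else 0"
      have "x - ?u \<in> supported F" using x insert(2) unfolding supported_def by auto
      then obtain w1 where w1: "w1 \<in> W" "(x - ?u) - w1 \<in> supported E'" using insert by blast
      obtain w2 where w2: "w2 \<in> W" "?u - w2 \<in> supported E'" using unit insert(4) by blast
      have "((x - ?u) - w1) + (?u - w2) \<in> supported E'" using sub w1(2) w2(2) by (rule fun_space.subspace_add)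
      moreover have "((x - ?u) - w1) + (?u - w2) = x - (w1 + w2)" by (simp add: algebra_simps)
      moreover have "w1 + w2 \<in> W" using W w1(1) w2(1) by (rule fun_space.subspace_add)
      ultimately show "\<exists>w\<in>W. x - w \<in> supported E'" by metis
    qed
  qed
  then show ?thesis using E' unfolding P_def by blast
qed

text \<open>The span of the ambiguities \<^term>\<open>W\<close> of the individual clients inside the kernel \<^term>\<open>U\<close> of
  the transmissions is invisible to the key, so \<^term>\<open>W\<close> has index at least \<^term>\<open>q ^ tau\<close> in \<^term>\<open>U\<close>.
  Keeping only coordinates of a complement of \<^term>\<open>W\<close>, every client decodes all remaining messages.\<close>
theorem linear_key_converse:
  fixes L :: "nat \<Rightarrow> ('m \<Rightarrow> 'f) \<Rightarrow> 'f::{finite,field}" and inc :: "'m \<Rightarrow> 'v set"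
  defines "q \<equiv> card (UNIV :: 'f set)"
  assumes E: "finite E" and V: "finite V" "V \<noteq> {}"
    and inc: "\<And>e. e \<in> E \<Longrightarrow> inc e \<subseteq> V" "\<And>e. e \<in> E \<Longrightarrow> inc e \<noteq> {}"
    and L: "linear_forms L"
    and s: "\<And>r. r < t \<Longrightarrow> s r \<in> V"
    and own: "\<And>r x y. r < t \<Longrightarrow> x \<in> supported E \<Longrightarrow> y \<in> supported E
        \<Longrightarrow> (\<forall>e\<in>E. s r \<in> inc e \<longrightarrow> x e = y e) \<Longrightarrow> L r x = L r y"
    and K: "\<And>j x y. j \<in> V \<Longrightarrow> x \<in> supported E \<Longrightarrow> y \<in> supported E \<Longrightarrow> transcript L t x = transcript L t y
        \<Longrightarrow> (\<forall>e\<in>E. j \<in> inc e \<longrightarrow> x e = y e) \<Longrightarrow> K x = K y"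
    and rate: "real (card (supported E :: ('m \<Rightarrow> 'f) set)) * (real tau * ln (real q))
        \<le> ent (supported E) (\<lambda>x. (transcript L t x, K x)) - ent (supported E) (transcript L t)"
  shows "\<exists>E'\<subseteq>E. card E' \<le> t + tau \<and> partition_connected tau V E' inc"
proof -
  let ?\<Omega> = "supported E :: ('m \<Rightarrow> 'f) set"
  have q: "q \<ge> 2" and n\<Omega>: "card ?\<Omega> > 0" and fin\<Omega>: "finite ?\<Omega>"
    using product_space_supported[OF E, where 'f='f] unfolding product_space_def q_def
    by (auto simp: card_gt_0_iff)
  define U where "U = ?\<Omega> \<inter> annihilator L t"
  \<comment> \<open>Client \<open>j\<close> cannot tell \<open>x\<close> from \<open>x + v\<close>
    for \<open>v\<close> in its part of \<open>A\<close>: it sees the same transmissions and holds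
    the same messages.\<close>
  define A where "A = (\<Union>j\<in>V. {x \<in> U. \<forall>e\<in>E. j \<in> inc e \<longrightarrow> x e = 0})"
  define W where "W = fun_space.span A"
  have subU: "fun_space.subspace U"
    unfolding U_def by (intro fun_space.subspace_inter subspace_supported subspace_annihilator L)
  have subW: "fun_space.subspace W" unfolding W_def by (rule fun_space.subspace_span)
  have WU: "W \<subseteq> U"
    unfolding W_def using subU by (intro fun_space.span_minimal) (auto simp: A_def)
  have finU: "finite U" using fin\<Omega> unfolding U_def by simp
  \<comment> \<open>Each summand may be vouched for by a different client; since all clients compute
    the same \<open>K\<close>, invariance extends to the span.\<close>
  have KW: "\<forall>x\<in>?\<Omega>. K (x + w) = K x" if "w \<in> W" for w
    using that unfolding W_def
  proof (induction rule: fun_space.span_induct_alt)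
    case base
    then show ?case by simp
  next
    case (step a v w)
    obtain j where j: "j \<in> V" "v \<in> U" "\<forall>e\<in>E. j \<in> inc e \<longrightarrow> v e = 0" using step(1) unfolding A_def by blast
    let ?v = "\<lambda>i. a * v i"
    have v: "?v \<in> U" using subU j(2) by (rule fun_space.subspace_scale)
    show ?case
    proof
      fix x assume x: "x \<in> ?\<Omega>"
      have xv: "x + ?v \<in> ?\<Omega>" using v x unfolding U_def by (auto simp: supported_def)
      have "K (x + ?v) = K x"
      proof (rule K[OF j(1) xv x])
        show "transcript L t (x + ?v) = transcript L t x"
          using v unfolding transcript_eq_iff U_def annihilator_def by (simp add: linear_formsD(1)[OF L])
      qed (use j(3) in auto)
      moreover have "K ((x + ?v) + w) = K (x + ?v)" using step xv by blast
      ultimately show "K (x + (?v + w)) = K x" by (simp only: add.assoc)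
    qed
  qed
  have posW: "card W > 0" using WU finU subW by (auto simp: card_gt_0_iff finite_subset dest: fun_space.subspace_0)
  then have posU: "card U > 0" using card_mono[OF finU WU] by simp
  have fibre: "card {y \<in> ?\<Omega>. transcript L t y = transcript L t x} = card U" if "x \<in> ?\<Omega>" for x
    using card_transcript_fibre[OF L subspace_supported that] unfolding U_def .
  \<comment> \<open>Given the transmissions, messages fill a coset of \<open>U\<close>, and each key
    value fills a union of cosets of \<open>W\<close>. The conditional key entropy per point is
    therefore at most \<open>ln (card U / card W)\<close>.\<close>
  have index: "q ^ tau * card W \<le> card U"
  proof -
    have "ent ?\<Omega> (transcript L t) = real (card ?\<Omega>) * ln (real (card ?\<Omega>) / real (card U))"
      by (rule ent_uniform) (simp add: fibre)
    moreover have "ent ?\<Omega> (\<lambda>x. (transcript L t x, K x)) \<le> (\<Sum>x\<in>?\<Omega>. ln (real (card ?\<Omega>) / real (card W)))"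
      unfolding ent_def
    proof (rule sum_mono)
      fix x assume x: "x \<in> ?\<Omega>"
      let ?F = "{y \<in> ?\<Omega>. (transcript L t y, K y) = (transcript L t x, K x)}"
      have "(\<lambda>w. x + w) ` W \<subseteq> ?F"
      proof
        fix y assume "y \<in> (\<lambda>w. x + w) ` W"
        then obtain w where w: "w \<in> W" "y = x + w" by blast
        then have "w \<in> U" using WU by blast
        then have "y \<in> ?\<Omega>" "transcript L t y = transcript L t x"
          using w(2) x unfolding U_def annihilator_def transcript_eq_iff
          by (auto simp: supported_def linear_formsD(1)[OF L])
        then show "y \<in> ?F" using KW[OF w(1)] x w(2) by simp
      qed
      then have "card ((\<lambda>w. x + w) ` W) \<le> card ?F" using fin\<Omega> by (intro card_mono) auto
      moreover have "card ((\<lambda>w. x + w) ` W) = card W" by (intro card_image) (auto simp: inj_on_def)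
      ultimately have "real (card W) \<le> real (card ?F)" by simp
      then show "ln (real (card ?\<Omega>) / real (card ?F)) \<le> ln (real (card ?\<Omega>) / real (card W))"
        using posW n\<Omega> by (intro ln_mono divide_left_mono) auto
    qed
    ultimately have "real (card ?\<Omega>) * (real tau * ln (real q))
      \<le> real (card ?\<Omega>) * (ln (real (card ?\<Omega>) / real (card W)) - ln (real (card ?\<Omega>) / real (card U)))"
      using rate by (simp add: right_diff_distrib)
    then have "real tau * ln (real q) \<le> ln (real (card ?\<Omega>) / real (card W)) - ln (real (card ?\<Omega>) / real (card U))"
      using n\<Omega> by (simp only: mult_le_cancel_left_pos of_nat_0_less_iff)
    then have "ln (real (q ^ tau * card W)) \<le> ln (real (card U))"
      using n\<Omega> posW posU q by (simp add: ln_div ln_mult ln_realpow)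
    then have "real (q ^ tau * card W) \<le> real (card U)"
      using posW posU q by (subst (asm) ln_le_cancel_iff) auto
    then show ?thesis by (simp only: of_nat_le_iff)
  qed
  obtain E1 where E1: "E1 \<subseteq> E" "supported E1 \<inter> W \<subseteq> {0}" "\<forall>x\<in>?\<Omega>. \<exists>w\<in>W. x - w \<in> supported E1"
    using ex_coordinate_complement[OF E subW] by blast
  have mono: "supported F \<subseteq> (supported F' :: ('m \<Rightarrow> 'f) set)" if "F \<subseteq> F'" for F F'
    using that unfolding supported_def by blast
  have "q ^ tau \<le> card (supported E1 \<inter> annihilator L t)"
  proof -
    let ?S = "supported E1 \<inter> annihilator L t"
    have SU: "?S \<subseteq> U" unfolding U_def using mono[OF E1(1)] by blast
    \<comment> \<open>Modulo \<open>W\<close> every kernel vector moves into the coordinates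
      \<open>E1\<close> and remains in the kernel, because \<open>W\<close> lies in
      \<open>U\<close>.\<close>
    have "U \<subseteq> (\<lambda>(a, w). a + w) ` (?S \<times> W)"
    proof
      fix u assume u: "u \<in> U"
      then obtain w where w: "w \<in> W" "u - w \<in> supported E1" using E1(3) unfolding U_def by blast
      have "u - w \<in> U" using subU u WU w(1) by (blast intro: fun_space.subspace_diff)
      then have "u - w \<in> ?S" using w(2) unfolding U_def by blast
      then show "u \<in> (\<lambda>(a, w). a + w) ` (?S \<times> W)" using w(1) by (intro image_eqI[of _ _ "(u - w, w)"]) auto
    qed
    moreover have fin: "finite (?S \<times> W)" using SU WU finU finite_subset by blast
    ultimately have "card U \<le> card (?S \<times> W)" by (metis card_image_le card_mono finite_imageI le_trans)
    then have "q ^ tau * card W \<le> card ?S * card W"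
      using index by (metis card_cartesian_product le_trans)
    then show ?thesis using posW by simp
  qed
  \<comment> \<open>If too many coordinates survive, any \<open>t + tau\<close> of them do:
    \<open>t\<close> equations leave at least \<open>q ^ tau\<close> solutions, and a smaller
    support still meets \<open>W\<close> trivially.\<close>
  moreover have "\<exists>E2\<subseteq>E1. card E2 \<le> t + tau \<and> q ^ tau \<le> card (supported E2 \<inter> annihilator L t)"
  proof (cases "card E1 \<le> t + tau")
    case True
    then show ?thesis using calculation by blast
  next
    case False
    then obtain E2 where E2: "E2 \<subseteq> E1" "card E2 = t + tau"
      by (meson obtain_subset_with_card_n nat_le_linear)
    have finE2: "finite E2" by (rule finite_subset[OF subset_trans[OF E2(1) E1(1)] E])
    have "q ^ (t + tau) \<le> q ^ t * card (supported E2 \<inter> annihilator L t)"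
      using card_le_kernel[OF L subspace_supported card_supported(2)[OF finE2], of t] E2(2)
        card_supported(1)[OF finE2, where 'f='f] unfolding q_def by simp
    then have "q ^ tau \<le> card (supported E2 \<inter> annihilator L t)" using q by (simp add: power_add)
    then show ?thesis using E2 by (intro exI[of _ E2]) simp
  qed
  ultimately obtain E2 where E2: "E2 \<subseteq> E1" "card E2 \<le> t + tau"
    "q ^ tau \<le> card (supported E2 \<inter> annihilator L t)" by blast
  have E2E: "E2 \<subseteq> E" using E2(1) E1(1) by blast
  have finE2: "finite E2" using E2E E finite_subset by blast
  let ?\<Omega>2 = "supported E2 :: ('m \<Rightarrow> 'f) set"
  have sub2: "?\<Omega>2 \<subseteq> ?\<Omega>" using mono[OF E2E] .
  have agree: "\<forall>e\<in>E. P e \<longrightarrow> x e = y e" if "x \<in> ?\<Omega>2" "y \<in> ?\<Omega>2" "\<forall>e\<in>E2. P e \<longrightarrow> x e = y e" for x y P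
    using that unfolding supported_def by (metis (mono_tags, lifting) mem_Collect_eq)
  have "partition_connected tau V E2 inc"
  \<comment> \<open>The whole vector serves as key: a difference that some client cannot see lies in
    \<open>W\<close> and is supported in \<open>E1\<close>, hence is 0.\<close>
  proof (rule key_rate_bound[where T = "transcript L" and K = "\<lambda>x. x" and t = t and s = s])
    show "product_space ?\<Omega>2 E2 q" unfolding q_def using finE2 by (rule product_space_supported)
    show "transcript L r x = transcript L r y" if "transcript L (Suc r) x = transcript L (Suc r) y" for r x y
      using that by (simp add: transcript_eq_iff)
    show "transcript L (Suc r) x = transcript L (Suc r) y"
      if r: "r < t" and xy: "x \<in> ?\<Omega>2" "y \<in> ?\<Omega>2" and eq: "transcript L r x = transcript L r y"
        and ag: "\<forall>e\<in>E2. s r \<in> inc e \<longrightarrow> x e = y e" for r x y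
    proof -
      have "L r x = L r y" using own[OF r _ _ agree[OF xy ag]] xy sub2 by blast
      then show ?thesis using eq by (auto simp: transcript_eq_iff less_Suc_eq)
    qed
    show "x = y"
      if j: "j \<in> V" and xy: "x \<in> ?\<Omega>2" "y \<in> ?\<Omega>2" and eq: "transcript L t x = transcript L t y"
        and ag: "\<forall>e\<in>E2. j \<in> inc e \<longrightarrow> x e = y e" for j x y
    proof -
      have d2: "x - y \<in> ?\<Omega>2" using subspace_supported xy by (rule fun_space.subspace_diff)
      moreover have "x - y \<in> annihilator L t"
        using eq unfolding annihilator_def transcript_eq_iff by (simp add: linear_formsD(4)[OF L])
      ultimately have "x - y \<in> U" using sub2 unfolding U_def by blast
      moreover have "\<forall>e\<in>E. j \<in> inc e \<longrightarrow> (x - y) e = 0" using agree[OF xy ag] by simp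
      ultimately have "x - y \<in> W" unfolding W_def A_def using j by (intro fun_space.span_base) blast
      moreover have "x - y \<in> supported E1" using mono[OF E2(1)] d2 by blast
      ultimately have "x - y = 0" using E1(2) by blast
      then show ?thesis by simp
    qed
    show "real (card ?\<Omega>2) * (real tau * ln (real q)) \<le> ent ?\<Omega>2 (\<lambda>x. (transcript L t x, x)) - ent ?\<Omega>2 (transcript L t)"
    proof -
      let ?k = "card (?\<Omega>2 \<inter> annihilator L t)"
      have pos: "?k > 0" using E2(3) q by (metis gr0I le_zero_eq not_numeral_le_zero power_not_zero)
      have n2: "card ?\<Omega>2 > 0" using card_supported[OF finE2, where 'f='f] q unfolding q_def by simp
      have "ent ?\<Omega>2 (transcript L t) = real (card ?\<Omega>2) * ln (real (card ?\<Omega>2) / real ?k)"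
        by (rule ent_uniform) (simp add: card_transcript_fibre[OF L subspace_supported])
      moreover have "ent ?\<Omega>2 (\<lambda>x. (transcript L t x, x)) = real (card ?\<Omega>2) * ln (real (card ?\<Omega>2))"
      proof (rule ent_uniform)
        fix x assume "x \<in> ?\<Omega>2"
        then have "{y \<in> ?\<Omega>2. (transcript L t y, y) = (transcript L t x, x)} = {x}" by auto
        then show "real (card ?\<Omega>2) / real (card {y \<in> ?\<Omega>2. (transcript L t y, y) = (transcript L t x, x)})
          = real (card ?\<Omega>2)" by simp
      qed
      moreover have "ln (real q ^ tau) \<le> ln (real ?k)"
      proof (rule ln_mono)
        show "real q ^ tau \<le> real ?k" using E2(3) by (metis of_nat_le_iff of_nat_power)
        show "0 < real q ^ tau" using q by simp
      qed
      then have "real (card ?\<Omega>2) * (real tau * ln (real q)) \<le> real (card ?\<Omega>2) * ln (real ?k)"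
        using q by (simp add: ln_realpow mult_left_mono)
      ultimately show ?thesis using pos n2 by (simp add: ln_div right_diff_distrib)
    qed
  qed (use V inc E2E s in \<open>auto simp: transcript_eq_iff\<close>)
  then show ?thesis using E2 E2E by blast
qed

lemma trans_linear:
  "trans I s (\<lambda>r y p. \<Sum>i\<in>I (s r). c r i * y i) x t = transcript (\<lambda>r x. \<Sum>i\<in>I (s r). c r i * x i) t x"
  by (induction t) (auto simp: transcript_def intro!: sum.cong)

lemma linear_forms_sum: "linear_forms (\<lambda>r x. \<Sum>i\<in>D r. c r i * x i)"
  unfolding linear_forms_def by (simp add: algebra_simps sum.distrib sum_distrib_left)

text \<open>Transcript and key read only held messages, so restriction carries them between
  \<open>supported\<close> and the message space without changing any entropy.\<close>

theorem linear_protocol_converse: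
  fixes I :: "nat \<Rightarrow> 'm set"
  assumes n: "1 \<le> n" and fin: "\<forall>j<n. finite (I j)"
    and lp: "linear_protocol_generates TYPE('f::{finite,field}) n I tau t"
  shows "\<exists>E'\<subseteq>msg_indices n I. card E' \<le> t + tau \<and> partition_connected tau {0..<n} E' (hyp_inc n I)"
proof -
  obtain s c and kf :: "nat \<Rightarrow> ('m \<Rightarrow> 'f) \<Rightarrow> 'f list \<Rightarrow> 'f list" where s: "\<forall>r<t. s r < n"
    and gk: "generates_keys TYPE('f) n I tau t s (\<lambda>r y p. \<Sum>i\<in>I (s r). c r i * y i) kf"
    using lp unfolding linear_protocol_generates_def by blast
  let ?E = "msg_indices n I" and ?\<Omega>' = "msg_space TYPE('f) n I"
  let ?\<Omega> = "supported ?E :: ('m \<Rightarrow> 'f) set"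
  define L where "L r x = (\<Sum>i\<in>I (s r). c r i * x i)" for r and x :: "'m \<Rightarrow> 'f"
  let ?T = "transcript L t"
  define K where "K x = kf 0 (restrict x (I 0)) (?T x)" for x
  have trans_T: "trans I s (\<lambda>r y p. \<Sum>i\<in>I (s r). c r i * y i) x t = ?T x" for x
    unfolding trans_linear L_def ..
  have IE: "I j \<subseteq> ?E" if "j < n" for j using that unfolding msg_indices_def by blast
  have restr: "restrict (restrict x ?E) (I j) = restrict x (I j)" if "j < n" for x :: "'m \<Rightarrow> 'f" and j
    using IE[OF that] by (auto simp: restrict_def fun_eq_iff)
  have T_restr: "?T (restrict x ?E) = ?T x" for x
    unfolding transcript_eq_iff L_def using s IE by (intro allI impI sum.cong refl) auto
  have K_restr: "K (restrict x ?E) = K x" for x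
    unfolding K_def T_restr using restr[of 0] n by simp
  have bij: "bij_betw (\<lambda>x. restrict x ?E) ?\<Omega> ?\<Omega>'" unfolding msg_space_def by (rule bij_betw_restrict)
  have agree: "restrict x (I j) = restrict y (I j)"
    if "j < n" "\<forall>e\<in>?E. j \<in> hyp_inc n I e \<longrightarrow> x e = y e" for x y :: "'m \<Rightarrow> 'f" and j
    using that IE[OF that(1)] unfolding hyp_inc_iff by (intro restrict_ext) auto
  show ?thesis
  proof (rule linear_key_converse[where L = L and s = s and K = K])
    show "finite ?E" using fin by (rule finite_msg_indices)
    show "{0..<n} \<noteq> {}" using n by auto
    show "linear_forms L" using linear_forms_sum[where D = "\<lambda>r. I (s r)" and c = c] unfolding L_def .
    show "L r x = L r y" if r: "r < t" and ag: "\<forall>e\<in>?E. s r \<in> hyp_inc n I e \<longrightarrow> x e = y e" for r x y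
    proof -
      have "x i = y i" if "i \<in> I (s r)" for i
        using ag that s r IE[of "s r"] unfolding hyp_inc_iff by blast
      then show ?thesis unfolding L_def by simp
    qed
    show "K x = K y" if j: "j \<in> {0..<n}" and xy: "x \<in> ?\<Omega>" "y \<in> ?\<Omega>" and eq: "?T x = ?T y"
      and ag: "\<forall>e\<in>?E. j \<in> hyp_inc n I e \<longrightarrow> x e = y e" for j x y
    proof -
      have jn: "j < n" using j by simp
      have dec: "K z = kf j (restrict z (I j)) (?T z)" if "z \<in> ?\<Omega>" for z
      proof -
        let ?z = "restrict z ?E"
        have "?z \<in> ?\<Omega>'" using bij_betwE[OF bij] that by blast
        then have "kf j (restrict ?z (I j)) (?T ?z) = K ?z"
          using gk jn unfolding generates_keys_def Let_def trans_T K_def by blast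
        then show ?thesis unfolding restr[OF jn] T_restr K_restr by simp
      qed
      show ?thesis unfolding dec[OF xy(1)] dec[OF xy(2)] eq agree[OF jn ag] ..
    qed
    show "real (card ?\<Omega>) * (real tau * ln (real (card (UNIV :: 'f set))))
        \<le> ent ?\<Omega> (\<lambda>x. (?T x, K x)) - ent ?\<Omega> ?T"
    proof -
      have "ent ?\<Omega>' (\<lambda>x. (?T x, K x)) - ent ?\<Omega>' ?T = real (card ?\<Omega>') * (real tau * ln (real (card (UNIV :: 'f set))))"
        using generates_keys_rate[OF fin gk] unfolding trans_T K_def by simp
      moreover have "card ?\<Omega> = card ?\<Omega>'" using bij by (rule bij_betw_same_card)
      moreover have "ent ?\<Omega> (\<lambda>x. (?T x, K x)) = ent ?\<Omega>' (\<lambda>x. (?T x, K x))"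
        using ent_bij[OF bij, of "\<lambda>x. (?T x, K x)"] unfolding T_restr K_restr .
      moreover have "ent ?\<Omega> ?T = ent ?\<Omega>' ?T" using ent_bij[OF bij, of ?T] unfolding T_restr .
      ultimately show ?thesis by simp
    qed
  qed (use s in \<open>auto simp: hyp_inc_def msg_indices_def\<close>)
qed

subsection \<open>Linear protocols: construction\<close>

definition dot :: "'m set \<Rightarrow> ('m \<Rightarrow> 'f) \<Rightarrow> ('m \<Rightarrow> 'f) \<Rightarrow> 'f::field" where
  "dot E v x = (\<Sum>e\<in>E. v e * x e)"

lemma dot_add_scale:
  "dot E v (\<lambda>e. x e + a * y e) = dot E v x + a * dot E v y"
  "dot E (\<lambda>e. v e + a * u e) x = dot E v x + a * dot E u x"
  unfolding dot_def by (simp_all add: algebra_simps sum.distrib sum_distrib_left)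

text \<open>This is where the field has to have more elements than there are clients.\<close>
lemma ex_common_vector:
  fixes X :: "'l \<Rightarrow> 'm \<Rightarrow> 'f::{finite,field}"
  assumes "finite \<Lambda>" "card \<Lambda> < card (UNIV :: 'f set)"
    and "\<And>l. l \<in> \<Lambda> \<Longrightarrow> \<exists>u\<in>supported D. dot E u (X l) \<noteq> 0"
  shows "\<exists>v\<in>supported D. \<forall>l\<in>\<Lambda>. dot E v (X l) \<noteq> 0"
  using assms
proof (induction \<Lambda> rule: finite_induct)
  case empty
  have "(\<lambda>_. 0 :: 'f) \<in> supported D" unfolding supported_def by simp
  then show ?case by blast
next
  case (insert l \<Lambda>)
  then obtain v where v: "v \<in> supported D" "\<forall>k\<in>\<Lambda>. dot E v (X k) \<noteq> 0" by auto
  obtain u where u: "u \<in> supported D" "dot E u (X l) \<noteq> 0" using insert by blast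
  \<comment> \<open>Each \<open>k\<close> with \<open>dot E u (X k) \<noteq> 0\<close> forbids one
    root \<open>a\<close>. Where \<open>dot E u (X k)\<close> is 0, division by zero only adds the
    value 0 to the set, and the old \<open>v\<close> already takes care of \<open>k\<close>.\<close>
  let ?bad = "(\<lambda>k. - dot E v (X k) / dot E u (X k)) ` insert l \<Lambda>"
  have "card ?bad \<le> card (insert l \<Lambda>)" using insert(1) by (intro card_image_le) simp
  then have "card ?bad < card (UNIV :: 'f set)" using insert by simp
  then have "?bad \<noteq> UNIV" by (metis less_irrefl)
  then obtain a where a: "a \<notin> ?bad" by blast
  let ?w = "\<lambda>e. v e + a * u e"
  have "?w \<in> supported D" using v(1) u(1) unfolding supported_def by simp
  moreover have "dot E ?w (X k) \<noteq> 0" if k: "k \<in> insert l \<Lambda>" for k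
  proof
    assume "dot E ?w (X k) = 0"
    then have eq: "dot E v (X k) + a * dot E u (X k) = 0" by (simp add: dot_add_scale)
    have "dot E u (X k) \<noteq> 0"
    proof
      assume 0: "dot E u (X k) = 0"
      then have "k \<in> \<Lambda>" using k u(2) by auto
      then show False using eq 0 v(2) by simp
    qed
    then have "a = - dot E v (X k) / dot E u (X k)" using eq by (simp add: field_simps add_eq_0_iff)
    then show False using a k by blast
  qed
  ultimately show ?case by blast
qed

text \<open>The individual matrices are exchanged for a common one row by row; each client objects to the
  new row only if it vanishes on one particular vector.\<close>
lemma ex_common_matrix:
  fixes B :: "nat \<Rightarrow> nat \<Rightarrow> 'm \<Rightarrow> 'f::{finite,field}"
  assumes n: "n < card (UNIV :: 'f set)"
    and N: "\<And>l. l < n \<Longrightarrow> fun_space.subspace (N l)"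
    and B: "\<And>l r. l < n \<Longrightarrow> r < t \<Longrightarrow> B l r \<in> supported (D r)"
    and inj: "\<And>l x. l < n \<Longrightarrow> x \<in> N l \<Longrightarrow> (\<forall>r<t. dot E (B l r) x = 0) \<Longrightarrow> x = 0"
  shows "\<exists>A. (\<forall>r<t. A r \<in> supported (D r)) \<and> (\<forall>l<n. \<forall>x\<in>N l. (\<forall>r<t. dot E (A r) x = 0) \<longrightarrow> x = 0)"
proof -
  have "\<exists>A. (\<forall>r<k. A r \<in> supported (D r)) \<and> (\<forall>l<n. \<forall>x\<in>N l.
      (\<forall>r<k. dot E (A r) x = 0) \<and> (\<forall>r. k \<le> r \<and> r < t \<longrightarrow> dot E (B l r) x = 0) \<longrightarrow> x = 0)"
    if "k \<le> t" for k
    using that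
  proof (induction k)
    case 0
    show ?case
    proof (intro exI[of _ "B 0"] conjI allI impI ballI)
      show "B 0 r \<in> supported (D r)" if "r < 0" for r using that by simp
      show "x = 0" if "l < n" "x \<in> N l" "(\<forall>r<0. dot E (B 0 r) x = 0)
        \<and> (\<forall>r. 0 \<le> r \<and> r < t \<longrightarrow> dot E (B l r) x = 0)" for l x
        using that by (intro inj[OF that(1,2)]) simp
    qed
  next
    case (Suc k)
    from Suc.IH[OF Suc_leD[OF Suc.prems]] obtain A where IH: "(\<forall>r<k. A r \<in> supported (D r)) \<and> (\<forall>l<n. \<forall>x\<in>N l.
        (\<forall>r<k. dot E (A r) x = 0) \<and> (\<forall>r. k \<le> r \<and> r < t \<longrightarrow> dot E (B l r) x = 0) \<longrightarrow> x = 0)"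
      by (elim exE) (rule that)
    then have A: "\<forall>r<k. A r \<in> supported (D r)" by (rule conjunct1)
    have inj_k: "x = 0" if "l < n" "x \<in> N l" "\<forall>r<k. dot E (A r) x = 0"
        "\<forall>r. k \<le> r \<and> r < t \<longrightarrow> dot E (B l r) x = 0" for l x
      using IH that by blast
    \<comment> \<open>Nonzero vectors that only row \<open>k\<close> still excludes. For a fixed
      client they are all multiples of one of them, so a single test vector \<open>X l\<close> per
      client is enough.\<close>
    define Q where "Q l x \<longleftrightarrow> x \<in> N l \<and> x \<noteq> 0 \<and> (\<forall>r<k. dot E (A r) x = 0)
      \<and> (\<forall>r. Suc k \<le> r \<and> r < t \<longrightarrow> dot E (B l r) x = 0)" for l x
    define \<Lambda> where "\<Lambda> = {l. l < n \<and> (\<exists>x. Q l x)}"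
    define X where "X l = (SOME x. Q l x)" for l
    have X: "Q l (X l)" if l: "l \<in> \<Lambda>" for l
    proof -
      obtain x where "Q l x" using l unfolding \<Lambda>_def by blast
      then show ?thesis unfolding X_def by (rule someI[of "Q l"])
    qed
    have BX: "dot E (B l k) (X l) \<noteq> 0" if l: "l \<in> \<Lambda>" for l
    proof
      assume 0: "dot E (B l k) (X l) = 0"
      have "dot E (B l r) (X l) = 0" if "k \<le> r" "r < t" for r
        using 0 X[OF l] that unfolding Q_def by (cases "r = k") auto
      then show False using inj_k[of l "X l"] X[OF l] l unfolding Q_def \<Lambda>_def by blast
    qed
    have "\<exists>v\<in>supported (D k). \<forall>l\<in>\<Lambda>. dot E v (X l) \<noteq> 0"
    proof (rule ex_common_vector)
      have sub: "\<Lambda> \<subseteq> {..<n}" unfolding \<Lambda>_def by auto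
      show "finite \<Lambda>" using sub by (rule finite_subset) simp
      have "card \<Lambda> \<le> n" using card_mono[OF _ sub] by simp
      then show "card \<Lambda> < card (UNIV :: 'f set)" using n by simp
      show "\<exists>u\<in>supported (D k). dot E u (X l) \<noteq> 0" if "l \<in> \<Lambda>" for l
        using BX[OF that] B[of l k] that Suc.prems unfolding \<Lambda>_def by auto
    qed
    then obtain v where v: "v \<in> supported (D k)" "\<And>l. l \<in> \<Lambda> \<Longrightarrow> dot E v (X l) \<noteq> 0" by blast
    have "x = 0" if l: "l < n" and x: "x \<in> N l" and kA: "\<forall>r<Suc k. dot E ((A(k := v)) r) x = 0"
      and kB: "\<forall>r. Suc k \<le> r \<and> r < t \<longrightarrow> dot E (B l r) x = 0" for l x
    proof (rule ccontr)
      assume "x \<noteq> 0"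
      have vx: "dot E v x = 0" using spec[OF kA, of k] by simp
      have Ax: "\<forall>r<k. dot E (A r) x = 0"
      proof (intro allI impI)
        fix r assume "r < k"
        then show "dot E (A r) x = 0" using spec[OF kA, of r] by simp
      qed
      have "Q l x" unfolding Q_def using x \<open>x \<noteq> 0\<close> Ax kB by blast
      then have l\<Lambda>: "l \<in> \<Lambda>" unfolding \<Lambda>_def using l by blast
      note Xl = X[OF l\<Lambda>, unfolded Q_def]
      \<comment> \<open>\<open>\<beta>\<close> cancels the value of the old row \<open>k\<close>.
        All rows before the exchange then kill \<open>?y\<close>, so \<open>x\<close> is a multiple
        of \<open>X l\<close>, on which the new row does not vanish.\<close>
      define \<beta> where "\<beta> = - (dot E (B l k) x / dot E (B l k) (X l))"
      let ?y = "\<lambda>e. x e + \<beta> * X l e"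
      have "x + (\<lambda>e. \<beta> * X l e) \<in> N l"
        using x Xl N[OF l] by (intro fun_space.subspace_add fun_space.subspace_scale) auto
      then have "?y \<in> N l" by (simp add: plus_fun_def)
      moreover have "\<forall>r<k. dot E (A r) ?y = 0" using Ax Xl by (simp add: dot_add_scale)
      moreover have "dot E (B l r) ?y = 0" if "k \<le> r" "r < t" for r
      proof (cases "r = k")
        case True
        then show ?thesis using BX[OF l\<Lambda>] unfolding dot_add_scale \<beta>_def by simp
      next
        case False
        then show ?thesis using kB Xl that by (simp add: dot_add_scale)
      qed
      ultimately have "?y = 0" using inj_k[OF l] by blast
      then have "dot E v ?y = 0" by (simp add: dot_def)
      then have "\<beta> * dot E v (X l) = 0" using vx by (simp add: dot_add_scale)
      then have "\<beta> = 0" using v(2)[OF l\<Lambda>] by simp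
      then show False using \<open>?y = 0\<close> \<open>x \<noteq> 0\<close> by simp
    qed
    moreover have "\<forall>r<Suc k. (A(k := v)) r \<in> supported (D r)" using A v(1) by (simp add: less_Suc_eq)
    ultimately show ?case by blast
  qed
  from this[OF order_refl] obtain A where "(\<forall>r<t. A r \<in> supported (D r)) \<and> (\<forall>l<n. \<forall>x\<in>N l.
      (\<forall>r<t. dot E (A r) x = 0) \<and> (\<forall>r. t \<le> r \<and> r < t \<longrightarrow> dot E (B l r) x = 0) \<longrightarrow> x = 0)"
    by (elim exE) (rule that)
  then show ?thesis by (intro exI[of _ A]) (simp add: linorder_not_le[symmetric])
qed

section \<open>Keys balanced on transcript fibres\<close>

text \<open>A coordinate that is not identically zero on \<open>M\<close> splits off one factor of
  the field size. Divisibility, not just size, is what a balanced key needs.\<close>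

lemma card_subspace_dvd:
  fixes M :: "('m \<Rightarrow> 'f::{finite,field}) set"
  assumes "fun_space.subspace M" "finite M" "card (UNIV :: 'f set) ^ k \<le> card M"
  shows "card (UNIV :: 'f set) ^ k dvd card M"
  using assms
proof (induction k arbitrary: M)
  case (Suc k)
  let ?q = "card (UNIV :: 'f set)"
  have "card {0 :: 'f, 1} \<le> ?q" by (intro card_mono) auto
  then have q: "?q \<ge> 2" by simp
  then have "1 < ?q ^ Suc k" by (intro one_less_power) auto
  then have "1 < card M" using Suc.prems(3) by linarith
  then have "\<not> M \<subseteq> {0}" using card_mono[of "{0}" M] by auto
  then obtain x where x: "x \<in> M" "x \<noteq> 0" by blast
  then obtain e where e: "x e \<noteq> 0" by (auto simp: fun_eq_iff)
  define M' where "M' = {y \<in> M. y e = 0}"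
  note sub = Suc.prems(1)
  have M': "fun_space.subspace M'"
    using sub unfolding M'_def fun_space.subspace_def by simp
  have sc: "(\<lambda>i. a * x i) \<in> M" for a using fun_space.subspace_scale[OF sub x(1)] .
  have "bij_betw (\<lambda>(a, y). y + (\<lambda>i. (a / x e) * x i)) (UNIV \<times> M') M"
  proof (rule bij_betw_byWitness[where f' = "\<lambda>z. (z e, z - (\<lambda>i. (z e / x e) * x i))"])
    have "y + (\<lambda>i. (a / x e) * x i) \<in> M" if "y \<in> M" for a y
      using sub that sc by (rule fun_space.subspace_add)
    then show "(\<lambda>(a, y). y + (\<lambda>i. (a / x e) * x i)) ` (UNIV \<times> M') \<subseteq> M"
      unfolding M'_def by (intro image_subsetI) (simp only: split_paired_all prod.case mem_Sigma_iff mem_Collect_eq)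
    show "(\<lambda>z. (z e, z - (\<lambda>i. (z e / x e) * x i))) ` M \<subseteq> UNIV \<times> M'"
    proof (rule image_subsetI)
      fix z assume "z \<in> M"
      then have "z - (\<lambda>i. (z e / x e) * x i) \<in> M" using sub sc by (blast intro: fun_space.subspace_diff)
      moreover have "(z - (\<lambda>i. (z e / x e) * x i)) e = 0" using e by simp
      ultimately have "z - (\<lambda>i. (z e / x e) * x i) \<in> M'" unfolding M'_def by (intro CollectI conjI)
      then show "(z e, z - (\<lambda>i. (z e / x e) * x i)) \<in> UNIV \<times> M'" by (intro SigmaI UNIV_I)
    qed
  qed (use e in \<open>auto simp: M'_def\<close>)
  then have "card M = ?q * card M'" using bij_betw_same_card by (metis card_cartesian_product)
  moreover have "?q ^ k \<le> card M'" using Suc.prems(3) calculation q by simp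
  then have "?q ^ k dvd card M'"
    using Suc.IH[OF M'] Suc.prems(2) unfolding M'_def by simp
  ultimately show ?case by simp
qed simp

text \<open>The key may be any function, so balance is a matter of cardinality: identify
  \<open>S\<close> with \<open>B\<close> times an interval and project.\<close>

lemma ex_balanced_function:
  assumes S: "finite S" and B: "finite B" "card B dvd card S" "B \<noteq> {}"
  shows "\<exists>f. f ` S \<subseteq> B \<and> (\<forall>b\<in>B. card {x \<in> S. f x = b} * card B = card S)"
proof -
  obtain m where m: "card S = card B * m" using B by blast
  then have eq: "card S = card (B \<times> {..<m})" by (simp add: card_cartesian_product)
  have "finite (B \<times> {..<m})" using B by simp
  then obtain h where h: "bij_betw h S (B \<times> {..<m})"
    using finite_same_card_bij[OF S _ eq] by blast
  have "card {x \<in> S. fst (h x) = b} = m" if "b \<in> B" for b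
  proof -
    have "{y \<in> B \<times> {..<m}. fst y = b} = {b} \<times> {..<m}" using that by auto
    then show ?thesis using bij_betw_card_Collect[OF h, of "\<lambda>y. fst y = b"] by (simp add: card_cartesian_product)
  qed
  moreover have "(\<lambda>x. fst (h x)) ` S \<subseteq> B" using bij_betwE[OF h] by (auto simp: mem_Times_iff)
  ultimately show ?thesis using m by (intro exI[of _ "\<lambda>x. fst (h x)"]) (simp add: mult.commute)
qed

text \<open>The messages outside \<open>E'\<close> range freely, which multiplies every count by the
  same power.\<close>

lemma card_zero_ext_Collect:
  assumes E: "finite E" and E': "E' \<subseteq> E"
  shows "card {x \<in> PiE E (\<lambda>_. UNIV :: 'f::{finite,field} set). P (zero_ext E' x)}
    = card (UNIV :: 'f set) ^ (card E - card E') * card {z \<in> supported E'. P z}"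
proof -
  let ?\<Omega> = "PiE E (\<lambda>_. UNIV :: 'f set)" and ?S = "{z \<in> supported E'. P z}"
  have ps: "product_space ?\<Omega> E (card (UNIV :: 'f set))" using E by (rule product_space_PiE)
  have "finite E'" using E' E finite_subset by blast
  then have "finite (supported E' :: ('a \<Rightarrow> 'f) set)" by (rule card_supported(2))
  then have finS: "finite ?S" by simp
  have fin: "finite {x \<in> ?\<Omega>. P (zero_ext E' x)}" using ps unfolding product_space_def by simp
  have "card {x \<in> ?\<Omega>. P (zero_ext E' x)}
      = (\<Sum>z\<in>?S. card {x \<in> {x \<in> ?\<Omega>. P (zero_ext E' x)}. zero_ext E' x = z})"
  proof -
    have "zero_ext E' ` {x \<in> ?\<Omega>. P (zero_ext E' x)} \<subseteq> ?S"
      unfolding supported_def by (auto simp: zero_ext_def)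
    then show ?thesis using sum.group[OF fin finS, of "zero_ext E'" "\<lambda>_. 1 :: nat"] by simp
  qed
  also have "\<dots> = (\<Sum>z\<in>?S. card (UNIV :: 'f set) ^ (card E - card E'))"
  proof (rule sum.cong[OF refl])
    fix z assume z: "z \<in> ?S"
    have "{x \<in> {x \<in> ?\<Omega>. P (zero_ext E' x)}. zero_ext E' x = z} = {y \<in> ?\<Omega>. \<forall>e\<in>E'. y e = restrict z E e}"
    proof -
      have "zero_ext E' y = z \<longleftrightarrow> (\<forall>e\<in>E'. y e = restrict z E e)" for y
        using z E' unfolding supported_def zero_ext_def by (auto simp: fun_eq_iff)
      moreover have "{x \<in> {x \<in> ?\<Omega>. P (zero_ext E' x)}. zero_ext E' x = z} = {y \<in> ?\<Omega>. zero_ext E' y = z}"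
        using z by blast
      ultimately show ?thesis by (simp only:)
    qed
    moreover have "card {y \<in> ?\<Omega>. \<forall>e\<in>E'. y e = restrict z E e} = card (UNIV :: 'f set) ^ (card E - card E')"
    proof -
      have "restrict z E \<in> ?\<Omega>" by simp
      then show ?thesis using ps E' unfolding product_space_def by blast
    qed
    ultimately show "card {x \<in> {x \<in> ?\<Omega>. P (zero_ext E' x)}. zero_ext E' x = z}
       = card (UNIV :: 'f set) ^ (card E - card E')"
      by (simp only:)
  qed
  finally show ?thesis by (simp add: mult.commute)
qed

text \<open>By \<open>count\<close> the key is uniform on every transcript fibre. Summing over the
  fibres gives uniformity; comparing the two gives independence, so every logarithm in the mutual
  information is that of 1.\<close>

lemma generates_keys_intro:
  fixes kf :: "nat \<Rightarrow> ('m \<Rightarrow> 'f) \<Rightarrow> 'f list \<Rightarrow> 'f::{finite,field} list"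
  defines "q \<equiv> card (UNIV :: 'f set)"
  assumes \<Omega>: "\<Omega> = msg_space TYPE('f) n I" "finite \<Omega>" "\<Omega> \<noteq> {}"
    and T: "T = (\<lambda>x. trans I s g x t)"
    and key: "\<And>x j. x \<in> \<Omega> \<Longrightarrow> j < n \<Longrightarrow> kf j (restrict x (I j)) (T x) = K x" and n: "1 \<le> n"
    and len: "\<And>x. x \<in> \<Omega> \<Longrightarrow> length (K x) = tau"
    and count: "\<And>k v. length k = tau \<Longrightarrow> v \<in> T ` \<Omega> \<Longrightarrow>
      card {x \<in> \<Omega>. K x = k \<and> T x = v} * q ^ tau = card {x \<in> \<Omega>. T x = v}"
  shows "generates_keys TYPE('f) n I tau t s g kf"
proof -
  have q: "q > 0" unfolding q_def by (simp add: card_gt_0_iff)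
  have n\<Omega>: "card \<Omega> > 0" using \<Omega> by (simp add: card_gt_0_iff)
  let ?K = "\<lambda>x. kf 0 (restrict x (I 0)) (T x)"
  have K0: "?K x = K x" if "x \<in> \<Omega>" for x using key[OF that, of 0] n by simp
  have marg: "card {x \<in> \<Omega>. ?K x = k} * q ^ tau = card \<Omega>" if k: "length k = tau" for k
  proof -
    have "{x \<in> \<Omega>. ?K x = k} = {x \<in> \<Omega>. K x = k}" using K0 by auto
    moreover have "T ` {x \<in> \<Omega>. K x = k} \<subseteq> T ` \<Omega>" by blast
    then have "card {x \<in> \<Omega>. K x = k} = (\<Sum>v\<in>T ` \<Omega>. card {x \<in> {x \<in> \<Omega>. K x = k}. T x = v})"
      using sum.group[of "{x \<in> \<Omega>. K x = k}" "T ` \<Omega>" T "\<lambda>_. 1 :: nat"] \<Omega>(2) by auto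
    moreover have "{x \<in> {x \<in> \<Omega>. K x = k}. T x = v} = {x \<in> \<Omega>. K x = k \<and> T x = v}" for v by blast
    ultimately have "card {x \<in> \<Omega>. ?K x = k} * q ^ tau = (\<Sum>v\<in>T ` \<Omega>. card {x \<in> \<Omega>. K x = k \<and> T x = v} * q ^ tau)"
      by (simp add: sum_distrib_right)
    also have "\<dots> = (\<Sum>v\<in>T ` \<Omega>. card {x \<in> \<Omega>. T x = v})" using count[OF k] by (intro sum.cong refl) blast
    also have "\<dots> = card \<Omega>" using sum.group[of \<Omega> "T ` \<Omega>" T "\<lambda>_. 1 :: nat"] \<Omega>(2) by simp
    finally show ?thesis .
  qed
  have pk: "prob_u \<Omega> (\<lambda>x. ?K x = k) = 1 / real (q ^ tau)" if "length k = tau" for k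
  proof -
    have "real (card {x \<in> \<Omega>. ?K x = k}) * real (q ^ tau) = real (card \<Omega>)"
      unfolding of_nat_mult[symmetric] marg[OF that] ..
    then show ?thesis unfolding prob_u_def using q n\<Omega> by (simp add: field_simps)
  qed
  have indep: "prob_u \<Omega> (\<lambda>x. ?K x = k \<and> T x = v) = prob_u \<Omega> (\<lambda>x. ?K x = k) * prob_u \<Omega> (\<lambda>x. T x = v)"
    if "k \<in> ?K ` \<Omega>" "v \<in> T ` \<Omega>" for k v
  proof -
    have k: "length k = tau" using that K0 len by auto
    have eq: "{x \<in> \<Omega>. ?K x = k \<and> T x = v} = {x \<in> \<Omega>. K x = k \<and> T x = v}" using K0 by auto
    have "real (card {x \<in> \<Omega>. ?K x = k \<and> T x = v}) * real (q ^ tau) = real (card {x \<in> \<Omega>. T x = v})"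
      unfolding eq of_nat_mult[symmetric] count[OF k that(2)] ..
    then show ?thesis unfolding pk[OF k] unfolding prob_u_def using q n\<Omega> by (simp add: field_simps)
  qed
  have "mutual_info_u \<Omega> ?K T = 0"
    unfolding mutual_info_u_def
    by (intro sum.neutral ballI) (auto simp: Let_def indep)
  then show ?thesis
    unfolding generates_keys_def Let_def \<Omega>(1)[symmetric] T[symmetric, THEN fun_cong, simplified]
    using key K0 len pk unfolding q_def T by auto
qed

text \<open>Once every client recovers all messages of \<open>E'\<close>, any function of them can
  be the common key. Rank-nullity leaves at least \<open>q ^ tau\<close> vectors in each nonempty
  transcript fibre, with \<open>q\<close> the field size, and divisibility makes a balanced function
  possible.\<close>

lemma linear_protocol_of_decoding:
  fixes A :: "nat \<Rightarrow> 'm \<Rightarrow> 'f::{finite,field}" and I :: "nat \<Rightarrow> 'm set"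
  assumes n: "1 \<le> n" and fin: "\<forall>j<n. finite (I j)"
    and E': "E' \<subseteq> msg_indices n I" "t + tau \<le> card E'"
    and s: "\<And>r. r < t \<Longrightarrow> s r < n"
    and A: "\<And>r. r < t \<Longrightarrow> A r \<in> supported {e \<in> E'. e \<in> I (s r)}"
    and dec: "\<And>j x. j < n \<Longrightarrow> x \<in> supported {e \<in> E'. e \<notin> I j} \<Longrightarrow> (\<forall>r<t. dot E' (A r) x = 0) \<Longrightarrow> x = 0"
  shows "linear_protocol_generates TYPE('f) n I tau t"
proof -
  let ?q = "card (UNIV :: 'f set)"
  let ?E = "msg_indices n I" and ?\<Omega> = "msg_space TYPE('f) n I"
  let ?M = "supported E' :: ('m \<Rightarrow> 'f) set"
  have finE: "finite ?E" using fin by (rule finite_msg_indices)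
  have finE': "finite E'" using E'(1) finE finite_subset by blast
  define L where "L r x = (\<Sum>i\<in>I (s r). A r i * x i)" for r and x :: "'m \<Rightarrow> 'f"
  let ?T = "transcript L t"
  let ?g = "\<lambda>r y p. \<Sum>i\<in>I (s r). A r i * y i"
  have lin: "linear_forms L" using linear_forms_sum[where D = "\<lambda>r. I (s r)" and c = A] unfolding L_def .
  have L_dot: "L r x = dot E' (A r) x" if r: "r < t" for r x
  proof -
    have z: "A r e = 0" if "e \<notin> E' \<or> e \<notin> I (s r)" for e using A[OF r] that unfolding supported_def by auto
    have "L r x = (\<Sum>i\<in>I (s r) \<inter> E'. A r i * x i)"
      unfolding L_def using fin s[OF r] z by (intro sum.mono_neutral_right) auto
    also have "\<dots> = dot E' (A r) x"
      unfolding dot_def using finE' z by (intro sum.mono_neutral_left) auto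
    finally show ?thesis .
  qed
  have trans_T: "trans I s ?g x t = ?T x" for x unfolding trans_linear L_def ..
  have T_zero_ext: "?T (zero_ext E' x) = ?T x" for x
    unfolding transcript_eq_iff using L_dot by (simp add: dot_def zero_ext_def)
  have subM: "fun_space.subspace ?M" by (rule subspace_supported)
  have finM: "finite ?M" using card_supported(2)[OF finE'] .
  let ?U = "?M \<inter> annihilator L t"
  have q: "?q > 0" by (simp add: card_gt_0_iff)
  have "?q ^ t * ?q ^ tau \<le> ?q ^ card E'"
    using E'(2) q by (simp flip: power_add add: power_increasing)
  also have "\<dots> \<le> ?q ^ t * card ?U"
    using card_le_kernel[OF lin subM finM, of t] card_supported(1)[OF finE', where 'f='f] by simp
  finally have "?q ^ tau \<le> card ?U" using q by simp
  then have dvdU: "?q ^ tau dvd card ?U"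
    using finM subM by (intro card_subspace_dvd fun_space.subspace_inter subspace_annihilator lin) auto
  define B where "B = {k :: 'f list. length k = tau}"
  have "B = {k :: 'f list. set k \<subseteq> UNIV \<and> length k = tau}" unfolding B_def by simp
  then have cardB: "card B = ?q ^ tau" and finB: "finite B"
    using card_lists_length_eq[of "UNIV :: 'f set" tau] finite_lists_length_eq[of "UNIV :: 'f set" tau] by auto
  have neB: "B \<noteq> {}" using cardB q by (metis card.empty power_not_zero less_irrefl)
  have "\<exists>f. f ` {z \<in> ?M. ?T z = v} \<subseteq> B \<and> (\<forall>k\<in>B. card {z \<in> {z \<in> ?M. ?T z = v}. f z = k} * card B = card {z \<in> ?M. ?T z = v})"
    for v
  proof (rule ex_balanced_function)
    show "card B dvd card {z \<in> ?M. ?T z = v}"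
    proof (cases "\<exists>z\<in>?M. ?T z = v")
      case True
      then obtain z where "z \<in> ?M" "v = ?T z" by blast
      then have "card {z \<in> ?M. ?T z = v} = card ?U" using card_transcript_fibre[OF lin subM] by simp
      then show ?thesis using dvdU cardB by simp
    next
      case False
      then have "{z \<in> ?M. ?T z = v} = {}" by blast
      then show ?thesis by (simp only: card.empty dvd_0_right)
    qed
  qed (use finM finB neB in auto)
  then have "\<forall>v. \<exists>f. f ` {z \<in> ?M. ?T z = v} \<subseteq> B \<and> (\<forall>k\<in>B. card {z \<in> {z \<in> ?M. ?T z = v}. f z = k} * card B = card {z \<in> ?M. ?T z = v})"
    by (rule allI)
  from choice[OF this] obtain f where ff: "\<forall>v. f v ` {z \<in> ?M. ?T z = v} \<subseteq> B
      \<and> (\<forall>k\<in>B. card {z \<in> {z \<in> ?M. ?T z = v}. f v z = k} * card B = card {z \<in> ?M. ?T z = v})"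
    by (elim exE) (rule that)
  have f: "f v ` {z \<in> ?M. ?T z = v} \<subseteq> B"
    "k \<in> B \<Longrightarrow> card {z \<in> {z \<in> ?M. ?T z = v}. f v z = k} * card B = card {z \<in> ?M. ?T z = v}" for v k
    using ff by blast+
  define K where "K x = f (?T x) (zero_ext E' x)" for x
  \<comment> \<open>Client \<open>j\<close> looks for a vector on \<open>E'\<close> consistent with
    the transcript and its own messages. By \<open>dec\<close> it is unique, so \<open>SOME\<close>
    returns the true one.\<close>
  define decodes where "decodes j y v z \<longleftrightarrow> z \<in> ?M \<and> ?T z = v \<and> (\<forall>e\<in>E' \<inter> I j. z e = y e)" for j y v z
  define kf where "kf j y v = f v (SOME z. decodes j y v z)" for j y v
  have zM: "zero_ext E' x \<in> ?M" for x :: "'m \<Rightarrow> 'f" unfolding supported_def zero_ext_def by simp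
  have "generates_keys TYPE('f) n I tau t s ?g kf"
  proof (rule generates_keys_intro[where \<Omega> = ?\<Omega> and T = ?T and K = K])
    show "finite ?\<Omega>" "?\<Omega> \<noteq> {}"
      using product_space_PiE[OF finE, where 'f='f] unfolding msg_space_def product_space_def by auto
    show "?T = (\<lambda>x. trans I s ?g x t)" unfolding trans_T ..
    show "kf j (restrict x (I j)) (?T x) = K x" if j: "j < n" for x j
    proof -
      have d: "decodes j (restrict x (I j)) (?T x) (zero_ext E' x)"
        unfolding decodes_def using zM T_zero_ext by (auto simp: zero_ext_def)
      have uniq: "z = zero_ext E' x" if z: "decodes j (restrict x (I j)) (?T x) z" for z
      proof -
        have 1: "z - zero_ext E' x \<in> supported {e \<in> E'. e \<notin> I j}"
          unfolding supported_def
        proof (intro CollectI allI impI)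
          fix i assume i: "i \<notin> {e \<in> E'. e \<notin> I j}"
          show "(z - zero_ext E' x) i = 0"
          proof (cases "i \<in> E'")
            case True
            then have "z i = zero_ext E' x i" using i z d unfolding decodes_def by simp
            then show ?thesis by simp
          next
            case False
            then show ?thesis using z zM[of x] unfolding decodes_def supported_def by simp
          qed
        qed
        have "L r (z - zero_ext E' x) = 0" if "r < t" for r
        proof -
          have "?T z = ?T (zero_ext E' x)" using z d unfolding decodes_def by simp
          then show ?thesis using that unfolding transcript_eq_iff by (simp add: linear_formsD(4)[OF lin])
        qed
        then have "z - zero_ext E' x = 0" using dec[OF j 1] L_dot by simp
        then show ?thesis by simp
      qed
      have "(SOME z. decodes j (restrict x (I j)) (?T x) z) = zero_ext E' x"
        using d uniq by (rule some_equality)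
      then show ?thesis unfolding kf_def K_def by simp
    qed
    show "length (K x) = tau" for x
    proof -
      have "zero_ext E' x \<in> {z \<in> ?M. ?T z = ?T x}" using zM T_zero_ext by simp
      then have "K x \<in> B" using f(1)[of "?T x"] unfolding K_def by blast
      then show ?thesis unfolding B_def by simp
    qed
    show "card {x \<in> ?\<Omega>. K x = k \<and> ?T x = v} * ?q ^ tau = card {x \<in> ?\<Omega>. ?T x = v}"
      if k: "length k = tau" for k v
    proof -
      let ?Q = "?q ^ (card ?E - card E')"
      have "{x \<in> ?\<Omega>. K x = k \<and> ?T x = v}
          = {x \<in> ?\<Omega>. f v (zero_ext E' x) = k \<and> ?T (zero_ext E' x) = v}"
        unfolding K_def T_zero_ext by auto
      then have 1: "card {x \<in> ?\<Omega>. K x = k \<and> ?T x = v} = ?Q * card {z \<in> ?M. f v z = k \<and> ?T z = v}"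
        unfolding msg_space_def
        using card_zero_ext_Collect[OF finE E'(1), of "\<lambda>z. f v z = k \<and> ?T z = v"] by simp
      have "card {x \<in> ?\<Omega>. ?T (zero_ext E' x) = v} = ?Q * card {z \<in> ?M. ?T z = v}"
        unfolding msg_space_def by (rule card_zero_ext_Collect[OF finE E'(1)])
      then have 2: "card {x \<in> ?\<Omega>. ?T x = v} = ?Q * card {z \<in> ?M. ?T z = v}" unfolding T_zero_ext .
      have "{z \<in> {z \<in> ?M. ?T z = v}. f v z = k} = {z \<in> ?M. f v z = k \<and> ?T z = v}" by blast
      then have "card {z \<in> ?M. f v z = k \<and> ?T z = v} * ?q ^ tau = card {z \<in> ?M. ?T z = v}"
        using f(2)[of k v] k unfolding cardB by (simp add: B_def)
      then show ?thesis unfolding 1 2 by simp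
    qed
  qed (use n in auto)
  then show ?thesis using s unfolding linear_protocol_generates_def by blast
qed

section \<open>From rates to a protocol\<close>

text \<open>Linear broadcasts ignore earlier ones, so only how often each client speaks matters; any
  bijection between rounds and slots \<open>(v, i)\<close> with \<open>i < m v\<close> will
  do.\<close>

lemma ex_schedule:
  assumes V: "finite V"
  shows "\<exists>s. (\<forall>k<sum m V. s k \<in> V) \<and> (\<forall>S\<subseteq>V. card {k. k < sum m V \<and> s k \<in> S} = sum m S)"
proof -
  have "card {..<sum m V} = card (Sigma V (\<lambda>v. {..<m v}))" using V by simp
  then obtain h where h: "bij_betw h {..<sum m V} (Sigma V (\<lambda>v. {..<m v}))"
    using V finite_same_card_bij[of "{..<sum m V}" "Sigma V (\<lambda>v. {..<m v})"] by blast
  have "card {k. k < sum m V \<and> fst (h k) \<in> S} = sum m S" if "S \<subseteq> V" for S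
  proof -
    have "{y \<in> Sigma V (\<lambda>v. {..<m v}). fst y \<in> S} = Sigma S (\<lambda>v. {..<m v})" using that by auto
    moreover have "finite S" using that V finite_subset by blast
    ultimately show ?thesis using bij_betw_card_Collect[OF h, of "\<lambda>y. fst y \<in> S"] by simp
  qed
  moreover have "fst (h k) \<in> V" if "k < sum m V" for k
    using bij_betwE[OF h] that by (metis SigmaD1 lessThan_iff prod.collapse)
  ultimately show ?thesis by (intro exI[of _ "\<lambda>k. fst (h k)"]) blast
qed

theorem partition_connected_imp_linear_protocol:
  fixes I :: "nat \<Rightarrow> 'm set"
  assumes n: "2 \<le> n" and fin: "\<forall>j<n. finite (I j)"
    and q: "n < card (UNIV :: 'f::{finite,field} set)"
    and E': "E' \<subseteq> msg_indices n I"
    and pc: "partition_connected tau {0..<n} E' (hyp_inc n I)"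
  shows "linear_protocol_generates TYPE('f) n I tau (card E' - tau)"
proof -
  let ?V = "{0..<n}" and ?inc = "hyp_inc n I"
  have finE': "finite E'" using E' finite_msg_indices[OF fin] finite_subset by blast
  have inc: "?inc e \<subseteq> ?V" "?inc e \<noteq> {}" if "e \<in> E'" for e
    using hyp_inc_incidence(1)[of n I e] hyp_inc_incidence(2)[of e n I] E' that by auto
  obtain r :: "nat \<Rightarrow> int" where
    r: "\<And>S. S \<subseteq> ?V \<Longrightarrow> S \<noteq> {} \<Longrightarrow> sum r S \<le> int (touching E' ?inc S) - int tau"
    and rV: "sum r ?V = int (card E') - int tau"
    using partition_connected_base[of ?V E' ?inc tau] inc finE' pc n by auto
  have inside: "int (card {e \<in> E'. ?inc e \<inter> (?V - S) = {}}) \<le> sum r S" if "S \<subset> ?V" for S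
    using base_complement[of ?V E' r ?inc "int tau" S] r rV finE' that by auto
  \<comment> \<open>With at least two clients a singleton is a proper subset, so the lower bound
    applies; for a single client the rate could be negative.\<close>
  have r_nonneg: "0 \<le> r v" if "v \<in> ?V" for v
  proof -
    have "{v} \<noteq> ?V" using n by (metis card_atLeastLessThan card.empty card.insert diff_zero finite.emptyI
          insert_absorb not_less_eq_eq numeral_2_eq_2 One_nat_def singletonI empty_iff le_refl)
    then have "{v} \<subset> ?V" using that by blast
    then show ?thesis using inside[of "{v}"] by simp
  qed
  define m where "m v = nat (r v)" for v
  have sum_m: "int (sum m S) = sum r S" if "S \<subseteq> ?V" for S
    unfolding m_def using r_nonneg that by (simp add: subset_iff)
  define t where "t = sum m ?V"
  \<comment> \<open>As \<open>t\<close> is a natural number, this also shows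
    \<open>tau \<le> card E'\<close>, so that \<open>card E' - tau\<close> is not truncated.\<close>
  have t_int: "int t = int (card E') - int tau" unfolding t_def using sum_m[of ?V] rV by simp
  then have t: "t = card E' - tau" and t_le: "t + tau \<le> card E'" by linarith+
  obtain s where s: "\<And>k. k < t \<Longrightarrow> s k \<in> ?V"
    and card_s: "\<And>S. S \<subseteq> ?V \<Longrightarrow> card {k. k < t \<and> s k \<in> S} = sum m S"
    using ex_schedule[of ?V m] unfolding t_def by auto
  define C where "C l = {e \<in> E'. e \<notin> I l}" for l
  have "\<exists>g. inj_on g (C l) \<and> (\<forall>e\<in>C l. g e \<in> {k. k < t \<and> s k \<in> ?inc e})" if l: "l < n" for l
  proof (rule hall_marriage)
    show "finite (C l)" unfolding C_def using finE' by simp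
    show "\<forall>e\<in>C l. finite {k. k < t \<and> s k \<in> ?inc e}" by simp
    show "\<forall>X\<subseteq>C l. card X \<le> card (\<Union>((\<lambda>e. {k. k < t \<and> s k \<in> ?inc e}) ` X))"
    proof (intro allI impI)
      fix X assume X: "X \<subseteq> C l"
      let ?S = "\<Union>(?inc ` X)"
      \<comment> \<open>Client \<open>l\<close> holds none of the messages in \<open>X\<close>. This
        makes \<open>?S\<close> proper, as the lower bound on \<open>r\<close> demands.\<close>
      have "l \<notin> ?S" using X unfolding C_def hyp_inc_def by auto
      moreover have "?S \<subseteq> ?V" by (auto simp: hyp_inc_def)
      ultimately have S: "?S \<subset> ?V" using l by auto
      have "(\<Union>((\<lambda>e. {k. k < t \<and> s k \<in> ?inc e}) ` X)) = {k. k < t \<and> s k \<in> ?S}" by blast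
      then have "int (card (\<Union>((\<lambda>e. {k. k < t \<and> s k \<in> ?inc e}) ` X))) = sum r ?S"
        using card_s[of ?S] sum_m[of ?S] S by (metis psubset_imp_subset)
      moreover have "card X \<le> card {e \<in> E'. ?inc e \<inter> (?V - ?S) = {}}"
        using X finE' unfolding C_def by (intro card_mono) auto
      ultimately show "card X \<le> card (\<Union>((\<lambda>e. {k. k < t \<and> s k \<in> ?inc e}) ` X))"
        using inside[OF S] by linarith
    qed
  qed
  then obtain g where g_inj: "\<And>l. l < n \<Longrightarrow> inj_on (g l) (C l)"
    and g: "\<And>l e. l < n \<Longrightarrow> e \<in> C l \<Longrightarrow> g l e < t \<and> s (g l e) \<in> ?inc e"
    by (metis (no_types, lifting) mem_Collect_eq)
  \<comment> \<open>Each message that \<open>l\<close> lacks gets a round of its own, sent by a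
    client who holds it. In that round the row of \<open>B l\<close> reads off just this
    message.\<close>
  define B where "B l k e = (if e \<in> C l \<and> g l e = k then 1 else 0 :: 'f)" for l k e
  have "\<exists>A. (\<forall>k<t. A k \<in> supported {e \<in> E'. e \<in> I (s k)})
     \<and> (\<forall>l<n. \<forall>x\<in>supported (C l). (\<forall>k<t. dot E' (A k) x = (0 :: 'f)) \<longrightarrow> x = 0)"
  proof (rule ex_common_matrix[OF q])
    show "fun_space.subspace (supported (C l))" for l by (rule subspace_supported)
    show "B l k \<in> supported {e \<in> E'. e \<in> I (s k)}" if "l < n" for l k
      using g[OF that] unfolding B_def supported_def by (auto simp: C_def hyp_inc_def)
    show "x = 0" if l: "l < n" and x: "x \<in> supported (C l)" and z: "\<forall>k<t. dot E' (B l k) x = 0" for l x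
    proof -
      have "x e = 0" for e
      proof (cases "e \<in> C l")
        case True
        have "dot E' (B l (g l e)) x = (\<Sum>e'\<in>E'. if e' = e then x e' else 0)"
          unfolding dot_def
        proof (rule sum.cong[OF refl])
          fix e'
          have "e' \<in> C l \<and> g l e' = g l e \<longleftrightarrow> e' = e" using True g_inj[OF l] by (auto dest: inj_onD)
          then show "B l (g l e) e' * x e' = (if e' = e then x e' else 0)" unfolding B_def by simp
        qed
        also have "\<dots> = x e" using True finE' by (simp add: C_def)
        finally show ?thesis using z g[OF l True] by simp
      qed (use x in \<open>simp add: supported_def\<close>)
      then show ?thesis by (simp add: fun_eq_iff)
    qed
  qed
  then obtain A :: "nat \<Rightarrow> 'm \<Rightarrow> 'f" where A: "\<And>k. k < t \<Longrightarrow> A k \<in> supported {e \<in> E'. e \<in> I (s k)}"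
    and dec: "\<And>l x. l < n \<Longrightarrow> x \<in> supported (C l) \<Longrightarrow> (\<forall>k<t. dot E' (A k) x = 0) \<Longrightarrow> x = 0"
    by blast
  have "linear_protocol_generates TYPE('f) n I tau t"
    using linear_protocol_of_decoding[of n I E' t tau s A] n fin E' t_le s A dec unfolding C_def by simp
  then show ?thesis unfolding t .
qed

text \<open>The partition inequality says nothing here; the supply of messages follows from the
  given key, since a key value of probability \<open>1 / q ^ tau\<close>, with \<open>q\<close> the
  field size, forces \<open>tau \<le> card (I 0)\<close>. Any \<open>tau\<close> of the client's
  messages then feed a key without transmissions.\<close>

lemma single_client_linear_protocol:
  fixes I :: "nat \<Rightarrow> 'm set"
  assumes fin: "finite (I 0)" and pg: "protocol_generates TYPE('f::{finite,field}) 1 I tau t"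
  shows "linear_protocol_generates TYPE('f) 1 I tau 0"
proof -
  let ?q = "card (UNIV :: 'f set)" and ?\<Omega> = "msg_space TYPE('f) 1 I"
  have fin1: "\<forall>j<1. finite (I j)" using fin by simp
  have E: "msg_indices 1 I = I 0" unfolding msg_indices_def by auto
  obtain K :: "('m \<Rightarrow> 'f) \<Rightarrow> 'f list" where
    "\<forall>k. length k = tau \<longrightarrow> prob_u ?\<Omega> (\<lambda>x. K x = k) = 1 / real (?q ^ tau)"
    using pg unfolding protocol_generates_def generates_keys_def Let_def by auto
  then have p: "prob_u ?\<Omega> (\<lambda>x. K x = replicate tau 0) = 1 / real (?q ^ tau)" by simp
  have card\<Omega>: "card ?\<Omega> = ?q ^ card (I 0)" unfolding msg_space_def E using fin by (simp add: card_PiE)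
  have q: "?q \<ge> 2" using product_space_PiE[OF fin, where 'f='f] unfolding product_space_def by blast
  let ?a = "card {x \<in> ?\<Omega>. K x = replicate tau 0}"
  have "real ?a * real (?q ^ tau) = real (?q ^ card (I 0))"
    using p q unfolding prob_u_def card\<Omega> by (simp add: field_simps)
  then have eq: "?a * ?q ^ tau = ?q ^ card (I 0)" by (simp only: of_nat_mult[symmetric] of_nat_eq_iff)
  then have "?a \<ge> 1" using q by (metis One_nat_def Suc_leI gr0I mult_0 not_numeral_le_zero power_not_zero)
  then have "1 * ?q ^ tau \<le> ?a * ?q ^ tau" by (rule mult_le_mono1)
  then have "?q ^ tau \<le> ?q ^ card (I 0)" unfolding eq by simp
  then have "tau \<le> card (I 0)" using q by simp
  then obtain E' where E': "E' \<subseteq> I 0" "card E' = tau" by (meson obtain_subset_with_card_n)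
  show ?thesis
  proof (rule linear_protocol_of_decoding[OF _ fin1, of E' 0 tau "\<lambda>_. 0" "\<lambda>_ _. 0"])
    show "x = 0" if "j < 1" "x \<in> supported {e \<in> E'. e \<notin> I j}" for j and x :: "'m \<Rightarrow> 'f"
      using that E'(1) unfolding supported_def by (auto simp: fun_eq_iff)
  qed (use E' E in auto)
qed

theorem theorem11:
  fixes n tau :: nat and I :: "nat \<Rightarrow> 'm set"
  assumes "1 \<le> tau" and "1 \<le> n"
    and "\<forall>j<n. finite (I j)"
    and "card (UNIV :: ('f::{finite,field}) set) > n"
    and "\<exists>t. protocol_generates TYPE('f) n I tau t"
  shows "S_L TYPE('f) n I tau = rho tau {0..<n} (msg_indices n I) (hyp_inc n I) - tau"
proof -
  let ?V = "{0..<n}" and ?E = "msg_indices n I" and ?inc = "hyp_inc n I"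
  let ?\<rho> = "rho tau ?V ?E ?inc"
  let ?lp = "linear_protocol_generates TYPE('f) n I tau"
  let ?ok = "\<lambda>k. \<exists>E'. E' \<subseteq> ?E \<and> card E' = k \<and> inherently_connected tau ?V E' ?inc"
  note n = assms(2) and fin = assms(3)
  obtain t where pg: "protocol_generates TYPE('f) n I tau t" using assms(5) by blast
  have V: "finite ?V" "?V \<noteq> {}" using n by auto
  have finE: "finite E'" if "E' \<subseteq> ?E" for E' using that finite_msg_indices[OF fin] finite_subset by blast
  have ic_iff: "inherently_connected tau ?V E' ?inc \<longleftrightarrow> partition_connected tau ?V E' ?inc"
    if E': "E' \<subseteq> ?E" for E'
  proof -
    have inc: "?inc e \<subseteq> ?V" "?inc e \<noteq> {}" if "e \<in> E'" for e
      using hyp_inc_incidence(1)[of n I e] hyp_inc_incidence(2)[of e n I] E' that by auto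
    show ?thesis
      using inherently_connected_imp_partition_connected[where inc = ?inc and tau = tau, OF V finE[OF E'] inc]
        partition_connected_imp_inherently_connected[where inc = ?inc and tau = tau, OF V finE[OF E'] inc]
      by blast
  qed
  have "?ok (card ?E)"
    using protocol_imp_partition_connected[OF n fin pg] ic_iff[of ?E] by blast
  then have "?ok ?\<rho>" unfolding rho_def by (rule LeastI)
  then obtain E' where E': "E' \<subseteq> ?E" "card E' = ?\<rho>" "partition_connected tau ?V E' ?inc"
    using ic_iff by blast
  \<comment> \<open>For one client the empty hypergraph qualifies, so \<open>?\<rho>\<close> is 0
    and the natural subtraction also gives 0. Otherwise an optimal \<open>E'\<close> supplies the
    protocol.\<close>
  have lp: "?lp (?\<rho> - tau)"
  proof (cases "n = 1")
    case True
    have "partition_connected tau ?V {} ?inc"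
      unfolding partition_connected_def using True by simp
    then have "?ok 0" using ic_iff[of "{}"] by (intro exI[of _ "{}"]) simp
    then have "?\<rho> \<le> 0" unfolding rho_def by (rule Least_le)
    then show ?thesis using single_client_linear_protocol[of I tau t] pg fin True by simp
  next
    case False
    then show ?thesis
      using partition_connected_imp_linear_protocol[OF _ fin assms(4) E'(1,3)] n E'(2) by simp
  qed
  \<comment> \<open>Thinning the messages turns any linear protocol into a candidate for
    \<open>rho\<close> with at most \<open>t + tau\<close> hyperedges.\<close>
  have "?\<rho> - tau \<le> t" if t: "?lp t" for t
  proof -
    obtain E'' where E'': "E'' \<subseteq> ?E" "card E'' \<le> t + tau" "partition_connected tau ?V E'' ?inc"
      using linear_protocol_converse[OF n fin t] by blast
    then have "?ok (card E'')" using ic_iff by blast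
    then have "?\<rho> \<le> card E''" unfolding rho_def by (rule Least_le)
    then show ?thesis using E''(2) by linarith
  qed
  then show ?thesis unfolding S_L_def using lp by (intro Least_equality)
qed

end
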